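(* Let $n\geq7$ be an integer and $b>0$. For $0<a<\pi/2$ let $\varphi_a:B^n\to E^n(b)$ be the map $\varphi_a(x)=\left(\sin a\,\frac{x}{|x|},\,b\cos a\right)$. Then there exists $a\in(0,\pi/2)$ such that $\varphi_a$ is a proper weakly triharmonic map if and only if $$0<b^2<\frac{n-1}{4(n-6)}.$$
   Context: $B^n\subset\mathbb{R}^n$ is the Euclidean unit ball with centre $O$, and $E^n(b)=\left\{(x,y)\in\mathbb{R}^n\times\mathbb{R}: |x|^2+\frac{y^2}{b^2}=1\right\}$ is the rotationally symmetric ellipsoid with the Riemannian metric induced from $\mathbb{R}^{n+1}$. For a smooth map $\varphi:(M,g_M)\to(N,g_N)$, $m=\dim M$, the tension field is $\tau(\varphi)=\mathrm{trace}_{g_M}\nabla d\varphi$; $\varphi$ is harmonic if $\tau(\varphi)=0$, and triharmonic ($3$-harmonic) if it is a critical point of the trienergy $E_3(\varphi)=\frac12\int_M\sum_{j=1}^m|\nabla^\varphi_{e_j}\tau(\varphi)|^2\,dV$, where $\{e_j\}$ is a local orthonormal frame and $\nabla^\varphi$ the induced connection on $\varphi^{-1}TN$. $W^{3,2}(B^n,E^n(b))$ is the set of $\varphi\in W^{3,2}(B^n,\mathbb{R}^{n+1})$ with $\varphi(x)\in E^n(b)$ a.e. A map in $W^{3,2}(B^n,E^n(b))$ is weakly triharmonic if it solves the Euler-Lagrange equation of $E_3$ in the sense of distributions. For the maps $\varphi_a$, which are smooth away from $O$, this is used in the equivalent form: $\varphi_a\in W^{3,2}(B^n,E^n(b))$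 and $\varphi_a$ is triharmonic on $B^n\setminus\{O\}$. Such a map is proper if it is not (weakly) harmonic. *)

theory Defs
  imports "HOL-Analysis.Analysis"
begin

section \<open>Partial derivatives and smooth maps\<close>

definition dir_deriv ::
  "'a::euclidean_space \<Rightarrow> ('a \<Rightarrow> 'b::euclidean_space) \<Rightarrow> 'a \<Rightarrow> 'b" where
  "dir_deriv v f x = frechet_derivative f (at x) v"

primrec iter_deriv ::
  "'a::euclidean_space list \<Rightarrow> ('a \<Rightarrow> 'b::euclidean_space) \<Rightarrow> 'a \<Rightarrow> 'b" where
  "iter_deriv [] f = f"
| "iter_deriv (v # vs) f = dir_deriv v (iter_deriv vs f)"

text \<open>\<open>C\<^sup>\<infinity>\<close> on an open set: all iterated partial derivatives exist and are again
  Frechet differentiable (hence continuous).\<close>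

definition smooth_on ::
  "'a::euclidean_space set \<Rightarrow> ('a \<Rightarrow> 'b::euclidean_space) \<Rightarrow> bool" where
  "smooth_on U f \<longleftrightarrow> (\<forall>vs\<in>lists Basis. \<forall>x\<in>U. iter_deriv vs f differentiable (at x))"


section \<open>Sobolev spaces\<close>

definition test_function :: "'a::euclidean_space set \<Rightarrow> ('a \<Rightarrow> real) \<Rightarrow> bool" where
  "test_function U \<eta> \<longleftrightarrow>
     smooth_on UNIV \<eta> \<and> compact (closure {x. \<eta> x \<noteq> 0}) \<and> closure {x. \<eta> x \<noteq> 0} \<subseteq> U"

definition L2_on ::
  "'a::euclidean_space set \<Rightarrow> ('a \<Rightarrow> 'b::euclidean_space) \<Rightarrow> bool" where
  "L2_on U f \<longleftrightarrow>
     f \<in> borel_measurable (lebesgue_on U) \<and> integrable (lebesgue_on U) (\<lambda>x. (norm (f x))\<^sup>2)"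

text \<open>A multi-index is given as a list of basis vectors, its order being the length of the list.\<close>

definition is_weak_deriv ::
  "'a::euclidean_space set \<Rightarrow> 'a list \<Rightarrow> ('a \<Rightarrow> 'b::euclidean_space) \<Rightarrow> ('a \<Rightarrow> 'b) \<Rightarrow> bool" where
  "is_weak_deriv U vs f g \<longleftrightarrow>
     (\<forall>\<eta>. test_function U \<eta> \<longrightarrow>
        (\<integral>x. iter_deriv vs \<eta> x *\<^sub>R f x \<partial>lebesgue_on U) =
        (-1) ^ length vs *\<^sub>R (\<integral>x. \<eta> x *\<^sub>R g x \<partial>lebesgue_on U))"

text \<open>\<open>W\<^sup>k\<^sup>,\<^sup>2(U, \<real>\<^sup>q)\<close>, with \<open>\<real>\<^sup>q\<close> the Euclidean space \<open>'b\<close>.\<close>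

definition sobolev ::
  "nat \<Rightarrow> 'a::euclidean_space set \<Rightarrow> ('a \<Rightarrow> 'b::euclidean_space) \<Rightarrow> bool" where
  "sobolev k U f \<longleftrightarrow> L2_on U f \<and>
     (\<forall>vs\<in>lists Basis. length vs \<le> k \<longrightarrow> (\<exists>g. L2_on U g \<and> is_weak_deriv U vs f g))"

definition sobolev_into ::
  "nat \<Rightarrow> 'a::euclidean_space set \<Rightarrow> 'b::euclidean_space set \<Rightarrow> ('a \<Rightarrow> 'b) \<Rightarrow> bool" where
  "sobolev_into k U N f \<longleftrightarrow> sobolev k U f \<and> (AE x in lebesgue_on U. f x \<in> N)"


section \<open>Harmonic and triharmonic maps into a submanifold of Euclidean space\<close>

text \<open>Here \<open>N\<close> is an embedded submanifold of the Euclidean space \<open>'b\<close> with the induced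
  Riemannian metric, and the domain is an open subset of the flat space \<open>'a\<close>.\<close>

definition tangent_space :: "'b::euclidean_space set \<Rightarrow> 'b \<Rightarrow> 'b set" where
  "tangent_space N p =
     {v. \<exists>\<gamma>::real \<Rightarrow> 'b. (\<forall>t. \<gamma> t \<in> N) \<and> \<gamma> 0 = p \<and> (\<gamma> has_vector_derivative v) (at 0)}"

text \<open>On a linear subspace the closest point is the orthogonal projection.\<close>

definition tangent_proj :: "'b::euclidean_space set \<Rightarrow> 'b \<Rightarrow> 'b \<Rightarrow> 'b" where
  "tangent_proj N p v = closest_point (tangent_space N p) v"

text \<open>The Levi-Civita connection of the induced metric is the tangential part of the ambient
  derivative; so for a vector field \<open>V\<close> along \<open>\<phi>\<close> (a section of the pullback bundle
  \<open>\<phi>\<^sup>-\<^sup>1TN\<close>) the induced connection \<open>\<nabla>\<^sup>\<phi>\<^sub>v V\<close> is the following.\<close>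

definition induced_conn ::
  "'b::euclidean_space set \<Rightarrow> ('a::euclidean_space \<Rightarrow> 'b) \<Rightarrow> 'a \<Rightarrow> ('a \<Rightarrow> 'b) \<Rightarrow> 'a \<Rightarrow> 'b" where
  "induced_conn N \<phi> v V x = tangent_proj N (\<phi> x) (dir_deriv v V x)"

text \<open>\<open>\<tau>(\<phi>) = trace \<nabla>d\<phi>\<close>. The standard orthonormal basis is a parallel frame of the flat domain,
  so \<open>(\<nabla>d\<phi>)(e, e) = \<nabla>\<^sup>\<phi>\<^sub>e (d\<phi>(e))\<close>.\<close>

definition tension ::
  "'b::euclidean_space set \<Rightarrow> ('a::euclidean_space \<Rightarrow> 'b) \<Rightarrow> 'a \<Rightarrow> 'b" where
  "tension N \<phi> x = (\<Sum>e\<in>Basis. induced_conn N \<phi> e (dir_deriv e \<phi>) x)"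

definition trienergy ::
  "'b::euclidean_space set \<Rightarrow> 'a::euclidean_space set \<Rightarrow> ('a \<Rightarrow> 'b) \<Rightarrow> real" where
  "trienergy N K \<phi> =
     1 / 2 * (\<integral>x. (\<Sum>e\<in>Basis. (norm (induced_conn N \<phi> e (tension N \<phi>) x))\<^sup>2) \<partial>lebesgue_on K)"

definition smooth_map ::
  "'a::euclidean_space set \<Rightarrow> 'b::euclidean_space set \<Rightarrow> ('a \<Rightarrow> 'b) \<Rightarrow> bool" where
  "smooth_map U N \<phi> \<longleftrightarrow> smooth_on U \<phi> \<and> \<phi> ` U \<subseteq> N"

definition harmonic_on ::
  "'a::euclidean_space set \<Rightarrow> 'b::euclidean_space set \<Rightarrow> ('a \<Rightarrow> 'b) \<Rightarrow> bool" where
  "harmonic_on U N \<phi> \<longleftrightarrow> smooth_map U N \<phi> \<and> (\<forall>x\<in>U. tension N \<phi> x = 0)"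

text \<open>A smooth one-parameter variation of \<open>\<phi>\<close> through maps into \<open>N\<close>, supported in \<open>K\<close>.\<close>

definition variation ::
  "'a::euclidean_space set \<Rightarrow> 'b::euclidean_space set \<Rightarrow> 'a set \<Rightarrow> ('a \<Rightarrow> 'b) \<Rightarrow>
    (real \<Rightarrow> 'a \<Rightarrow> 'b) \<Rightarrow> bool" where
  "variation U N K \<phi> \<Phi> \<longleftrightarrow>
     (\<exists>\<epsilon>>0. smooth_map ({-\<epsilon><..<\<epsilon>} \<times> U) N (\<lambda>(t, x). \<Phi> t x) \<and>
        (\<forall>x\<in>U. \<Phi> 0 x = \<phi> x) \<and>
        (\<forall>t\<in>{-\<epsilon><..<\<epsilon>}. \<forall>x\<in>U - K. \<Phi> t x = \<phi> x))"

text \<open>Critical points of the trienergy with respect to compactly supported variations. The energy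
  is integrated over \<open>K\<close> only: off \<open>K\<close> the integrand does not depend on \<open>t\<close>, while its integral
  over the whole of \<open>U\<close> need not be finite.\<close>

definition triharmonic_on ::
  "'a::euclidean_space set \<Rightarrow> 'b::euclidean_space set \<Rightarrow> ('a \<Rightarrow> 'b) \<Rightarrow> bool" where
  "triharmonic_on U N \<phi> \<longleftrightarrow> smooth_map U N \<phi> \<and>
     (\<forall>K \<Phi>. compact K \<and> K \<subseteq> U \<and> variation U N K \<phi> \<Phi> \<longrightarrow>
        ((\<lambda>t. trienergy N K (\<Phi> t)) has_real_derivative 0) (at 0))"

text \<open>Weak (tri)harmonicity for maps of the unit ball that are smooth away from its centre:
  the Sobolev condition together with (tri)harmonicity on the punctured ball. For such maps this
  is the form of the distributional Euler-Lagrange equation that is used for the maps \<open>\<phi>\<^sub>a\<close>.\<close>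

definition weakly_harmonic ::
  "'b::euclidean_space set \<Rightarrow> ('a::euclidean_space \<Rightarrow> 'b) \<Rightarrow> bool" where
  "weakly_harmonic N \<phi> \<longleftrightarrow>
     sobolev_into 1 (ball 0 1) N \<phi> \<and> harmonic_on (ball 0 1 - {0}) N \<phi>"

definition weakly_triharmonic ::
  "'b::euclidean_space set \<Rightarrow> ('a::euclidean_space \<Rightarrow> 'b) \<Rightarrow> bool" where
  "weakly_triharmonic N \<phi> \<longleftrightarrow>
     sobolev_into 3 (ball 0 1) N \<phi> \<and> triharmonic_on (ball 0 1 - {0}) N \<phi>"

definition proper_weakly_triharmonic ::
  "'b::euclidean_space set \<Rightarrow> ('a::euclidean_space \<Rightarrow> 'b) \<Rightarrow> bool" where
  "proper_weakly_triharmonic N \<phi> \<longleftrightarrow> weakly_triharmonic N \<phi> \<and> \<not> weakly_harmonic N \<phi>"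


section \<open>The ellipsoid and the maps \<open>\<phi>\<^sub>a\<close>\<close>

definition ellipsoid :: "real \<Rightarrow> ((real ^ 'n) \<times> real) set" where
  "ellipsoid b = {(x, y). (norm x)\<^sup>2 + y\<^sup>2 / b\<^sup>2 = 1}"

definition phi :: "real \<Rightarrow> real \<Rightarrow> real ^ 'n \<Rightarrow> (real ^ 'n) \<times> real" where
  "phi b a x = (sin a *\<^sub>R (x /\<^sub>R norm x), b * cos a)"

end

theory Submission
  imports Defs
begin

text \<open>Write \<open>r = |x|\<close>, \<open>S = sin\<^sup>2 a\<close>, and let \<open>t = (cos a \<cdot> x/r, - b sin a)\<close> be the meridian direction of the
  ellipsoid along \<open>\<phi>\<^sub>a\<close>. The tension field of \<open>\<phi>\<^sub>a\<close> is a nonzero multiple of \<open>r\<^sup>-\<^sup>2 t\<close>, so \<open>\<phi>\<^sub>a\<close> is never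
  harmonic (\<open>tension_phi_nonzero\<close>). By homogeneity and rotational symmetry the Euler-Lagrange operator of
  the trienergy at \<open>\<phi>\<^sub>a\<close> is a number times \<open>r\<^sup>-\<^sup>6 t\<close>, and up to nonzero factors this number is a cubic
  polynomial in \<open>S\<close> (\<open>el_poly\<close>). So the question is whether that polynomial has a zero in \<open>(0, 1)\<close>. It is
  positive at \<open>S = 0\<close>; at \<open>S = 1\<close> it is negative exactly if \<open>b\<^sup>2 < (n - 1) / (4 (n - 6))\<close>, and then the
  intermediate value theorem applies; otherwise an elementary estimate shows that it is positive on all of
  \<open>(0, 1)\<close> (\<open>el_poly_root_iff\<close>).

  Triharmonicity is criticality with respect to all compactly supported variations, so the first
  variation has to be computed for an arbitrary variation field \<open>V\<close> (\<open>phi_first_variation\<close>). This is done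
  in the ambient space: the tangent spaces are the orthogonal complements of the gradient of the
  quadratic form (\<open>tangent_space_ellipsoid\<close>), and the tension field is the tangential part of the
  Laplacian. The computation is short because the ambient derivatives of the tension field \<open>w\<close> of \<open>\<phi>\<^sub>a\<close>
  have no normal part. Hence the derivative of the trienergy is that of a Dirichlet energy, namely
  \<open>- \<integral> \<Delta>w \<bullet> y\<close> with \<open>y\<close> the velocity of the tension field (\<open>trienergy_first_variation\<close>). A second
  integration by parts leaves a number times \<open>\<integral> r\<^sup>-\<^sup>7 (x \<bullet> V\<^sub>1)\<close>, where \<open>V\<^sub>1\<close> is the first component of
  \<open>V\<close>. If the number is zero, \<open>\<phi>\<^sub>a\<close> is triharmonic; if \<open>\<phi>\<^sub>a\<close> is triharmonic, then a bump that moves it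
  along the meridians shows that the number is zero.

  The Sobolev condition holds because the third derivatives of \<open>\<phi>\<^sub>a\<close> are of size \<open>r\<^sup>-\<^sup>3\<close>, which is
  square integrable for \<open>n \<ge> 7\<close>, and because the singularity can be cut off without a contribution in the
  limit (\<open>homog_integration_by_parts\<close>, \<open>homog_sobolev\<close>).

  The analytic tools are a calculus of smooth maps with the symmetry of mixed derivatives, bump
  functions, and integration by parts for compactly supported functions, which follows from the translation
  invariance of the Lebesgue measure.\<close>

section \<open>Smooth maps\<close>

lemma dir_deriv_eq: "(f has_derivative f') (at x) \<Longrightarrow> dir_deriv v f x = f' v"
  unfolding dir_deriv_def using frechet_derivative_at by metis

lemma has_derivative_dir_deriv:
  "f differentiable (at x) \<Longrightarrow> (f has_derivative (\<lambda>v. dir_deriv v f x)) (at x)"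
  unfolding dir_deriv_def by (simp add: frechet_derivative_works)

lemma dir_deriv_const [simp]: "dir_deriv v (\<lambda>x. c) x = 0"
  by (simp add: dir_deriv_def)

lemma dir_deriv_transform:
  assumes "open U" "x \<in> U" "\<And>y. y \<in> U \<Longrightarrow> f y = g y"
  shows "f differentiable (at x) \<longleftrightarrow> g differentiable (at x)" "dir_deriv v f x = dir_deriv v g x"
proof -
  have *: "(f has_derivative f') (at x) \<longleftrightarrow> (g has_derivative f') (at x)" for f'
    using assms by (metis has_derivative_transform_within_open)
  show "f differentiable (at x) \<longleftrightarrow> g differentiable (at x)"
    unfolding differentiable_def using * by blast
  show "dir_deriv v f x = dir_deriv v g x"
    unfolding dir_deriv_def frechet_derivative_def * ..
qed

lemma dir_deriv_linear:
  assumes "bounded_linear L" "f differentiable (at x)"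
  shows "(\<lambda>x. L (f x)) differentiable (at x)" "dir_deriv v (\<lambda>x. L (f x)) x = L (dir_deriv v f x)"
proof -
  have *: "((\<lambda>x. L (f x)) has_derivative (\<lambda>v. L (dir_deriv v f x))) (at x)"
    using bounded_linear.has_derivative[OF assms(1) has_derivative_dir_deriv[OF assms(2)]] .
  show "(\<lambda>x. L (f x)) differentiable (at x)" using * differentiable_def by blast
  show "dir_deriv v (\<lambda>x. L (f x)) x = L (dir_deriv v f x)" using dir_deriv_eq[OF *] .
qed

lemma dir_deriv_bilinear:
  assumes "bounded_bilinear B" "f differentiable (at x)" "g differentiable (at x)"
  shows "(\<lambda>x. B (f x) (g x)) differentiable (at x)"
    "dir_deriv v (\<lambda>x. B (f x) (g x)) x = B (f x) (dir_deriv v g x) + B (dir_deriv v f x) (g x)"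
proof -
  have *: "((\<lambda>x. B (f x) (g x)) has_derivative
      (\<lambda>v. B (f x) (dir_deriv v g x) + B (dir_deriv v f x) (g x))) (at x)"
    using bounded_bilinear.FDERIV[OF assms(1) has_derivative_dir_deriv[OF assms(2)]
      has_derivative_dir_deriv[OF assms(3)]] .
  show "(\<lambda>x. B (f x) (g x)) differentiable (at x)" using * differentiable_def by blast
  show "dir_deriv v (\<lambda>x. B (f x) (g x)) x = B (f x) (dir_deriv v g x) + B (dir_deriv v f x) (g x)"
    using dir_deriv_eq[OF *] .
qed

lemma dir_deriv_add:
  assumes "f differentiable (at x)" "g differentiable (at x)"
  shows "dir_deriv v (\<lambda>x. f x + g x) x = dir_deriv v f x + dir_deriv v g x"
  using dir_deriv_eq[OF has_derivative_add[OF assms[THEN has_derivative_dir_deriv]]] .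

lemma dir_deriv_diff:
  assumes "f differentiable (at x)" "g differentiable (at x)"
  shows "dir_deriv v (\<lambda>x. f x - g x) x = dir_deriv v f x - dir_deriv v g x"
  using dir_deriv_eq[OF has_derivative_diff[OF assms[THEN has_derivative_dir_deriv]]] .

lemma dir_deriv_sum:
  assumes "\<And>i. i \<in> I \<Longrightarrow> f i differentiable (at x)"
  shows "dir_deriv v (\<lambda>x. \<Sum>i\<in>I. f i x) x = (\<Sum>i\<in>I. dir_deriv v (f i) x)"
  using dir_deriv_eq[OF has_derivative_sum[OF has_derivative_dir_deriv[OF assms]]] .

text \<open>Restricting to the line through \<open>x\<close> in direction \<open>v\<close> reduces directional derivatives to
  ordinary ones.\<close>

lemma dir_deriv_line:
  assumes "f differentiable (at (x + s *\<^sub>R v))"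
  shows "((\<lambda>s. f (x + s *\<^sub>R v)) has_vector_derivative dir_deriv v f (x + s *\<^sub>R v)) (at s)"
proof -
  have "((\<lambda>s. f (x + s *\<^sub>R v)) has_derivative (\<lambda>h. dir_deriv (h *\<^sub>R v) f (x + s *\<^sub>R v))) (at s)"
  proof -
    have "((\<lambda>s. x + s *\<^sub>R v) has_derivative (\<lambda>h. h *\<^sub>R v)) (at s)"
      by (auto intro!: derivative_eq_intros)
    from has_derivative_compose[OF this, of f] has_derivative_dir_deriv[OF assms]
    show ?thesis by blast
  qed
  moreover have "dir_deriv (h *\<^sub>R v) f (x + s *\<^sub>R v) = h *\<^sub>R dir_deriv v f (x + s *\<^sub>R v)" for h
    using linear_scale[OF has_derivative_linear[OF has_derivative_dir_deriv[OF assms]]] by simp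
  ultimately show ?thesis by (simp add: has_vector_derivative_def)
qed

text \<open>Smoothness speaks of all iterated derivatives at once. Exhibiting a family of functions that is
  closed under first derivatives avoids any formula for the higher ones; every closure property of
  smooth maps below is proved by choosing such a family.\<close>

lemma smooth_on_coinduct:
  assumes "open U" "f \<in> F"
    and diff: "\<And>f x. f \<in> F \<Longrightarrow> x \<in> U \<Longrightarrow> f differentiable (at x)"
    and closed: "\<And>f e. f \<in> F \<Longrightarrow> e \<in> Basis \<Longrightarrow> \<exists>g\<in>F. \<forall>x\<in>U. dir_deriv e f x = g x"
  shows "smooth_on U f"
proof -
  have "\<exists>g\<in>F. \<forall>x\<in>U. iter_deriv vs f x = g x" if "vs \<in> lists Basis" for vs
    using that
  proof (induction vs)
    case Nil
    then show ?case using assms by auto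
  next
    case (Cons v vs)
    then obtain g where g: "g \<in> F" "\<forall>x\<in>U. iter_deriv vs f x = g x" by auto
    obtain h where "h \<in> F" "\<forall>x\<in>U. dir_deriv v g x = h x" using closed[OF g(1)] Cons by blast
    then show ?case
      using dir_deriv_transform(2)[OF \<open>open U\<close>, of _ "iter_deriv vs f" g v] g(2) by auto
  qed
  then show ?thesis
    unfolding smooth_on_def using diff dir_deriv_transform(1)[OF \<open>open U\<close>] by metis
qed

lemma iter_deriv_append: "iter_deriv (vs @ ws) f = iter_deriv vs (iter_deriv ws f)"
  by (induction vs) auto

lemma smooth_on_diff: "smooth_on U f \<Longrightarrow> x \<in> U \<Longrightarrow> f differentiable (at x)"
  unfolding smooth_on_def by (metis iter_deriv.simps(1) lists.Nil)

lemma smooth_on_iter_deriv: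
  assumes "smooth_on U f" "ws \<in> lists Basis"
  shows "smooth_on U (iter_deriv ws f)"
  using assms unfolding smooth_on_def
  by (metis iter_deriv_append append_in_lists_conv)

lemma smooth_on_dir_deriv: "smooth_on U f \<Longrightarrow> e \<in> Basis \<Longrightarrow> smooth_on U (dir_deriv e f)"
  using smooth_on_iter_deriv[of U f "[e]"] by simp

lemma smooth_on_continuous: "smooth_on U f \<Longrightarrow> continuous_on U f"
  by (meson smooth_on_diff differentiable_imp_continuous_within continuous_at_imp_continuous_on)

lemma smooth_on_subset: "smooth_on U f \<Longrightarrow> V \<subseteq> U \<Longrightarrow> smooth_on V f"
  unfolding smooth_on_def by blast

lemma smooth_on_const [simp]: "smooth_on U (\<lambda>x. c)"
proof -
  have "iter_deriv vs (\<lambda>x. c) = (\<lambda>x. if vs = [] then c else 0)" for vs :: "'a list" and c :: 'b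
  proof (induction vs)
    case (Cons v vs)
    then show ?case by (simp only: iter_deriv.simps) (rule ext, simp)
  qed simp
  then show ?thesis unfolding smooth_on_def by simp
qed

lemma smooth_on_linear:
  assumes "open U" "bounded_linear L" "smooth_on U f"
  shows "smooth_on U (\<lambda>x. L (f x))"
proof (rule smooth_on_coinduct[where F = "{\<lambda>x. L (f x) |f. smooth_on U f}"])
  fix g :: "'a \<Rightarrow> 'c" and e :: 'a
  assume "g \<in> {\<lambda>x. L (f x) |f. smooth_on U f}" and e: "e \<in> Basis"
  then obtain f where f: "smooth_on U f" "g = (\<lambda>x. L (f x))" by blast
  show "\<exists>h\<in>{\<lambda>x. L (f x) |f. smooth_on U f}. \<forall>x\<in>U. dir_deriv e g x = h x"
    using smooth_on_dir_deriv[OF f(1) e] dir_deriv_linear(2)[OF assms(2) smooth_on_diff[OF f(1)]] f(2)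
    by (intro bexI[of _ "\<lambda>x. L (dir_deriv e f x)"]) auto
qed (use assms dir_deriv_linear(1)[OF assms(2) smooth_on_diff] in auto)

lemma smooth_on_id: "open U \<Longrightarrow> smooth_on U (\<lambda>x. x)"
proof (rule smooth_on_coinduct[where F = "insert (\<lambda>x. x) (range (\<lambda>c x. c))"])
  fix g :: "'a \<Rightarrow> 'a" and e :: 'a
  assume "g \<in> insert (\<lambda>x. x) (range (\<lambda>c x. c))"
  then show "\<exists>h\<in>insert (\<lambda>x. x) (range (\<lambda>c x. c)). \<forall>x\<in>U. dir_deriv e g x = h x"
    by (auto simp: dir_deriv_eq[OF has_derivative_ident])
qed auto

lemma smooth_on_linear_id: "open U \<Longrightarrow> bounded_linear L \<Longrightarrow> smooth_on U L"
  using smooth_on_linear[OF _ _ smooth_on_id] .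

lemma smooth_on_add:
  assumes "open U" "smooth_on U f" "smooth_on U g"
  shows "smooth_on U (\<lambda>x. f x + g x)"
proof (rule smooth_on_coinduct[where F = "{\<lambda>x. f x + g x |f g. smooth_on U f \<and> smooth_on U g}"])
  fix h :: "'a \<Rightarrow> 'b" and e :: 'a
  assume "h \<in> {\<lambda>x. f x + g x |f g. smooth_on U f \<and> smooth_on U g}" and e: "e \<in> Basis"
  then obtain f g where f: "smooth_on U f" "smooth_on U g" "h = (\<lambda>x. f x + g x)" by blast
  show "\<exists>k\<in>{\<lambda>x. f x + g x |f g. smooth_on U f \<and> smooth_on U g}. \<forall>x\<in>U. dir_deriv e h x = k x"
    using smooth_on_dir_deriv[OF f(1) e] smooth_on_dir_deriv[OF f(2) e] f(3)
      dir_deriv_add[OF smooth_on_diff[OF f(1)] smooth_on_diff[OF f(2)]]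
    by (intro bexI[of _ "\<lambda>x. dir_deriv e f x + dir_deriv e g x"]) auto
qed (use assms smooth_on_diff in \<open>auto intro: differentiable_add\<close>)

lemma smooth_on_sum:
  assumes "open U" "\<And>i. i \<in> I \<Longrightarrow> smooth_on U (f i)"
  shows "smooth_on U (\<lambda>x. \<Sum>i\<in>I. f i x)"
  using assms(2) by (induction I rule: infinite_finite_induct) (auto intro: smooth_on_add[OF assms(1)])

lemma smooth_on_minus: "open U \<Longrightarrow> smooth_on U f \<Longrightarrow> smooth_on U (\<lambda>x. - f x)"
  using smooth_on_linear[OF _ bounded_linear_minus[OF bounded_linear_ident]] .

lemma smooth_on_sub: "open U \<Longrightarrow> smooth_on U f \<Longrightarrow> smooth_on U g \<Longrightarrow> smooth_on U (\<lambda>x. f x - g x)"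
  using smooth_on_add[of U f "\<lambda>x. - g x"] smooth_on_minus[of U g] by simp

text \<open>By the Leibniz rule, the finite sums of products of smooth maps are closed under directional
  derivatives, so coinduction applies to them.\<close>

lemma smooth_on_bilinear:
  fixes f :: "'a::euclidean_space \<Rightarrow> 'b::euclidean_space" and g :: "'a \<Rightarrow> 'c::euclidean_space"
    and B :: "'b \<Rightarrow> 'c \<Rightarrow> 'd::euclidean_space"
  assumes "open U" "bounded_bilinear B" "smooth_on U f" "smooth_on U g"
  shows "smooth_on U (\<lambda>x. B (f x) (g x))"
proof -
  define S where "S = {(f :: 'a \<Rightarrow> 'b, g :: 'a \<Rightarrow> 'c). smooth_on U f \<and> smooth_on U g}"
  define F where "F = {\<lambda>x. \<Sum>(f, g)\<leftarrow>ps. B (f x) (g x) |ps. set ps \<subseteq> S}"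
  note D = dir_deriv_bilinear[OF assms(2)]
  have main: "\<exists>qs. set qs \<subseteq> S \<and> (\<forall>x\<in>U. (\<lambda>x. \<Sum>(f, g)\<leftarrow>ps. B (f x) (g x)) differentiable (at x) \<and>
       dir_deriv e (\<lambda>x. \<Sum>(f, g)\<leftarrow>ps. B (f x) (g x)) x = (\<Sum>(f, g)\<leftarrow>qs. B (f x) (g x)))"
    if "set ps \<subseteq> S" "e \<in> Basis" for ps e
    using that(1)
  proof (induction ps)
    case Nil
    show ?case by (intro exI[of _ "[]"]) auto
  next
    case (Cons p ps)
    obtain f g where p: "p = (f, g)" "smooth_on U f" "smooth_on U g" using Cons by (auto simp: S_def)
    obtain qs where qs: "set qs \<subseteq> S" "\<And>x. x\<in>U \<Longrightarrow> (\<lambda>x. \<Sum>(f, g)\<leftarrow>ps. B (f x) (g x)) differentiable (at x)"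
       "\<And>x. x \<in> U \<Longrightarrow> dir_deriv e (\<lambda>x. \<Sum>(f, g)\<leftarrow>ps. B (f x) (g x)) x = (\<Sum>(f, g)\<leftarrow>qs. B (f x) (g x))"
      using Cons by auto
    show ?case
    proof (intro exI[of _ "(f, dir_deriv e g) # (dir_deriv e f, g) # qs"] conjI ballI)
      show "set ((f, dir_deriv e g) # (dir_deriv e f, g) # qs) \<subseteq> S"
        using p qs(1) smooth_on_dir_deriv[OF p(2) that(2)] smooth_on_dir_deriv[OF p(3) that(2)]
        by (simp add: S_def)
      fix x assume "x \<in> U"
      note d = smooth_on_diff[OF p(2) \<open>x \<in> U\<close>] smooth_on_diff[OF p(3) \<open>x \<in> U\<close>]
      show "(\<lambda>x. \<Sum>(f, g)\<leftarrow>p # ps. B (f x) (g x)) differentiable (at x)"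
        using differentiable_add[OF D(1)[OF d] qs(2)[OF \<open>x \<in> U\<close>]] by (simp add: p(1))
      show "dir_deriv e (\<lambda>x. \<Sum>(f, g)\<leftarrow>p # ps. B (f x) (g x)) x =
          (\<Sum>(f, g)\<leftarrow>(f, dir_deriv e g) # (dir_deriv e f, g) # qs. B (f x) (g x))"
        using dir_deriv_add[OF D(1)[OF d] qs(2)[OF \<open>x \<in> U\<close>], of e] D(2)[OF d, of e] qs(3)[OF \<open>x \<in> U\<close>]
        by (simp add: p(1))
    qed
  qed
  show ?thesis
  proof (rule smooth_on_coinduct[OF \<open>open U\<close>, where F = F])
    show "(\<lambda>x. B (f x) (g x)) \<in> F"
      unfolding F_def S_def using assms by (intro CollectI exI[of _ "[(f, g)]"]) auto
    fix h :: "'a \<Rightarrow> 'd" and x assume "h \<in> F" "x \<in> U"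
    then obtain ps where "set ps \<subseteq> S" and h: "h = (\<lambda>x. \<Sum>(f, g)\<leftarrow>ps. B (f x) (g x))" unfolding F_def by blast
    moreover obtain e :: 'a where "e \<in> Basis" using nonempty_Basis by blast
    ultimately show "h differentiable (at x)" using main[of ps e] \<open>x \<in> U\<close> by metis
  next
    fix h :: "'a \<Rightarrow> 'd" and e :: 'a assume "h \<in> F" "e \<in> Basis"
    then obtain ps where ps: "set ps \<subseteq> S" and h: "h = (\<lambda>x. \<Sum>(f, g)\<leftarrow>ps. B (f x) (g x))" unfolding F_def by blast
    obtain qs where "set qs \<subseteq> S" "\<forall>x\<in>U. dir_deriv e h x = (\<Sum>(f, g)\<leftarrow>qs. B (f x) (g x))"
      using main[OF ps \<open>e \<in> Basis\<close>] unfolding h by blast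
    then show "\<exists>k\<in>F. \<forall>x\<in>U. dir_deriv e h x = k x"
      unfolding F_def by (intro bexI[of _ "\<lambda>x. \<Sum>(f, g)\<leftarrow>qs. B (f x) (g x)"]) auto
  qed
qed

lemmas smooth_on_inner = smooth_on_bilinear[OF _ bounded_bilinear_inner]
lemmas smooth_on_scaleR = smooth_on_bilinear[OF _ bounded_bilinear_scaleR]
lemmas smooth_on_mult = smooth_on_bilinear[OF _ bounded_bilinear_mult]

lemma smooth_on_Pair:
  assumes "open U" "smooth_on U f" "smooth_on U g"
  shows "smooth_on U (\<lambda>x. (f x, g x))"
proof -
  have "smooth_on U (\<lambda>x. (f x, 0) + (0, g x))"
    using assms
    by (intro smooth_on_add smooth_on_linear[of U "\<lambda>y. (y, 0)" f] smooth_on_linear[of U "\<lambda>y. (0, y)" g])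
      (auto intro!: bounded_linear_Pair bounded_linear_zero bounded_linear_ident)
  then show ?thesis by simp
qed

lemma dir_deriv_chain:
  assumes "f differentiable (at x)" "g differentiable (at (f x))"
  shows "(\<lambda>x. g (f x)) differentiable (at x)"
    "dir_deriv v (\<lambda>x. g (f x)) x = (\<Sum>i\<in>Basis. (dir_deriv v f x \<bullet> i) *\<^sub>R dir_deriv i g (f x))"
proof -
  have *: "((\<lambda>x. g (f x)) has_derivative (\<lambda>v. dir_deriv (dir_deriv v f x) g (f x))) (at x)"
    using has_derivative_compose[OF has_derivative_dir_deriv[OF assms(1)] has_derivative_dir_deriv[OF assms(2)]] .
  show "(\<lambda>x. g (f x)) differentiable (at x)" using * differentiable_def by blast
  have lin: "linear (\<lambda>v. dir_deriv v g (f x))"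
    using has_derivative_linear[OF has_derivative_dir_deriv[OF assms(2)]] .
  have "dir_deriv w g (f x) = (\<Sum>i\<in>Basis. (w \<bullet> i) *\<^sub>R dir_deriv i g (f x))" for w
    using linear_sum[OF lin, of "\<lambda>i. (w \<bullet> i) *\<^sub>R i" Basis] linear_scale[OF lin]
    by (simp add: euclidean_representation)
  then show "dir_deriv v (\<lambda>x. g (f x)) x = (\<Sum>i\<in>Basis. (dir_deriv v f x \<bullet> i) *\<^sub>R dir_deriv i g (f x))"
    using dir_deriv_eq[OF *] by metis
qed

text \<open>The family used for coinduction consists of the finite sums of \<open>h \<cdot> (g \<circ> f)\<close> with \<open>h\<close> and \<open>g\<close>
  smooth; the chain rule keeps a derivative inside it.\<close>

lemma smooth_on_compose:
  fixes f :: "'a::euclidean_space \<Rightarrow> 'b::euclidean_space" and g :: "'b \<Rightarrow> 'c::euclidean_space"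
  assumes "open U" "smooth_on U f" "smooth_on V g" "f ` U \<subseteq> V"
  shows "smooth_on U (\<lambda>x. g (f x))"
proof -
  define A where "A = {\<lambda>x. h x *\<^sub>R (g :: 'b \<Rightarrow> 'c) (f x) |h g. smooth_on U h \<and> smooth_on V g}"
  define F where "F = {\<lambda>x. \<Sum>k\<leftarrow>ks. k x |ks. set ks \<subseteq> A}"
  have A: "\<exists>ls. set ls \<subseteq> A \<and> (\<forall>x\<in>U. k differentiable (at x) \<and> dir_deriv e k x = (\<Sum>l\<leftarrow>ls. l x))"
    if "k \<in> A" and e_in: "e \<in> Basis" for k e
  proof -
    obtain h g where k: "k = (\<lambda>x. h x *\<^sub>R g (f x))" and h: "smooth_on U h" and g: "smooth_on V g"
      using \<open>k \<in> A\<close> by (auto simp: A_def)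
    obtain bs :: "'b list" where bs: "set bs = Basis" "distinct bs"
      using finite_distinct_list[OF finite_Basis] by blast
    define ls where "ls = (\<lambda>x. dir_deriv e h x *\<^sub>R g (f x)) #
       map (\<lambda>i x. (h x * (dir_deriv e f x \<bullet> i)) *\<^sub>R dir_deriv i g (f x)) bs"
    have "set ls \<subseteq> A"
    proof -
      have "smooth_on U (\<lambda>x. h x * (dir_deriv e f x \<bullet> i))" for i
        using assms h e_in by (intro smooth_on_mult smooth_on_inner smooth_on_dir_deriv) auto
      then show ?thesis
        using smooth_on_dir_deriv[OF h e_in] smooth_on_dir_deriv[OF g] g bs(1)
        unfolding ls_def A_def by fastforce
    qed
    moreover have "k differentiable (at x) \<and> dir_deriv e k x = (\<Sum>l\<leftarrow>ls. l x)" if "x \<in> U" for x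
    proof -
      have d: "h differentiable (at x)" "f differentiable (at x)" "g differentiable (at (f x))"
        using that assms h g smooth_on_diff by blast+
      note c = dir_deriv_chain[OF d(2,3)]
      show ?thesis
        using dir_deriv_bilinear(1)[OF bounded_bilinear_scaleR d(1) c(1)]
          dir_deriv_bilinear(2)[OF bounded_bilinear_scaleR d(1) c(1), of e] unfolding k ls_def c(2)
        by (simp add: bs sum_list_distinct_conv_sum_set scaleR_sum_right comp_def)
    qed
    ultimately show ?thesis by blast
  qed
  have main: "\<exists>ls. set ls \<subseteq> A \<and> (\<forall>x\<in>U. (\<lambda>x. \<Sum>k\<leftarrow>ks. k x) differentiable (at x) \<and>
       dir_deriv e (\<lambda>x. \<Sum>k\<leftarrow>ks. k x) x = (\<Sum>l\<leftarrow>ls. l x))"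
    if "set ks \<subseteq> A" and e_in: "e \<in> Basis" for ks e
    using that(1)
  proof (induction ks)
    case Nil
    show ?case by (intro exI[of _ "[]"]) auto
  next
    case (Cons k ks)
    obtain ls where ls: "set ls \<subseteq> A" "\<And>x. x\<in>U \<Longrightarrow> k differentiable (at x)"
       "\<And>x. x \<in> U \<Longrightarrow> dir_deriv e k x = (\<Sum>l\<leftarrow>ls. l x)"
      using A[OF _ e_in, of k] Cons by auto
    obtain qs where qs: "set qs \<subseteq> A" "\<And>x. x\<in>U \<Longrightarrow> (\<lambda>x. \<Sum>k\<leftarrow>ks. k x) differentiable (at x)"
       "\<And>x. x \<in> U \<Longrightarrow> dir_deriv e (\<lambda>x. \<Sum>k\<leftarrow>ks. k x) x = (\<Sum>l\<leftarrow>qs. l x)"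
      using Cons by auto
    show ?case
    proof (intro exI[of _ "ls @ qs"] conjI ballI)
      fix x assume "x \<in> U"
      note d = ls(2)[OF \<open>x \<in> U\<close>] qs(2)[OF \<open>x \<in> U\<close>]
      show "(\<lambda>x. \<Sum>k\<leftarrow>k # ks. k x) differentiable (at x)"
        using differentiable_add[OF d] by simp
      show "dir_deriv e (\<lambda>x. \<Sum>k\<leftarrow>k # ks. k x) x = (\<Sum>l\<leftarrow>ls @ qs. l x)"
        using dir_deriv_add[OF d, of e] ls(3)[OF \<open>x \<in> U\<close>] qs(3)[OF \<open>x \<in> U\<close>] by simp
    qed (use ls qs in auto)
  qed
  show ?thesis
  proof (rule smooth_on_coinduct[OF \<open>open U\<close>, where F = F])
    have "(\<lambda>x. g (f x)) \<in> A"
      unfolding A_def using assms by (intro CollectI exI[of _ "\<lambda>x. 1"] exI[of _ g]) auto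
    then show "(\<lambda>x. g (f x)) \<in> F"
      unfolding F_def by (intro CollectI exI[of _ "[\<lambda>x. g (f x)]"]) auto
    fix h :: "'a \<Rightarrow> 'c" and x assume "h \<in> F" "x \<in> U"
    then obtain ks where "set ks \<subseteq> A" and h: "h = (\<lambda>x. \<Sum>k\<leftarrow>ks. k x)" unfolding F_def by blast
    moreover obtain e :: 'a where "e \<in> Basis" using nonempty_Basis by blast
    ultimately show "h differentiable (at x)" using main[of ks e] \<open>x \<in> U\<close> by metis
  next
    fix h :: "'a \<Rightarrow> 'c" and e :: 'a assume "h \<in> F" "e \<in> Basis"
    then obtain ks where ks: "set ks \<subseteq> A" and h: "h = (\<lambda>x. \<Sum>k\<leftarrow>ks. k x)" unfolding F_def by blast
    obtain qs where "set qs \<subseteq> A" "\<forall>x\<in>U. dir_deriv e h x = (\<Sum>k\<leftarrow>qs. k x)"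
      using main[OF ks \<open>e \<in> Basis\<close>] unfolding h by blast
    then show "\<exists>k\<in>F. \<forall>x\<in>U. dir_deriv e h x = k x"
      unfolding F_def by (intro bexI[of _ "\<lambda>x. \<Sum>k\<leftarrow>qs. k x"]) auto
  qed
qed

lemma smooth_on_inverse:
  assumes "open U" "smooth_on U f" "\<And>x. x \<in> U \<Longrightarrow> f x \<noteq> (0::real)"
  shows "smooth_on U (\<lambda>x. inverse (f x))"
proof (rule smooth_on_compose[OF assms(1,2), of "- {0}" inverse])
  show "smooth_on (- {0::real}) inverse"
  proof (rule smooth_on_coinduct[where F = "{\<lambda>x::real. c * inverse x ^ k |c k. True}"])
    have "(inverse :: real \<Rightarrow> real) = (\<lambda>x. 1 * inverse x ^ 1)" by auto
    then show "(inverse :: real \<Rightarrow> real) \<in> {\<lambda>x::real. c * inverse x ^ k |c k. True}" by blast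
  next
    fix f :: "real \<Rightarrow> real" and x :: real
    assume "f \<in> {\<lambda>x::real. c * inverse x ^ k |c k. True}" and x: "x \<in> - {0}"
    then show "f differentiable (at x)" by (auto intro!: derivative_intros)
  next
    fix f :: "real \<Rightarrow> real" and e :: real
    assume "f \<in> {\<lambda>x::real. c * inverse x ^ k |c k. True}"
    then obtain c k where f: "f = (\<lambda>x. c * inverse x ^ k)" by blast
    have "dir_deriv e f x = - (c * real k * e) * inverse x ^ (k + 1)" if "x \<noteq> 0" for x
    proof -
      have "k = 0 \<or> inverse x * inverse x ^ (k - Suc 0) = inverse x ^ k"
        by (cases k) auto
      moreover have "(f has_real_derivative c * (real k * (- (inverse x * 1 * inverse x) * inverse x ^ (k - Suc 0)))) (at x)"
        unfolding f using that by (intro DERIV_cmult DERIV_power DERIV_inverse' DERIV_ident)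
      ultimately have "(f has_derivative (\<lambda>h. - (c * real k * h) * inverse x ^ (k + 1))) (at x)"
        unfolding has_field_derivative_def
        by (elim has_derivative_eq_rhs) (auto simp: algebra_simps fun_eq_iff)
      from dir_deriv_eq[OF this] show ?thesis .
    qed
    then have "\<forall>x\<in>- {0}. dir_deriv e f x = - (c * real k * e) * inverse x ^ (k + 1)" by blast
    then show "\<exists>g\<in>{\<lambda>x. c * inverse x ^ k |c k. True}. \<forall>x\<in>- {0}. dir_deriv e f x = g x"
      by (rule bexI[of _ "\<lambda>x. - (c * real k * e) * inverse x ^ (k + 1)"]) blast
  qed auto
qed (use assms in auto)

lemma smooth_on_trig: "smooth_on UNIV (\<lambda>x. A * sin x + B * cos x :: real)"
proof -
  have deriv: "((\<lambda>x. A * sin x + B * cos x) has_derivative (\<lambda>h. h * (A * cos x - B * sin x))) (at x)"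
    for A B x :: real
    by (auto intro!: derivative_eq_intros simp: algebra_simps)
  show ?thesis
  proof (rule smooth_on_coinduct[where F = "{\<lambda>x. A * sin x + B * cos x |A B. True}"])
    fix f :: "real \<Rightarrow> real" and e :: real
    assume "f \<in> {\<lambda>x. A * sin x + B * cos x |A B. True}"
    then obtain A B where f: "f = (\<lambda>x. A * sin x + B * cos x)" by blast
    have "dir_deriv e f x = (- B * e) * sin x + (A * e) * cos x" for x
      unfolding f using deriv[THEN dir_deriv_eq, of e A B x] by (simp add: algebra_simps)
    then show "\<exists>g\<in>{\<lambda>x. A * sin x + B * cos x |A B. True}. \<forall>x\<in>UNIV. dir_deriv e f x = g x"
      by blast
  qed (use deriv in \<open>auto simp: differentiable_def\<close>)
qed

lemma smooth_on_sin: "open U \<Longrightarrow> smooth_on U f \<Longrightarrow> smooth_on U (\<lambda>x. sin (f x :: real))"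
  using smooth_on_compose[of U f UNIV "\<lambda>x. 1 * sin x + 0 * cos x"] smooth_on_trig[of 1 0] by simp

lemma smooth_on_cos: "open U \<Longrightarrow> smooth_on U f \<Longrightarrow> smooth_on U (\<lambda>x. cos (f x :: real))"
  using smooth_on_compose[of U f UNIV "\<lambda>x. 0 * sin x + 1 * cos x"] smooth_on_trig[of 0 1] by simp

text \<open>Both mixed derivatives are limits of the same second difference quotient.\<close>

lemma second_difference_mean_value:
  fixes f :: "'a::euclidean_space \<Rightarrow> real"
  assumes "h > 0"
    and sub: "\<And>s t. 0 \<le> s \<Longrightarrow> s \<le> h \<Longrightarrow> 0 \<le> t \<Longrightarrow> t \<le> h \<Longrightarrow> x + s *\<^sub>R u + t *\<^sub>R v \<in> U"
    and d1: "\<And>y. y \<in> U \<Longrightarrow> f differentiable (at y)"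
    and d2: "\<And>y. y \<in> U \<Longrightarrow> dir_deriv u f differentiable (at y)"
  shows "\<exists>s t. 0 < s \<and> s < h \<and> 0 < t \<and> t < h \<and>
     f (x + h *\<^sub>R u + h *\<^sub>R v) - f (x + h *\<^sub>R u) - f (x + h *\<^sub>R v) + f x =
       h\<^sup>2 * dir_deriv v (dir_deriv u f) (x + s *\<^sub>R u + t *\<^sub>R v)"
proof -
  define g where "g s = f (x + h *\<^sub>R v + s *\<^sub>R u) - f (x + s *\<^sub>R u)" for s
  have g: "(g has_real_derivative dir_deriv u f (x + h *\<^sub>R v + s *\<^sub>R u) - dir_deriv u f (x + s *\<^sub>R u)) (at s)"
    if "0 \<le> s" "s \<le> h" for s
  proof -
    have "x + h *\<^sub>R v + s *\<^sub>R u \<in> U" "x + s *\<^sub>R u \<in> U"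
      using sub[of s h] sub[of s 0] that \<open>h > 0\<close> by (simp_all add: algebra_simps)
    then show ?thesis unfolding g_def has_real_derivative_iff_has_vector_derivative
      by (intro has_vector_derivative_diff dir_deriv_line d1)
  qed
  obtain s where s: "0 < s" "s < h"
    and gs: "g h - g 0 = (h - 0) * (dir_deriv u f (x + h *\<^sub>R v + s *\<^sub>R u) - dir_deriv u f (x + s *\<^sub>R u))"
    using MVT2[OF \<open>h > 0\<close> g] by blast
  define k where "k t = dir_deriv u f (x + s *\<^sub>R u + t *\<^sub>R v)" for t
  have k: "(k has_real_derivative dir_deriv v (dir_deriv u f) (x + s *\<^sub>R u + t *\<^sub>R v)) (at t)"
    if "0 \<le> t" "t \<le> h" for t
    unfolding k_def has_real_derivative_iff_has_vector_derivative
    using sub[of s t] that s by (intro dir_deriv_line d2) auto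
  obtain t where t: "0 < t" "t < h"
    and kt: "k h - k 0 = (h - 0) * dir_deriv v (dir_deriv u f) (x + s *\<^sub>R u + t *\<^sub>R v)"
    using MVT2[OF \<open>h > 0\<close> k] by blast
  have "f (x + h *\<^sub>R u + h *\<^sub>R v) - f (x + h *\<^sub>R u) - f (x + h *\<^sub>R v) + f x = g h - g 0"
    by (simp add: g_def algebra_simps)
  also have "\<dots> = h * (k h - k 0)" unfolding gs k_def by (simp add: algebra_simps)
  also have "\<dots> = h\<^sup>2 * dir_deriv v (dir_deriv u f) (x + s *\<^sub>R u + t *\<^sub>R v)"
    unfolding kt by (simp add: power2_eq_square)
  finally show ?thesis using s t by blast
qed

lemma dir_deriv_commute_real:
  fixes f :: "'a::euclidean_space \<Rightarrow> real"
  assumes "open U" "smooth_on U f" "u \<in> Basis" "v \<in> Basis" "x \<in> U"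
  shows "dir_deriv u (dir_deriv v f) x = dir_deriv v (dir_deriv u f) x"
proof (rule ccontr)
  let ?A = "dir_deriv u (dir_deriv v f)" and ?B = "dir_deriv v (dir_deriv u f)"
  assume ne: "?A x \<noteq> ?B x"
  define \<epsilon> where "\<epsilon> = \<bar>?A x - ?B x\<bar> / 2"
  have "\<epsilon> > 0" using ne by (simp add: \<epsilon>_def)
  have cont: "isCont ?A x" "isCont ?B x"
    using assms smooth_on_continuous smooth_on_dir_deriv continuous_on_eq_continuous_at by metis+
  obtain r where r: "r > 0" "ball x r \<subseteq> U" using assms openE by metis
  obtain d1 where d1: "d1 > 0" "\<And>y. dist y x < d1 \<Longrightarrow> dist (?A y) (?A x) < \<epsilon>"
    using cont(1) \<open>\<epsilon> > 0\<close> unfolding continuous_at_eps_delta by metis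
  obtain d2 where d2: "d2 > 0" "\<And>y. dist y x < d2 \<Longrightarrow> dist (?B y) (?B x) < \<epsilon>"
    using cont(2) \<open>\<epsilon> > 0\<close> unfolding continuous_at_eps_delta by metis
  define h where "h = min r (min d1 d2) / 3"
  have "h > 0" using r d1 d2 by (simp add: h_def)
  have close: "dist (x + s *\<^sub>R e + t *\<^sub>R e') x < min r (min d1 d2)"
    if "0 \<le> s" "s \<le> h" "0 \<le> t" "t \<le> h" "e \<in> Basis" "e' \<in> Basis" for s t e e'
  proof -
    have "dist (x + s *\<^sub>R e + t *\<^sub>R e') x = norm (s *\<^sub>R e + t *\<^sub>R e')" by (simp add: dist_norm algebra_simps)
    also have "\<dots> \<le> s + t" using norm_triangle_ineq[of "s *\<^sub>R e" "t *\<^sub>R e'"] that by simp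
    finally show ?thesis using that r d1 d2 \<open>h > 0\<close> unfolding h_def by linarith
  qed
  have "x + s *\<^sub>R e + t *\<^sub>R e' \<in> U"
    if "0 \<le> s" "s \<le> h" "0 \<le> t" "t \<le> h" "e \<in> Basis" "e' \<in> Basis" for s t e e'
    using close[OF that] r by (auto simp: dist_commute subset_iff)
  note mv = second_difference_mean_value[OF \<open>h > 0\<close> this smooth_on_diff[OF assms(2)]
      smooth_on_diff[OF smooth_on_dir_deriv[OF assms(2)]]]
  obtain s t where 1: "0 < s" "s < h" "0 < t" "t < h"
     "f (x + h *\<^sub>R u + h *\<^sub>R v) - f (x + h *\<^sub>R u) - f (x + h *\<^sub>R v) + f x = h\<^sup>2 * ?B (x + s *\<^sub>R u + t *\<^sub>R v)"
    using mv[of u v] assms by blast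
  obtain s' t' where 2: "0 < s'" "s' < h" "0 < t'" "t' < h"
     "f (x + h *\<^sub>R v + h *\<^sub>R u) - f (x + h *\<^sub>R v) - f (x + h *\<^sub>R u) + f x = h\<^sup>2 * ?A (x + s' *\<^sub>R v + t' *\<^sub>R u)"
    using mv[of v u] assms by blast
  have "h\<^sup>2 * ?B (x + s *\<^sub>R u + t *\<^sub>R v) = h\<^sup>2 * ?A (x + s' *\<^sub>R v + t' *\<^sub>R u)"
    using 1(5) 2(5) by (simp add: algebra_simps)
  then have "?B (x + s *\<^sub>R u + t *\<^sub>R v) = ?A (x + s' *\<^sub>R v + t' *\<^sub>R u)" using \<open>h > 0\<close> by simp
  moreover have "dist (?B (x + s *\<^sub>R u + t *\<^sub>R v)) (?B x) < \<epsilon>"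
    using close[of s t u v] 1 assms by (intro d2) auto
  moreover have "dist (?A (x + s' *\<^sub>R v + t' *\<^sub>R u)) (?A x) < \<epsilon>"
    using close[of s' t' v u] 2 assms by (intro d1) auto
  moreover have "False" if "\<bar>p - r\<bar> < \<bar>s - r\<bar> / 2" "\<bar>p - s\<bar> < \<bar>s - r\<bar> / 2" for p r s :: real
    using that by (auto simp: abs_if split: if_splits)
  ultimately show False unfolding \<epsilon>_def dist_real_def by metis
qed

lemma dir_deriv_commute:
  fixes f :: "'a::euclidean_space \<Rightarrow> 'b::euclidean_space"
  assumes "open U" "smooth_on U f" "u \<in> Basis" "v \<in> Basis" "x \<in> U"
  shows "dir_deriv u (dir_deriv v f) x = dir_deriv v (dir_deriv u f) x"
proof (rule euclidean_eqI)
  fix i :: 'b assume "i \<in> Basis"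
  note L = bounded_linear_inner_left[of i]
  have *: "dir_deriv p (dir_deriv q f) x \<bullet> i = dir_deriv p (dir_deriv q (\<lambda>x. f x \<bullet> i)) x"
    if "p \<in> Basis" "q \<in> Basis" for p q
  proof -
    have "dir_deriv p (dir_deriv q f) x \<bullet> i = dir_deriv p (\<lambda>x. dir_deriv q f x \<bullet> i) x"
      using dir_deriv_linear(2)[OF L smooth_on_diff[OF smooth_on_dir_deriv[OF assms(2)]]] that assms by metis
    also have "\<dots> = dir_deriv p (dir_deriv q (\<lambda>x. f x \<bullet> i)) x"
      by (rule dir_deriv_transform(2)[OF assms(1,5)])
        (use dir_deriv_linear(2)[OF L smooth_on_diff[OF assms(2)]] in auto)
    finally show ?thesis .
  qed
  show "dir_deriv u (dir_deriv v f) x \<bullet> i = dir_deriv v (dir_deriv u f) x \<bullet> i"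
    using * assms dir_deriv_commute_real[OF assms(1) smooth_on_linear[OF assms(1) L assms(2)] assms(3-5)] by simp
qed

text \<open>Variations are smooth in the pair \<open>(t, x)\<close>, while the tension field and the energy of a single map
  are defined by derivatives in \<open>x\<close> alone.\<close>

lemma smooth_on_slice:
  assumes "smooth_on (I \<times> U) G" "open I" "open U" "t \<in> I"
  shows "smooth_on U (\<lambda>x. G (t, x))" "\<And>x. x \<in> U \<Longrightarrow> dir_deriv e (\<lambda>x. G (t, x)) x = dir_deriv (0, e) G (t, x)"
proof -
  have chain: "((\<lambda>x. G (t, x)) has_derivative (\<lambda>e. dir_deriv (0, e) G (t, x))) (at x)"
    if "smooth_on (I \<times> U) G" "x \<in> U" for G :: "'a \<times> 'b \<Rightarrow> 'c" and x
  proof -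
    have "((\<lambda>x. (t, x)) has_derivative (\<lambda>e. (0, e))) (at x)"
      by (auto intro!: derivative_eq_intros)
    from has_derivative_compose[OF this, of G]
    show ?thesis using has_derivative_dir_deriv[OF smooth_on_diff[OF that(1)]] that \<open>t \<in> I\<close> by blast
  qed
  show "dir_deriv e (\<lambda>x. G (t, x)) x = dir_deriv (0, e) G (t, x)" if "x \<in> U" for x
    using dir_deriv_eq[OF chain[OF assms(1) that]] .
  show "smooth_on U (\<lambda>x. G (t, x))"
  proof (rule smooth_on_coinduct[OF \<open>open U\<close>, where F = "{\<lambda>x. G (t, x) |G. smooth_on (I \<times> U) G}"])
    fix f :: "'b \<Rightarrow> 'c" and e assume "f \<in> {\<lambda>x. G (t, x) |G. smooth_on (I \<times> U) G}" "e \<in> (Basis :: 'b set)"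
    then obtain G where G: "f = (\<lambda>x. G (t, x))" "smooth_on (I \<times> U) G" by blast
    have "(0, e) \<in> Basis" using \<open>e \<in> Basis\<close> by (simp add: Basis_prod_def)
    then show "\<exists>g\<in>{\<lambda>x. G (t, x) |G. smooth_on (I \<times> U) G}. \<forall>x\<in>U. dir_deriv e f x = g x"
      using smooth_on_dir_deriv[OF G(2), of "(0, e)"] dir_deriv_eq[OF chain[OF G(2)]] G(1)
      by (intro bexI[of _ "\<lambda>x. dir_deriv (0, e) G (t, x)"]) auto
  qed (use assms chain differentiable_def in blast)+
qed

lemma slice_real_derivative:
  fixes G :: "real \<times> 'b::euclidean_space \<Rightarrow> 'c::euclidean_space"
  assumes "G differentiable (at (t, x))"
  shows "((\<lambda>t. G (t, x)) has_vector_derivative dir_deriv (1, 0) G (t, x)) (at t)"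
  using dir_deriv_line[of G "(0, x)" t "(1, 0)"] assms by simp

section \<open>Integration by parts and differentiation under the integral\<close>

text \<open>The bound \<open>B\<close> dominates all difference quotients, so they may be integrated termwise in the limit.\<close>

lemma has_real_derivative_integral:
  fixes f :: "real \<Rightarrow> 'a \<Rightarrow> real"
  assumes "\<delta> > 0"
    and int: "\<And>t. \<bar>t\<bar> < \<delta> \<Longrightarrow> integrable M (f t)"
    and meas: "f' \<in> borel_measurable M"
    and deriv: "\<And>x. x \<in> space M \<Longrightarrow> ((\<lambda>t. f t x) has_real_derivative f' x) (at 0)"
    and bound: "\<And>t x. \<bar>t\<bar> < \<delta> \<Longrightarrow> x \<in> space M \<Longrightarrow> \<bar>f t x - f 0 x\<bar> \<le> B x * \<bar>t\<bar>"
    and B: "integrable M B"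
  shows "((\<lambda>t. \<integral>x. f t x \<partial>M) has_real_derivative (\<integral>x. f' x \<partial>M)) (at 0)"
  unfolding has_field_derivative_iff tendsto_at_iff_sequentially
proof (intro allI impI)
  fix X :: "nat \<Rightarrow> real" assume X: "\<forall>i. X i \<in> UNIV - {0}" "X \<longlonglongrightarrow> 0"
  obtain N where N: "\<And>n. n \<ge> N \<Longrightarrow> \<bar>X n\<bar> < \<delta>"
    using LIMSEQ_D[OF X(2) \<open>\<delta> > 0\<close>] by auto
  define Y where "Y n = X (n + N)" for n
  have Y: "\<bar>Y n\<bar> < \<delta>" "Y n \<noteq> 0" for n using X N by (auto simp: Y_def)
  have Y0: "Y \<longlonglongrightarrow> 0" using LIMSEQ_ignore_initial_segment[OF X(2)] by (simp add: Y_def[abs_def])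
  have "(\<lambda>n. \<integral>x. (f (Y n) x - f 0 x) / Y n \<partial>M) \<longlonglongrightarrow> (\<integral>x. f' x \<partial>M)"
  proof (rule integral_dominated_convergence[where w = B])
    show "(\<lambda>x. (f (Y n) x - f 0 x) / Y n) \<in> borel_measurable M" for n
      using int[of "Y n"] int[of 0] Y[of n] \<open>\<delta> > 0\<close> by (intro borel_measurable_divide borel_measurable_diff) auto
    show "AE x in M. (\<lambda>n. (f (Y n) x - f 0 x) / Y n) \<longlonglongrightarrow> f' x"
    proof (rule AE_I2)
      fix x assume "x \<in> space M"
      from deriv[OF this] show "(\<lambda>n. (f (Y n) x - f 0 x) / Y n) \<longlonglongrightarrow> f' x"
        unfolding has_field_derivative_iff tendsto_at_iff_sequentially using Y(2) Y0
        by (auto simp: comp_def)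
    qed
    show "AE x in M. norm ((f (Y n) x - f 0 x) / Y n) \<le> B x" for n
      using bound[OF Y(1)[of n]] Y(2)[of n] by (intro AE_I2) (simp add: field_simps)
  qed fact+
  moreover have "(\<integral>x. (f (Y n) x - f 0 x) / Y n \<partial>M) = ((\<integral>x. f (Y n) x \<partial>M) - (\<integral>x. f 0 x \<partial>M)) / Y n" for n
    using int[of "Y n"] int[of 0] Y[of n] \<open>\<delta> > 0\<close> by simp
  ultimately have "(\<lambda>n. ((\<integral>x. f (X (n + N)) x \<partial>M) - (\<integral>x. f 0 x \<partial>M)) / X (n + N)) \<longlonglongrightarrow> (\<integral>x. f' x \<partial>M)"
    by (simp only: Y_def)
  from LIMSEQ_offset[OF this]
  show "((\<lambda>y. ((\<integral>x. f y x \<partial>M) - (\<integral>x. f 0 x \<partial>M)) / (y - 0)) \<circ> X) \<longlonglongrightarrow> (\<integral>x. f' x \<partial>M)"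
    by (simp add: comp_def)
qed

lemma integrable_lebesgue_on_compact:
  fixes f :: "'a::euclidean_space \<Rightarrow> 'b::euclidean_space"
  assumes "compact K" "continuous_on K f"
  shows "integrable (lebesgue_on K) f"
proof -
  have "integrable lebesgue (\<lambda>x. indicator K x *\<^sub>R f x)"
    using borel_integrable_compact[OF assms]
    by (subst integrable_completion) (auto dest: borel_measurable_integrable)
  then show ?thesis
    using assms by (subst integrable_restrict_space) (auto simp: compact_imp_closed)
qed

lemma lipschitz_of_bounded_derivative:
  fixes f :: "real \<Rightarrow> real"
  assumes "\<And>s. s \<in> S \<Longrightarrow> (f has_real_derivative f' s) (at s)" "\<And>s. s \<in> S \<Longrightarrow> \<bar>f' s\<bar> \<le> B"
    and "convex S" "0 \<in> S" "t \<in> S"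
  shows "\<bar>f t - f 0\<bar> \<le> B * \<bar>t\<bar>"
proof -
  have "norm (f t - f 0) \<le> B * norm (t - 0)"
    using assms by (intro field_differentiable_bound[of S f f']) (auto intro: has_field_derivative_at_within)
  then show ?thesis by simp
qed

text \<open>The integral of a translate \<open>g(x + t e)\<close> does not depend on \<open>t\<close>; differentiating under the
  integral at \<open>t = 0\<close> gives the claim.\<close>

lemma integral_dir_deriv_compact_support:
  fixes h :: "'a::euclidean_space \<Rightarrow> real"
  assumes "open U" "compact K" "K \<subseteq> U" "smooth_on U h" "e \<in> Basis"
    and zero: "\<And>x. x \<in> U - K \<Longrightarrow> h x = 0"
  shows "(\<integral>x. dir_deriv e h x \<partial>lebesgue_on K) = 0"
proof -
  define g where "g x = (if x \<in> K then h x else 0)" for x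
  define g' where "g' x = indicator K x *\<^sub>R dir_deriv e h x" for x
  have "closed K" using assms compact_imp_closed by blast
  have g: "g differentiable (at x) \<and> dir_deriv e g x = g' x" for x
  proof (cases "x \<in> U")
    case True
    have "g differentiable (at x)" "dir_deriv e g x = dir_deriv e h x"
      using dir_deriv_transform[OF \<open>open U\<close> True, of g h] zero smooth_on_diff[OF assms(4) True]
      by (auto simp: g_def)
    moreover have "dir_deriv e h x = 0" if "x \<notin> K"
      using dir_deriv_transform(2)[of "U - K" x h "\<lambda>_. 0"] zero that True \<open>open U\<close> \<open>closed K\<close> by auto
    ultimately show ?thesis by (auto simp: g'_def indicator_def)
  next
    case False
    then show ?thesis
      using dir_deriv_transform(1)[of "- K" x g "\<lambda>_. 0"] dir_deriv_transform(2)[of "- K" x g "\<lambda>_. 0" e] \<open>closed K\<close> \<open>K \<subseteq> U\<close> by (force simp: g_def g'_def open_Compl)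
  qed
  have cont': "continuous_on K (dir_deriv e h)"
    using smooth_on_continuous[OF smooth_on_dir_deriv[OF assms(4,5)]] \<open>K \<subseteq> U\<close> continuous_on_subset by blast
  have gm': "g' \<in> borel_measurable borel"
    unfolding g'_def[abs_def] using cont' \<open>closed K\<close>
    by (intro borel_measurable_continuous_on_indicator borel_closed)
  have "bounded (dir_deriv e h ` K)"
    using compact_continuous_image[OF cont' \<open>compact K\<close>] compact_imp_bounded by blast
  then obtain B where "B > 0" and B: "\<And>x. x \<in> K \<Longrightarrow> \<bar>dir_deriv e h x\<bar> \<le> B"
    unfolding bounded_pos by auto
  have B': "\<bar>g' x\<bar> \<le> B" for x using B \<open>B > 0\<close> by (auto simp: g'_def indicator_def)
  obtain R where R: "\<And>x. x \<in> K \<Longrightarrow> norm x \<le> R"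
    using compact_imp_bounded[OF \<open>compact K\<close>] unfolding bounded_iff by blast
  have line: "((\<lambda>s. g (x + s *\<^sub>R e)) has_real_derivative g' (x + s *\<^sub>R e)) (at s)" for x s
    using dir_deriv_line[of g x s e] g by (simp add: has_real_derivative_iff_has_vector_derivative)
  have gm: "g \<in> borel_measurable borel"
    using g by (intro borel_measurable_continuous_onI continuous_at_imp_continuous_on)
      (auto intro: differentiable_imp_continuous_within)
  have g_eq: "g = (\<lambda>x. indicator K x *\<^sub>R h x)" by (auto simp: g_def indicator_def)
  have gi: "integrable lborel g"
    unfolding g_eq using borel_integrable_compact[OF \<open>compact K\<close>] assms smooth_on_continuous continuous_on_subset
    by blast
  have shift: "integrable lborel (\<lambda>x. g (x + c))" "(\<integral>x. g (x + c) \<partial>lborel) = (\<integral>x. g x \<partial>lborel)" for c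
  proof -
    have "integrable (distr lborel borel ((+) c)) g" "(\<integral>x. g x \<partial>distr lborel borel ((+) c)) = (\<integral>x. g x \<partial>lborel)"
      using gi by (simp_all add: lborel_distr_plus)
    then show "integrable lborel (\<lambda>x. g (x + c))" "(\<integral>x. g (x + c) \<partial>lborel) = (\<integral>x. g x \<partial>lborel)"
      using gm by (simp_all add: integrable_distr_eq integral_distr add.commute)
  qed
  have "((\<lambda>t. \<integral>x. g (x + t *\<^sub>R e) \<partial>lborel) has_real_derivative (\<integral>x. g' x \<partial>lborel)) (at 0)"
  proof (rule has_real_derivative_integral[where \<delta> = 1 and B = "\<lambda>x. indicator (cball 0 (R + 1)) x * B"])
    show "g' \<in> borel_measurable lborel"
      using gm' by simp
    show "((\<lambda>t. g (x + t *\<^sub>R e)) has_real_derivative g' x) (at 0)" for x using line[of x 0] by simp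
    have "emeasure lborel (cball (0::'a) (R + 1)) < \<infinity>" using emeasure_compact_finite compact_cball by blast
    then show "integrable lborel (\<lambda>x. indicator (cball (0::'a) (R + 1)) x * B)"
      by (intro integrable_mult_left integrable_real_indicator) auto
    fix t x assume t: "\<bar>t\<bar> < (1::real)"
    show "\<bar>g (x + t *\<^sub>R e) - g (x + 0 *\<^sub>R e)\<bar> \<le> indicator (cball 0 (R + 1)) x * B * \<bar>t\<bar>"
    proof (cases "norm x \<le> R + 1")
      case True
      then show ?thesis
        using lipschitz_of_bounded_derivative[OF line, of UNIV x B t] B' by simp
    next
      case False
      have "norm x \<le> norm (x + t *\<^sub>R e) + norm (t *\<^sub>R e)" using norm_triangle_ineq4[of "x + t *\<^sub>R e" "t *\<^sub>R e"] by simp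
      then have "norm (x + t *\<^sub>R e) > R" using False t \<open>e \<in> Basis\<close> by simp
      then have "x \<notin> K" "x + t *\<^sub>R e \<notin> K" using R False by force+
      then show ?thesis using \<open>B > 0\<close> by (simp add: g_def)
    qed
  qed (use shift in auto)
  moreover have "((\<lambda>t. \<integral>x. g (x + t *\<^sub>R e) \<partial>lborel) has_real_derivative 0) (at 0)"
    by (simp add: shift)
  ultimately have "(\<integral>x. g' x \<partial>lborel) = 0" using DERIV_unique by blast
  moreover have "(\<integral>x. g' x \<partial>lebesgue) = (\<integral>x. g' x \<partial>lborel)"
    using gm' by (intro integral_completion) simp
  moreover have "(\<integral>x. dir_deriv e h x \<partial>lebesgue_on K) = (\<integral>x. g' x \<partial>lebesgue)"
    unfolding g'_def[abs_def] using \<open>closed K\<close> by (subst integral_restrict_space) auto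
  ultimately show ?thesis by simp
qed

lemma integration_by_parts:
  fixes p q :: "'a::euclidean_space \<Rightarrow> 'b::euclidean_space"
  assumes U: "open U" "compact K" "K \<subseteq> U" and p: "smooth_on U p" and q: "smooth_on U q" and e: "e \<in> Basis"
    and zero: "\<And>x. x \<in> U - K \<Longrightarrow> q x = 0"
  shows "(\<integral>x. dir_deriv e p x \<bullet> q x \<partial>lebesgue_on K) = - (\<integral>x. p x \<bullet> dir_deriv e q x \<partial>lebesgue_on K)"
proof -
  have "(\<integral>x. dir_deriv e (\<lambda>x. p x \<bullet> q x) x \<partial>lebesgue_on K) = 0"
    using assms by (intro integral_dir_deriv_compact_support[OF U] smooth_on_inner) auto
  also have "(\<integral>x. dir_deriv e (\<lambda>x. p x \<bullet> q x) x \<partial>lebesgue_on K) =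
      (\<integral>x. p x \<bullet> dir_deriv e q x + dir_deriv e p x \<bullet> q x \<partial>lebesgue_on K)"
    using \<open>K \<subseteq> U\<close> dir_deriv_bilinear(2)[OF bounded_bilinear_inner smooth_on_diff[OF p] smooth_on_diff[OF q]]
    by (intro Bochner_Integration.integral_cong) auto
  also have "\<dots> = (\<integral>x. p x \<bullet> dir_deriv e q x \<partial>lebesgue_on K) + (\<integral>x. dir_deriv e p x \<bullet> q x \<partial>lebesgue_on K)"
    using U p q e
    by (intro Bochner_Integration.integral_add integrable_lebesgue_on_compact
        continuous_on_subset[OF smooth_on_continuous \<open>K \<subseteq> U\<close>] smooth_on_inner smooth_on_dir_deriv)
  finally show ?thesis by simp
qed

lemma integration_by_parts_laplace:
  fixes p q :: "'a::euclidean_space \<Rightarrow> 'b::euclidean_space"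
  assumes U: "open U" "compact K" "K \<subseteq> U" and p: "smooth_on U p" and q: "smooth_on U q"
    and zero: "\<And>x. x \<in> U - K \<Longrightarrow> q x = 0"
  shows "(\<integral>x. (\<Sum>e\<in>Basis. dir_deriv e p x \<bullet> dir_deriv e q x) \<partial>lebesgue_on K) =
      - (\<integral>x. (\<Sum>e\<in>Basis. dir_deriv e (dir_deriv e p) x) \<bullet> q x \<partial>lebesgue_on K)"
proof -
  have i: "integrable (lebesgue_on K) (\<lambda>x. f x \<bullet> g x)" if "smooth_on U f" "smooth_on U g" for f g :: "'a \<Rightarrow> 'b"
    using U that by (intro integrable_lebesgue_on_compact continuous_on_subset[OF smooth_on_continuous \<open>K \<subseteq> U\<close>] smooth_on_inner)
  note s = smooth_on_dir_deriv
  have "(\<integral>x. (\<Sum>e\<in>Basis. dir_deriv e p x \<bullet> dir_deriv e q x) \<partial>lebesgue_on K) =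
     (\<Sum>e\<in>Basis. \<integral>x. dir_deriv e p x \<bullet> dir_deriv e q x \<partial>lebesgue_on K)"
    using p q by (intro Bochner_Integration.integral_sum i s) auto
  also have "\<dots> = - (\<Sum>e\<in>Basis. \<integral>x. dir_deriv e (dir_deriv e p) x \<bullet> q x \<partial>lebesgue_on K)"
    using integration_by_parts[OF U s[OF p] q _ zero] by (simp add: sum_negf)
  also have "(\<Sum>e\<in>Basis. \<integral>x. dir_deriv e (dir_deriv e p) x \<bullet> q x \<partial>lebesgue_on K) =
      (\<integral>x. (\<Sum>e\<in>Basis. dir_deriv e (dir_deriv e p) x \<bullet> q x) \<partial>lebesgue_on K)"
    using p q by (intro Bochner_Integration.integral_sum[symmetric] i s) auto
  finally show ?thesis by (simp add: inner_sum_left)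
qed

lemma green_formula:
  fixes p q :: "'a::euclidean_space \<Rightarrow> 'b::euclidean_space"
  assumes U: "open U" "compact K" "K \<subseteq> U" and p: "smooth_on U p" and q: "smooth_on U q"
    and zero: "\<And>x. x \<in> U - K \<Longrightarrow> q x = 0"
  shows "(\<integral>x. p x \<bullet> (\<Sum>e\<in>Basis. dir_deriv e (dir_deriv e q) x) \<partial>lebesgue_on K) =
      (\<integral>x. (\<Sum>e\<in>Basis. dir_deriv e (dir_deriv e p) x) \<bullet> q x \<partial>lebesgue_on K)"
proof -
  have i: "integrable (lebesgue_on K) (\<lambda>x. f x \<bullet> g x)" if "smooth_on U f" "smooth_on U g" for f g :: "'a \<Rightarrow> 'b"
    using U that by (intro integrable_lebesgue_on_compact continuous_on_subset[OF smooth_on_continuous \<open>K \<subseteq> U\<close>] smooth_on_inner)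
  note s = smooth_on_dir_deriv
  have zero': "dir_deriv e q x = 0" if "x \<in> U - K" for e x
    using dir_deriv_transform(2)[of "U - K" x q "\<lambda>_. 0" e] zero that U compact_imp_closed by auto
  have "(\<integral>x. p x \<bullet> (\<Sum>e\<in>Basis. dir_deriv e (dir_deriv e q) x) \<partial>lebesgue_on K) =
     (\<Sum>e\<in>Basis. \<integral>x. p x \<bullet> dir_deriv e (dir_deriv e q) x \<partial>lebesgue_on K)"
    unfolding inner_sum_right using p q by (intro Bochner_Integration.integral_sum i s) auto
  also have "\<dots> = - (\<Sum>e\<in>Basis. \<integral>x. dir_deriv e p x \<bullet> dir_deriv e q x \<partial>lebesgue_on K)"
    using integration_by_parts[OF U p s[OF q] _ zero'] by (simp add: sum_negf)
  also have "(\<Sum>e\<in>Basis. \<integral>x. dir_deriv e p x \<bullet> dir_deriv e q x \<partial>lebesgue_on K) =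
    (\<integral>x. (\<Sum>e\<in>Basis. dir_deriv e p x \<bullet> dir_deriv e q x) \<partial>lebesgue_on K)"
    using p q by (intro Bochner_Integration.integral_sum[symmetric] i s) auto
  finally show ?thesis using integration_by_parts_laplace[OF U p q zero] by simp
qed

lemma leibniz_rule_compact:
  fixes D :: "real \<times> 'a::euclidean_space \<Rightarrow> real"
  assumes "\<epsilon> > 0" "open U" "compact K" "K \<subseteq> U" and D: "smooth_on ({-\<epsilon><..<\<epsilon>} \<times> U) D"
  shows "((\<lambda>t. \<integral>x. D (t, x) \<partial>lebesgue_on K) has_real_derivative
           (\<integral>x. dir_deriv (1, 0) D (0, x) \<partial>lebesgue_on K)) (at 0)"
proof -
  let ?S = "{-(\<epsilon> / 2)..\<epsilon> / 2}"
  let ?D' = "dir_deriv (1, 0) D"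
  have sub: "?S \<times> K \<subseteq> {-\<epsilon><..<\<epsilon>} \<times> U" using \<open>K \<subseteq> U\<close> \<open>\<epsilon> > 0\<close> by auto
  have D': "smooth_on ({-\<epsilon><..<\<epsilon>} \<times> U) ?D'"
    using smooth_on_dir_deriv[OF D, of "(1, 0)"] by (simp add: Basis_prod_def)
  note cont = continuous_on_subset[OF smooth_on_continuous sub]
  have "bounded (?D' ` (?S \<times> K))"
    using compact_continuous_image[OF cont[OF D']] \<open>compact K\<close> compact_imp_bounded compact_Times compact_Icc by blast
  then obtain B where B: "\<And>t x. t \<in> ?S \<Longrightarrow> x \<in> K \<Longrightarrow> \<bar>?D' (t, x)\<bar> \<le> B"
    unfolding bounded_iff by fastforce
  have slice: "continuous_on K (\<lambda>x. f (t, x))" if "smooth_on ({-\<epsilon><..<\<epsilon>} \<times> U) f" "t \<in> ?S"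
    for t and f :: "real \<times> 'a \<Rightarrow> real"
    using that by (intro continuous_on_compose2[OF cont[OF that(1)]] continuous_intros) auto
  have line: "((\<lambda>t. D (t, x)) has_real_derivative ?D' (t, x)) (at t)" if "t \<in> ?S" "x \<in> K" for t x
  proof -
    have "(t, x) \<in> {-\<epsilon><..<\<epsilon>} \<times> U" using sub that by blast
    then show ?thesis
      using slice_real_derivative[OF smooth_on_diff[OF D]]
      by (simp add: has_real_derivative_iff_has_vector_derivative)
  qed
  show ?thesis
  proof (rule has_real_derivative_integral[where \<delta> = "\<epsilon> / 2" and B = "\<lambda>_. B"])
    show "integrable (lebesgue_on K) (\<lambda>x. D (t, x))" if "\<bar>t\<bar> < \<epsilon> / 2" for t
      using that by (intro integrable_lebesgue_on_compact \<open>compact K\<close> slice[OF D]) auto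
    show "(\<lambda>x. ?D' (0, x)) \<in> borel_measurable (lebesgue_on K)"
      using integrable_lebesgue_on_compact[OF \<open>compact K\<close> slice[OF D', of 0]] \<open>\<epsilon> > 0\<close> by auto
    show "((\<lambda>t. D (t, x)) has_real_derivative ?D' (0, x)) (at 0)" if "x \<in> space (lebesgue_on K)" for x
      using line[of 0 x] that \<open>\<epsilon> > 0\<close> by auto
    show "\<bar>D (t, x) - D (0, x)\<bar> \<le> B * \<bar>t\<bar>" if "\<bar>t\<bar> < \<epsilon> / 2" "x \<in> space (lebesgue_on K)" for t x
      using that \<open>\<epsilon> > 0\<close>
      by (intro lipschitz_of_bounded_derivative[of ?S _ "\<lambda>t. ?D' (t, x)"] line B) auto
    show "integrable (lebesgue_on K) (\<lambda>_. B)"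
      using integrable_lebesgue_on_compact[OF \<open>compact K\<close>, of "\<lambda>_. B"] by simp
  qed (use \<open>\<epsilon> > 0\<close> in auto)
qed

section \<open>Flat functions\<close>

text \<open>The functions \<open>q(1/s) exp(-1/s)\<close>, extended by \<open>0\<close> to \<open>s \<le> 0\<close>, are closed under
  differentiation; \<open>q = 1\<close> is the function from which bumps and cutoffs are made.\<close>

definition flat_exp :: "real poly \<Rightarrow> real \<Rightarrow> real" where
  "flat_exp q s = (if s > 0 then poly q (inverse s) * exp (- inverse s) else 0)"

lemma poly_times_exp_minus_tendsto: "((\<lambda>u. poly q u * exp (- u)) \<longlongrightarrow> (0::real)) at_top"
proof -
  have "((\<lambda>u. \<Sum>i\<le>degree q. coeff q i * (u ^ i / exp u)) \<longlongrightarrow> (0::real)) at_top"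
    by (intro tendsto_null_sum tendsto_mult_right_zero tendsto_power_div_exp_0)
  then show ?thesis
    by (simp add: poly_altdef sum_distrib_right exp_minus divide_inverse mult.assoc)
qed

lemma flat_exp_deriv:
  "(flat_exp q has_real_derivative flat_exp (monom 1 2 * (q - pderiv q)) s) (at s)"
proof -
  consider "s > 0" | "s < 0" | "s = 0" by linarith
  then show ?thesis
  proof cases
    case 1
    have "((\<lambda>s. poly q (inverse s) * exp (- inverse s)) has_real_derivative
        flat_exp (monom 1 2 * (q - pderiv q)) s) (at s)"
      using 1 by (auto intro!: derivative_eq_intros DERIV_chain2[OF poly_DERIV]
          simp: flat_exp_def poly_monom power2_eq_square algebra_simps)
    then show ?thesis
      by (rule has_field_derivative_transform_within_open[of _ _ _ "{0<..}"]) (use 1 in \<open>auto simp: flat_exp_def\<close>)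
  next
    case 2
    have "((\<lambda>s. 0) has_real_derivative flat_exp (monom 1 2 * (q - pderiv q)) s) (at s)"
      using 2 by (simp add: flat_exp_def)
    then show ?thesis
      by (rule has_field_derivative_transform_within_open[of _ _ _ "{..<0}"]) (use 2 in \<open>auto simp: flat_exp_def\<close>)
  next
    case 3
    have "((\<lambda>y. flat_exp q y / y) \<longlongrightarrow> 0) (at 0)"
      unfolding filterlim_at_split
    proof
      show "((\<lambda>y. flat_exp q y / y) \<longlongrightarrow> 0) (at_left 0)"
        by (rule tendsto_eventually) (auto simp: eventually_at_filter flat_exp_def)
      have "((\<lambda>y. poly (pCons 0 q) (inverse y) * exp (- inverse y)) \<longlongrightarrow> 0) (at_right 0)"
        by (rule filterlim_compose[OF poly_times_exp_minus_tendsto filterlim_inverse_at_top_right])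
      then show "((\<lambda>y. flat_exp q y / y) \<longlongrightarrow> 0) (at_right 0)"
        by (rule Lim_transform_eventually)
          (auto simp: eventually_at_filter flat_exp_def divide_inverse mult_ac)
    qed
    then show ?thesis using 3 by (simp add: has_field_derivative_iff flat_exp_def)
  qed
qed

lemma smooth_on_flat_exp: "smooth_on UNIV (flat_exp q)"
proof (rule smooth_on_coinduct[where F = "range flat_exp"])
  fix f :: "real \<Rightarrow> real" and e :: real assume "f \<in> range flat_exp"
  then obtain q where q: "f = flat_exp q" by blast
  have "dir_deriv e f x = flat_exp (smult e (monom 1 2 * (q - pderiv q))) x" for x
    using dir_deriv_eq[OF flat_exp_deriv[of q x, unfolded has_field_derivative_def], of e]
    by (simp add: q flat_exp_def)
  then show "\<exists>g\<in>range flat_exp. \<forall>x\<in>UNIV. dir_deriv e f x = g x" by blast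
qed (auto intro: differentiableI flat_exp_deriv[unfolded has_field_derivative_def])

definition smooth_step :: "real \<Rightarrow> real" where "smooth_step = flat_exp 1"

definition smooth_step' :: "real \<Rightarrow> real" where "smooth_step' = flat_exp (monom 1 2)"

lemma smooth_step_deriv: "(smooth_step has_real_derivative smooth_step' s) (at s)"
  using flat_exp_deriv[of 1 s] by (simp add: smooth_step_def smooth_step'_def)

lemma smooth_on_smooth_step: "open U \<Longrightarrow> smooth_on U f \<Longrightarrow> smooth_on U (\<lambda>x. smooth_step (f x))"
  unfolding smooth_step_def by (rule smooth_on_compose[OF _ _ smooth_on_flat_exp]) auto

lemma smooth_step_nonpos: "s \<le> 0 \<Longrightarrow> smooth_step s = 0" "s \<le> 0 \<Longrightarrow> smooth_step' s = 0"
  by (simp_all add: smooth_step_def smooth_step'_def flat_exp_def)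

lemma smooth_step_pos: "s > 0 \<Longrightarrow> smooth_step s > 0"
  by (simp add: smooth_step_def flat_exp_def)

lemma smooth_step_bounds: "0 \<le> smooth_step s" "smooth_step s \<le> 1"
  by (simp_all add: smooth_step_def flat_exp_def)

lemma smooth_step_tendsto: "(smooth_step \<longlongrightarrow> 1) at_top"
proof -
  have "((\<lambda>s::real. exp (- inverse s)) \<longlongrightarrow> exp (- 0)) at_top"
    by (intro tendsto_intros tendsto_inverse_0_at_top filterlim_ident)
  then have "((\<lambda>s::real. exp (- inverse s)) \<longlongrightarrow> 1) at_top" by simp
  then show ?thesis
    by (rule Lim_transform_eventually)
      (auto simp: smooth_step_def flat_exp_def eventually_at_top_linorder intro!: exI[of _ 1])
qed

text \<open>For \<open>s = j r - 1\<close> this weighted derivative is \<open>j r\<close> times the slope of the step, that is, \<open>r\<close> times the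
  radial derivative of \<open>smooth_step (j r - 1)\<close>.\<close>

lemma smooth_step'_weighted:
  shows "\<bar>(s + 1) * smooth_step' s\<bar> \<le> 3" "((\<lambda>s. (s + 1) * smooth_step' s) \<longlongrightarrow> 0) at_top"
proof -
  have eq: "(s + 1) * smooth_step' s = (inverse s + (inverse s)\<^sup>2) * exp (- inverse s)" if "s > 0" for s
    using that by (simp add: smooth_step'_def flat_exp_def poly_monom field_simps power2_eq_square)
  show "\<bar>(s + 1) * smooth_step' s\<bar> \<le> 3"
  proof (cases "s > 0")
    case True
    have "inverse s + (inverse s)\<^sup>2 \<le> 3 * exp (inverse s)"
    proof -
      have "1 + inverse s + (inverse s)\<^sup>2 / 2 \<le> exp (inverse s)" "inverse s > 0" "(inverse s)\<^sup>2 \<ge> 0"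
        using exp_lower_Taylor_quadratic[of "inverse s"] True by auto
      then show ?thesis by linarith
    qed
    then show ?thesis unfolding eq[OF True] using True
      by (simp add: exp_minus field_simps abs_of_pos add_pos_pos)
  qed (simp add: smooth_step_nonpos)
  have "((\<lambda>s::real. (inverse s + (inverse s)\<^sup>2) * exp (- inverse s)) \<longlongrightarrow> (0 + 0\<^sup>2) * exp (- 0)) at_top"
    by (intro tendsto_intros tendsto_inverse_0_at_top filterlim_ident)
  then have "((\<lambda>s::real. (inverse s + (inverse s)\<^sup>2) * exp (- inverse s)) \<longlongrightarrow> 0) at_top" by simp
  then show "((\<lambda>s. (s + 1) * smooth_step' s) \<longlongrightarrow> 0) at_top"
    by (rule Lim_transform_eventually)
      (auto simp: eq eventually_at_top_linorder intro!: exI[of _ 1])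
qed


section \<open>Sobolev regularity of homogeneous maps\<close>

lemma has_derivative_inverse_norm:
  fixes x :: "'a::euclidean_space"
  assumes "x \<noteq> 0"
  shows "((\<lambda>x. inverse (norm x)) has_derivative (\<lambda>h. - (x \<bullet> h) * inverse (norm x) ^ 3)) (at x)"
proof -
  have "((\<lambda>x. inverse (norm x)) has_derivative
      (\<lambda>h. - (inverse (norm x) * (h \<bullet> sgn x) * inverse (norm x)))) (at x)"
    using assms by (intro Deriv.has_derivative_inverse has_derivative_norm) auto
  then show ?thesis
    by (rule has_derivative_eq_rhs)
      (auto simp: sgn_div_norm power3_eq_cube inner_commute fun_eq_iff)
qed

text \<open>The algebra generated by the coordinates of \<open>x/|x|\<close> and by \<open>1/|x|\<close>, graded by the order \<open>k\<close> of the
  decay. Differentiation maps grade \<open>k\<close> to grade \<open>k + 1\<close>, and grade \<open>k\<close> is square integrable near the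
  origin once \<open>2 k < n\<close>; for the maps \<open>\<phi>\<^sub>a\<close>, which have grade \<open>0\<close>, this is where \<open>n \<ge> 7\<close> and three
  derivatives meet. Since \<open>inverse 0 = 0\<close>, all these functions are defined at the origin too.\<close>

inductive homog :: "nat \<Rightarrow> ('a::euclidean_space \<Rightarrow> real) \<Rightarrow> bool" where
  homog_const: "homog 0 (\<lambda>x. c)"
| homog_dir: "homog 0 (\<lambda>x. (x \<bullet> v) * inverse (norm x))"
| homog_rad: "homog 1 (\<lambda>x. inverse (norm x))"
| homog_mult: "homog k f \<Longrightarrow> homog l g \<Longrightarrow> homog (k + l) (\<lambda>x. f x * g x)"
| homog_add: "homog k f \<Longrightarrow> homog k g \<Longrightarrow> homog k (\<lambda>x. f x + g x)"

lemma homog_scale: "homog k f \<Longrightarrow> homog k (\<lambda>x. c * f x)"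
  using homog_mult[OF homog_const] by fastforce

lemma homog_rad_power: "homog k (\<lambda>x. inverse (norm x) ^ k)"
proof (induction k)
  case (Suc k)
  show ?case using homog_mult[OF homog_rad Suc] by simp
qed (use homog_const[of 1] in simp)

lemma homog_bound: "homog k f \<Longrightarrow> \<exists>C\<ge>0. \<forall>x. \<bar>f x\<bar> \<le> C * inverse (norm x) ^ k"
proof (induction rule: homog.induct)
  case (homog_const c)
  show ?case by (intro exI[of _ "\<bar>c\<bar>"]) auto
next
  case (homog_dir v)
  have "\<bar>x \<bullet> v * inverse (norm x)\<bar> \<le> norm v" for x :: 'a
  proof (cases "x = 0")
    case False
    then show ?thesis using Cauchy_Schwarz_ineq2[of x v] by (simp add: abs_mult field_simps)
  qed simp
  then show ?case by (intro exI[of _ "norm v"]) auto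
next
  case homog_rad
  show ?case by (intro exI[of _ 1]) auto
next
  case (homog_mult k f l g)
  then obtain C D where C: "C \<ge> 0" "\<And>x. \<bar>f x\<bar> \<le> C * inverse (norm x) ^ k"
    and D: "D \<ge> 0" "\<And>x. \<bar>g x\<bar> \<le> D * inverse (norm x) ^ l" by blast
  have "\<bar>f x * g x\<bar> \<le> (C * D) * inverse (norm x) ^ (k + l)" for x
    using mult_mono[OF C(2)[of x] D(2)[of x]] C(1) by (simp add: abs_mult power_add mult_ac)
  then show ?case using C D by (intro exI[of _ "C * D"]) auto
next
  case (homog_add k f g)
  then obtain C D where C: "C \<ge> 0" "\<And>x. \<bar>f x\<bar> \<le> C * inverse (norm x) ^ k"
    and D: "D \<ge> 0" "\<And>x. \<bar>g x\<bar> \<le> D * inverse (norm x) ^ k" by blast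
  have "\<bar>f x + g x\<bar> \<le> (C + D) * inverse (norm x) ^ k" for x
    using C(2)[of x] D(2)[of x] abs_triangle_ineq[of "f x" "g x"] by (simp add: algebra_simps)
  then show ?case using C D by (intro exI[of _ "C + D"]) auto
qed

lemma homog_measurable: "homog k f \<Longrightarrow> f \<in> borel_measurable borel"
  by (induction rule: homog.induct) auto

lemma homog_dir_deriv:
  "homog k f \<Longrightarrow> \<exists>g. homog (Suc k) g \<and> (\<forall>x. x \<noteq> 0 \<longrightarrow> f differentiable (at x) \<and> dir_deriv e f x = g x)"
proof (induction rule: homog.induct)
  case (homog_const c)
  have "homog (Suc 0) (\<lambda>x :: 'a. 0)" using homog_scale[OF homog_rad, of 0] by simp
  then show ?case by (intro exI[of _ "\<lambda>x. 0"]) auto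
next
  case (homog_dir v)
  define g where "g x = (e \<bullet> v) * inverse (norm x) +
     - 1 * (inverse (norm x) * ((x \<bullet> v * inverse (norm x)) * (x \<bullet> e * inverse (norm x))))" for x
  have "homog (Suc 0) g"
    unfolding g_def[abs_def]
    using homog_mult[OF homog_rad homog_mult[OF homog.homog_dir homog.homog_dir]] homog_rad
    by (intro homog_add homog_scale) simp_all
  moreover have D: "((\<lambda>x. (x \<bullet> v) * inverse (norm x)) has_derivative
      (\<lambda>h. (h \<bullet> v) * inverse (norm x) + (x \<bullet> v) * (- (x \<bullet> h) * inverse (norm x) ^ 3))) (at x)" if "x \<noteq> 0" for x
    by (rule has_derivative_eq_rhs[OF has_derivative_mult[OF has_derivative_inner_left[OF has_derivative_ident] has_derivative_inverse_norm[OF that]]])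
      (auto simp: fun_eq_iff)
  moreover have "dir_deriv e (\<lambda>x. (x \<bullet> v) * inverse (norm x)) x = g x" if "x \<noteq> 0" for x
    using dir_deriv_eq[OF D[OF that], of e] by (simp add: g_def power3_eq_cube algebra_simps)
  ultimately show ?case
    by (intro exI[of _ g]) (auto intro: differentiableI)
next
  case homog_rad
  define g where "g x = - 1 * (inverse (norm x) * (inverse (norm x) * (x \<bullet> e * inverse (norm x))))" for x
  have "homog (Suc 1) g"
    unfolding g_def[abs_def]
    using homog_mult[OF homog.homog_rad homog_mult[OF homog.homog_rad homog.homog_dir]]
    by (intro homog_scale) simp
  moreover have "dir_deriv e (\<lambda>x. inverse (norm x)) x = g x" if "x \<noteq> 0" for x
    using dir_deriv_eq[OF has_derivative_inverse_norm[OF that], of e] by (simp add: g_def power3_eq_cube)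
  ultimately show ?case
    by (intro exI[of _ g]) (auto intro: differentiableI has_derivative_inverse_norm)
next
  case (homog_mult k f l g)
  then obtain f' g' where f': "homog (Suc k) f'" "\<And>x. x \<noteq> 0 \<Longrightarrow> f differentiable (at x)" "\<And>x. x \<noteq> 0 \<Longrightarrow> dir_deriv e f x = f' x"
    and g': "homog (Suc l) g'" "\<And>x. x \<noteq> 0 \<Longrightarrow> g differentiable (at x)" "\<And>x. x \<noteq> 0 \<Longrightarrow> dir_deriv e g x = g' x"
    by metis
  have "homog (Suc (k + l)) (\<lambda>x. f x * g' x + f' x * g x)"
    using homog_add[of "Suc (k + l)" "\<lambda>x. f x * g' x" "\<lambda>x. f' x * g x"]
      homog.homog_mult[OF homog_mult.hyps(1) g'(1)] homog.homog_mult[OF f'(1) homog_mult.hyps(2)] by simp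
  moreover have "(\<lambda>x. f x * g x) differentiable (at x)" "dir_deriv e (\<lambda>x. f x * g x) x = f x * g' x + f' x * g x"
    if "x \<noteq> 0" for x
    using dir_deriv_bilinear(1)[OF bounded_bilinear_mult f'(2)[OF that] g'(2)[OF that]]
      dir_deriv_bilinear(2)[OF bounded_bilinear_mult f'(2)[OF that] g'(2)[OF that], of e] f'(3)[OF that] g'(3)[OF that] by auto
  ultimately show ?case by blast
next
  case (homog_add k f g)
  then obtain f' g' where f': "homog (Suc k) f'" "\<And>x. x \<noteq> 0 \<Longrightarrow> f differentiable (at x)" "\<And>x. x \<noteq> 0 \<Longrightarrow> dir_deriv e f x = f' x"
    and g': "homog (Suc k) g'" "\<And>x. x \<noteq> 0 \<Longrightarrow> g differentiable (at x)" "\<And>x. x \<noteq> 0 \<Longrightarrow> dir_deriv e g x = g' x"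
    by metis
  show ?case
  proof (intro exI[of _ "\<lambda>x. f' x + g' x"] conjI allI impI)
    show "homog (Suc k) (\<lambda>x. f' x + g' x)" using homog.homog_add[OF f'(1) g'(1)] .
    fix x :: 'a assume "x \<noteq> 0"
    then show "(\<lambda>x. f x + g x) differentiable (at x)" "dir_deriv e (\<lambda>x. f x + g x) x = f' x + g' x"
      using f' g' dir_deriv_add[OF f'(2) g'(2)] by (auto intro: differentiable_add)
  qed
qed

lemma homog_smooth: "homog k f \<Longrightarrow> smooth_on (- {0}) f"
proof (rule smooth_on_coinduct[where F = "{f. \<exists>k. homog k f}"])
  fix f :: "'a \<Rightarrow> real" and e :: 'a assume "f \<in> {f. \<exists>k. homog k f}"
  then obtain k where "homog k f" by blast
  from homog_dir_deriv[OF this] obtain g where "homog (Suc k) g" "\<forall>x. x \<noteq> 0 \<longrightarrow> dir_deriv e f x = g x"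
    by blast
  then show "\<exists>g\<in>{f. \<exists>k. homog k f}. \<forall>x\<in>- {0}. dir_deriv e f x = g x"
    by (intro bexI[of _ g]) auto
next
  fix f :: "'a \<Rightarrow> real" and x :: 'a assume "f \<in> {f. \<exists>k. homog k f}" "x \<in> - {0}"
  then show "f differentiable (at x)" using homog_dir_deriv by auto
qed auto

lemma smooth_on_norm: "smooth_on (- {0}) (norm :: 'a::euclidean_space \<Rightarrow> real)"
  using smooth_on_inverse[OF _ homog_smooth[OF homog_rad]] by (simp add: open_Compl)

text \<open>On the shell \<open>2\<^sup>-\<^sup>j\<^sup>-\<^sup>1 \<le> |x| \<le> 2\<^sup>-\<^sup>j\<close> the integrand is at most \<open>2\<^sup>k\<^sup>(\<^sup>j\<^sup>+\<^sup>1\<^sup>)\<close>, and the ball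
  containing the shell has volume proportional to \<open>2\<^sup>-\<^sup>n\<^sup>j\<close>.\<close>

lemma integrable_inverse_norm_power:
  assumes "k < DIM('a::euclidean_space)"
  shows "integrable lborel (\<lambda>x::'a. indicator (ball 0 1) x * inverse (norm x) ^ k)"
proof (rule integrableI_bounded)
  let ?f = "\<lambda>x::'a. indicator (ball 0 1) x * inverse (norm x) ^ k"
  let ?n = "DIM('a)"
  define g :: "nat \<Rightarrow> 'a \<Rightarrow> real" where "g j x = 2 ^ (k * Suc j) * indicator (cball 0 ((1 / 2) ^ j)) x" for j and x :: 'a
  have le: "ennreal (norm (?f x)) \<le> (\<Sum>j. ennreal (g j x))" for x
  proof -
    have "\<exists>j. norm (?f x) \<le> g j x"
    proof (cases "norm x < 1 \<and> x \<noteq> 0")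
      case False
      then show ?thesis
        by (intro exI[of _ 0]) (auto simp: g_def indicator_def power_0_left)
    next
      case True
      obtain m where m: "(1 / 2) ^ m < norm x" using real_arch_pow_inv[of "norm x" "1 / 2"] True by auto
      define j where "j = (LEAST m. (1 / 2) ^ m < norm x)"
      have j: "(1 / 2) ^ j < norm x" unfolding j_def by (rule LeastI[of _ m]) (rule m)
      have "j \<noteq> 0" using j True by (intro notI) auto
      then obtain i where i: "j = Suc i" using not0_implies_Suc by blast
      have "norm x \<le> (1 / 2) ^ i" using not_less_Least[of i "\<lambda>m. (1 / 2) ^ m < norm x"] i unfolding j_def by auto
      moreover have "inverse (norm x) ^ k \<le> (2 ^ Suc i) ^ k"
      proof (rule power_mono)
        have "inverse (norm x) \<le> inverse ((1 / 2) ^ j)" using j by (intro le_imp_inverse_le) auto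
        then show "inverse (norm x) \<le> 2 ^ Suc i" by (simp add: i power_one_over field_simps)
      qed simp
      ultimately have "norm (?f x) \<le> g i x"
        using True by (auto simp: g_def indicator_def power_mult[symmetric] mult.commute power_add)
      then show ?thesis by blast
    qed
    then obtain j where "norm (?f x) \<le> g j x" by blast
    then have "ennreal (norm (?f x)) \<le> (\<Sum>i\<in>{j}. ennreal (g i x))" by (simp add: ennreal_leI)
    also have "\<dots> \<le> (\<Sum>i. ennreal (g i x))" by (intro sum_le_suminf) auto
    finally show ?thesis .
  qed
  have int: "(\<integral>\<^sup>+x. ennreal (g j x) \<partial>lborel) = ennreal (2 ^ k * unit_ball_vol ?n * (2 ^ k / 2 ^ ?n) ^ j)" for j
  proof -
    have "(\<integral>\<^sup>+x. ennreal (g j x) \<partial>lborel) = (\<integral>\<^sup>+x. ennreal (2 ^ (k * Suc j)) * indicator (cball (0::'a) ((1 / 2) ^ j)) x \<partial>lborel)"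
      by (intro nn_integral_cong) (auto simp: g_def indicator_def)
    also have "\<dots> = ennreal (2 ^ (k * Suc j)) * ennreal (unit_ball_vol ?n * ((1 / 2) ^ j) ^ ?n)"
      by (subst nn_integral_cmult_indicator) (auto simp: emeasure_cball)
    also have "\<dots> = ennreal (2 ^ (k * Suc j) * (unit_ball_vol ?n * ((1 / 2) ^ j) ^ ?n))"
      by (simp add: ennreal_mult)
    also have "2 ^ (k * Suc j) * (unit_ball_vol ?n * ((1 / 2) ^ j) ^ ?n) = 2 ^ k * unit_ball_vol ?n * (2 ^ k / 2 ^ ?n) ^ j"
    proof -
      have "((1 / 2 :: real) ^ j) ^ ?n = ((1 / 2) ^ ?n) ^ j" by (simp only: power_mult[symmetric] mult.commute)
      moreover have "(2::real) ^ (k * Suc j) = 2 ^ k * (2 ^ k) ^ j" by (simp add: power_add power_mult)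
      ultimately show ?thesis by (simp add: power_divide)
    qed
    finally show ?thesis .
  qed
  have ratio: "(2::real) ^ k / 2 ^ ?n < 1" using assms by simp
  have "(\<integral>\<^sup>+x. ennreal (norm (?f x)) \<partial>lborel) \<le> (\<integral>\<^sup>+x. (\<Sum>j. ennreal (g j x)) \<partial>lborel)"
    by (intro nn_integral_mono le)
  also have "\<dots> = (\<Sum>j. \<integral>\<^sup>+x. ennreal (g j x) \<partial>lborel)"
    unfolding g_def
    by (intro nn_integral_suminf measurable_compose[OF _ measurable_ennreal] borel_measurable_times
        borel_measurable_const borel_measurable_indicator) auto
  also have "\<dots> = (\<Sum>j. ennreal (2 ^ k * unit_ball_vol ?n * (2 ^ k / 2 ^ ?n) ^ j))" unfolding int ..
  also have "\<dots> = ennreal (\<Sum>j. 2 ^ k * unit_ball_vol ?n * (2 ^ k / 2 ^ ?n) ^ j)"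
    using ratio by (intro suminf_ennreal2 summable_mult summable_geometric) auto
  also have "\<dots> < \<infinity>" by simp
  finally show "(\<integral>\<^sup>+x. ennreal (norm (?f x)) \<partial>lborel) < \<infinity>" .
qed (auto intro!: borel_measurable_times borel_measurable_indicator borel_measurable_power)

lemma homog_integrable:
  fixes f :: "'a::euclidean_space \<Rightarrow> real"
  assumes f: "homog k f" "k < DIM('a)" and \<xi>: "\<xi> \<in> borel_measurable borel" "\<And>x. \<bar>\<xi> x\<bar> \<le> B"
  shows "integrable (lebesgue_on (ball 0 1)) (\<lambda>x. \<xi> x * f x)"
proof -
  obtain C where C: "C \<ge> 0" "\<And>x. \<bar>f x\<bar> \<le> C * inverse (norm x) ^ k" using homog_bound[OF f(1)] by blast
  have "B \<ge> 0" using \<xi>(2)[of 0] by linarith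
  have "integrable lborel (\<lambda>x. indicator (ball 0 1) x * (\<xi> x * f x))"
  proof (rule Bochner_Integration.integrable_bound)
    show "integrable lborel (\<lambda>x::'a. B * C * (indicator (ball 0 1) x * inverse (norm x) ^ k))"
      using integrable_inverse_norm_power[OF f(2)] by simp
    show "(\<lambda>x. indicator (ball 0 1) x * (\<xi> x * f x)) \<in> borel_measurable lborel"
      using homog_measurable[OF f(1)] \<xi>(1)
      by (intro borel_measurable_times borel_measurable_indicator) auto
    have "\<bar>\<xi> x * f x\<bar> \<le> B * C * inverse (norm x) ^ k" for x
      using mult_mono[OF \<xi>(2)[of x] C(2)[of x]] \<open>B \<ge> 0\<close> by (simp add: abs_mult mult_ac)
    then show "AE x in lborel. norm (indicator (ball 0 1) x * (\<xi> x * f x)) \<le> norm (B * C * (indicator (ball 0 1) x * inverse (norm x) ^ k))"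
      using \<open>B \<ge> 0\<close> C(1) by (intro AE_I2) (auto simp: indicator_def abs_mult)
  qed
  then have "integrable lebesgue (\<lambda>x. indicator (ball 0 1) x *\<^sub>R (\<xi> x * f x))"
    by (subst integrable_completion) (auto dest: borel_measurable_integrable)
  then show ?thesis by (subst integrable_restrict_space) auto
qed

lemma AE_lebesgue_on_ball_nonzero: "AE x in lebesgue_on (ball (0::'a::euclidean_space) 1). x \<noteq> 0"
  by (rule AE_restrict_space_iff[THEN iffD2])
    (auto intro: AE_mp[OF AE_not_in[of "{0}"]] simp: null_sets_completionI)

text \<open>The cutoff \<open>\<psi>\<^sub>j(x) = smooth_step (j |x| - 1)\<close> removes the singularity. Its gradient is bounded by
  \<open>3/|x|\<close> uniformly in \<open>j\<close> and tends to \<open>0\<close> off the origin, so it disappears in the limit by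
  dominated convergence.\<close>

lemma homog_integration_by_parts:
  fixes f :: "'a::euclidean_space \<Rightarrow> real"
  assumes f: "homog k f" and g: "homog (Suc k) g" "\<And>x. x \<noteq> 0 \<Longrightarrow> dir_deriv e f x = g x"
    and k: "Suc k < DIM('a)" and e: "e \<in> Basis"
    and \<eta>: "smooth_on UNIV \<eta>" and K: "compact K" "K \<subseteq> ball 0 1" "\<And>x. x \<notin> K \<Longrightarrow> \<eta> x = 0"
  shows "(\<integral>x. dir_deriv e \<eta> x * f x \<partial>lebesgue_on (ball 0 1)) = - (\<integral>x. \<eta> x * g x \<partial>lebesgue_on (ball 0 1))"
proof -
  let ?M = "lebesgue_on (ball (0::'a) 1)"
  let ?G = "\<lambda>s. (s + 1) * smooth_step' s"
  have "closed K" using K compact_imp_closed by blast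
  have \<eta>': "smooth_on UNIV (dir_deriv e \<eta>)" using smooth_on_dir_deriv[OF \<eta> e] .
  have zero': "dir_deriv e \<eta> x = 0" if "x \<notin> K" for x
    using dir_deriv_transform(2)[of "- K" x \<eta> "\<lambda>_. 0" e] \<open>closed K\<close> K(3) that by (simp add: open_Compl)
  have bdd: "\<exists>B. \<forall>x. \<bar>\<xi> x\<bar> \<le> B" if \<xi>: "smooth_on UNIV \<xi>" "\<And>x. x \<notin> K \<Longrightarrow> \<xi> x = 0" for \<xi> :: "'a \<Rightarrow> real"
  proof -
    have "bounded (\<xi> ` K)"
      using compact_continuous_image[OF continuous_on_subset[OF smooth_on_continuous[OF \<xi>(1)]] K(1)]
        compact_imp_bounded by blast
    then obtain B where "B > 0" "\<And>x. x \<in> K \<Longrightarrow> \<bar>\<xi> x\<bar> \<le> B" unfolding bounded_pos by auto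
    then show ?thesis using \<xi>(2) by (intro exI[of _ B]) (metis abs_zero less_eq_real_def)
  qed
  have int: "integrable ?M (\<lambda>x. \<xi> x * h x)"
    if \<xi>: "smooth_on UNIV \<xi>" "\<And>x. x \<notin> K \<Longrightarrow> \<xi> x = 0" and h: "homog l h" "l \<le> Suc k" for \<xi> h :: "'a \<Rightarrow> real" and l
  proof -
    obtain B where "\<And>x. \<bar>\<xi> x\<bar> \<le> B" using bdd[OF \<xi>] by blast
    then show ?thesis
      using homog_integrable[OF h(1) _ borel_measurable_continuous_onI[OF smooth_on_continuous[OF \<xi>(1)]]] k h(2)
      by auto
  qed
  have rad: "homog (Suc k) (\<lambda>x. inverse (norm x) * f x)" using homog_mult[OF homog_rad f] by simp
  have i1: "integrable ?M (\<lambda>x. dir_deriv e \<eta> x * f x)" and i2: "integrable ?M (\<lambda>x. \<eta> x * g x)"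
    and i3: "integrable ?M (\<lambda>x. \<eta> x * (inverse (norm x) * f x))"
    using int[OF \<eta>' zero' f] int[OF \<eta> K(3) g(1)] int[OF \<eta> K(3) rad] by auto
  define A where "A x = dir_deriv e \<eta> x * f x + \<eta> x * g x" for x
  define S where "S j x = smooth_step (real (Suc j) * norm x - 1) * A x +
     ?G (real (Suc j) * norm x - 1) * ((x \<bullet> e * inverse (norm x)) * (\<eta> x * (inverse (norm x) * f x)))" for j x
  have u: "\<bar>x \<bullet> e * inverse (norm x)\<bar> \<le> 1" for x
  proof (cases "x = 0")
    case False
    then show ?thesis using Cauchy_Schwarz_ineq2[of x e] e by (simp add: abs_mult field_simps)
  qed simp
  have S0: "(\<integral>x. S j x \<partial>?M) = 0" for j
  proof -
    define \<psi> where "\<psi> x = smooth_step (real (Suc j) * norm x - 1)" for x :: 'a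
    define h where "h x = \<psi> x * (\<eta> x * f x)" for x
    define L where "L = K - ball 0 (1 / real (Suc j))"
    have small: "S j x = 0 \<and> h x = 0" if "x \<notin> L" for x
    proof (cases "x \<in> K")
      case True
      then have "norm x < 1 / real (Suc j)" using that by (auto simp: L_def)
      then have "real (Suc j) * norm x - 1 \<le> 0" by (simp add: field_simps)
      then show ?thesis by (simp add: S_def h_def \<psi>_def smooth_step_nonpos)
    qed (simp add: S_def A_def h_def K(3) zero')
    have "compact L" unfolding L_def using K(1) by (intro compact_diff) auto
    have "0 \<notin> L" by (simp add: L_def)
    have s\<psi>: "smooth_on (- {0}) \<psi>"
      unfolding \<psi>_def[abs_def] using smooth_on_norm
      by (intro smooth_on_smooth_step smooth_on_sub smooth_on_mult) (auto simp: open_Compl)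
    have s\<eta>: "smooth_on (- {0}) \<eta>" using smooth_on_subset[OF \<eta>] by blast
    have sf: "smooth_on (- {0}) f" using homog_smooth[OF f] .
    have sh: "smooth_on (- {0}) h"
      unfolding h_def[abs_def] using s\<psi> s\<eta> sf by (intro smooth_on_mult) (auto simp: open_Compl)
    have "dir_deriv e h x = S j x" if "x \<noteq> 0" for x
    proof -
      let ?s = "real (Suc j) * norm x - 1"
      have "((\<lambda>x. real (Suc j) * norm x - 1) has_derivative (\<lambda>v. real (Suc j) * (v \<bullet> sgn x))) (at x)"
        using has_derivative_diff[OF has_derivative_mult_right[OF has_derivative_norm[OF that]] has_derivative_const] by simp
      from DERIV_compose_FDERIV[OF smooth_step_deriv this]
      have "dir_deriv e \<psi> x = real (Suc j) * (e \<bullet> sgn x) * smooth_step' ?s"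
        unfolding \<psi>_def[abs_def] by (rule dir_deriv_eq)
      also have "\<dots> = ?G ?s * (x \<bullet> e * inverse (norm x) * inverse (norm x))"
        using that by (simp add: sgn_div_norm field_simps inner_commute)
      finally have d\<psi>: "dir_deriv e \<psi> x = ?G ?s * (x \<bullet> e * inverse (norm x) * inverse (norm x))" .
      have d: "\<psi> differentiable (at x)" "\<eta> differentiable (at x)" "f differentiable (at x)"
        using smooth_on_diff s\<psi> s\<eta> sf that by auto
      note B = dir_deriv_bilinear[OF bounded_bilinear_mult]
      have "dir_deriv e h x = \<psi> x * dir_deriv e (\<lambda>x. \<eta> x * f x) x + dir_deriv e \<psi> x * (\<eta> x * f x)"
        unfolding h_def[abs_def] by (rule B(2)[OF d(1) B(1)[OF d(2,3)]])
      also have "dir_deriv e (\<lambda>x. \<eta> x * f x) x = A x"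
        using B(2)[OF d(2,3), of e] g(2)[OF that] by (simp add: A_def algebra_simps)
      finally have "dir_deriv e h x = \<psi> x * A x +
          ?G ?s * (x \<bullet> e * inverse (norm x) * inverse (norm x)) * (\<eta> x * f x)" unfolding d\<psi> .
      then show ?thesis by (simp add: S_def \<psi>_def mult_ac)
    qed
    then have "dir_deriv e h x = S j x" if "x \<in> L" for x using that \<open>0 \<notin> L\<close> by metis
    then have "(\<integral>x. S j x \<partial>lebesgue_on L) = (\<integral>x. dir_deriv e h x \<partial>lebesgue_on L)"
      by (intro Bochner_Integration.integral_cong) auto
    also have "\<dots> = 0"
      using \<open>compact L\<close> \<open>0 \<notin> L\<close> sh e small
      by (intro integral_dir_deriv_compact_support[of "- {0}"]) (auto simp: open_Compl)
    finally have "(\<integral>x. S j x \<partial>lebesgue_on L) = 0" .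
    moreover have "(\<integral>x. S j x \<partial>lebesgue_on L) = (\<integral>x. S j x \<partial>?M)"
    proof -
      have "(\<integral>x. S j x \<partial>lebesgue_on L) = (\<integral>x. indicator L x *\<^sub>R S j x \<partial>lebesgue)"
        using \<open>compact L\<close> by (intro integral_restrict_space) (auto simp: compact_imp_closed)
      also have "\<dots> = (\<integral>x. indicator (ball 0 1) x *\<^sub>R S j x \<partial>lebesgue)"
        using small K(2) by (intro Bochner_Integration.integral_cong) (auto simp: indicator_def L_def)
      also have "\<dots> = (\<integral>x. S j x \<partial>?M)" by (intro integral_restrict_space[symmetric]) auto
      finally show ?thesis .
    qed
    ultimately show ?thesis by simp
  qed
  have iA: "integrable ?M A" unfolding A_def[abs_def] using i1 i2 by (rule Bochner_Integration.integrable_add)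
  have "(\<lambda>j. \<integral>x. S j x \<partial>?M) \<longlonglongrightarrow> (\<integral>x. A x \<partial>?M)"
  proof (rule integral_dominated_convergence[where w = "\<lambda>x. \<bar>A x\<bar> + 3 * \<bar>\<eta> x * (inverse (norm x) * f x)\<bar>"])
    show "A \<in> borel_measurable ?M" using iA by auto
    have lin: "(\<lambda>x::'a. real (Suc j) * norm x - 1) \<in> borel_measurable borel" for j
      by (intro borel_measurable_diff borel_measurable_times borel_measurable_norm borel_measurable_const measurable_ident)
    have "smooth_step \<in> borel_measurable borel" "smooth_step' \<in> borel_measurable borel"
      unfolding smooth_step_def smooth_step'_def
      by (rule borel_measurable_continuous_onI, rule smooth_on_continuous, rule smooth_on_flat_exp)+
    note comp = measurable_compose[OF lin this(1)] measurable_compose[OF lin this(2)]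
    have m1: "(\<lambda>x::'a. smooth_step (real (Suc j) * norm x - 1)) \<in> borel_measurable borel" for j
      by (rule comp)
    have m2: "(\<lambda>x::'a. ?G (real (Suc j) * norm x - 1) * (x \<bullet> e * inverse (norm x))) \<in> borel_measurable borel" for j
      by (intro borel_measurable_times[OF _ homog_measurable[OF homog_dir]] borel_measurable_times
          borel_measurable_add lin comp borel_measurable_const)
    have restr: "\<phi> \<in> borel_measurable ?M" if "\<phi> \<in> borel_measurable borel" for \<phi> :: "'a \<Rightarrow> real"
      using that by (intro measurable_restrict_space1 measurable_completion) simp
    show "S j \<in> borel_measurable ?M" for j
      using borel_measurable_times[OF restr[OF m1[of j]] borel_measurable_integrable[OF iA]]
        borel_measurable_times[OF restr[OF m2[of j]] borel_measurable_integrable[OF i3]]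
      unfolding S_def[abs_def] by (auto simp: mult.assoc intro: borel_measurable_add)
    show "integrable ?M (\<lambda>x. \<bar>A x\<bar> + 3 * \<bar>\<eta> x * (inverse (norm x) * f x)\<bar>)"
      using iA i3 by (intro Bochner_Integration.integrable_add integrable_abs integrable_mult_right)
    show "AE x in ?M. (\<lambda>j. S j x) \<longlonglongrightarrow> A x"
      using AE_lebesgue_on_ball_nonzero
    proof eventually_elim
      fix x :: 'a assume "x \<noteq> 0"
      have "filterlim (\<lambda>j. norm x * real (Suc j)) at_top sequentially"
        using \<open>x \<noteq> 0\<close> by (intro filterlim_tendsto_pos_mult_at_top[OF tendsto_const]
            filterlim_compose[OF filterlim_real_sequentially filterlim_Suc]) auto
      then have lim: "filterlim (\<lambda>j. real (Suc j) * norm x - 1) at_top sequentially"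
        using filterlim_tendsto_add_at_top[OF tendsto_const[of "-1"]] by (simp add: mult.commute)
      have "(\<lambda>j. S j x) \<longlonglongrightarrow> 1 * A x + 0 * ((x \<bullet> e * inverse (norm x)) * (\<eta> x * (inverse (norm x) * f x)))"
        unfolding S_def
        by (intro tendsto_intros filterlim_compose[OF smooth_step_tendsto lim]
            filterlim_compose[OF smooth_step'_weighted(2) lim])
      then show "(\<lambda>j. S j x) \<longlonglongrightarrow> A x" by simp
    qed
    show "AE x in ?M. norm (S j x) \<le> \<bar>A x\<bar> + 3 * \<bar>\<eta> x * (inverse (norm x) * f x)\<bar>" for j
    proof (rule AE_I2)
      fix x :: 'a
      let ?s = "real (Suc j) * norm x - 1"
      have "\<bar>smooth_step ?s * A x\<bar> \<le> 1 * \<bar>A x\<bar>"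
        unfolding abs_mult using smooth_step_bounds[of ?s] by (intro mult_right_mono) auto
      moreover have "\<bar>?G ?s * ((x \<bullet> e * inverse (norm x)) * (\<eta> x * (inverse (norm x) * f x)))\<bar>
          \<le> 3 * (1 * \<bar>\<eta> x * (inverse (norm x) * f x)\<bar>)"
        unfolding abs_mult[of "?G ?s"] abs_mult[of "x \<bullet> e * inverse (norm x)"]
        using smooth_step'_weighted(1)[of ?s] u[of x] by (intro mult_mono) auto
      ultimately show "norm (S j x) \<le> \<bar>A x\<bar> + 3 * \<bar>\<eta> x * (inverse (norm x) * f x)\<bar>"
        unfolding S_def real_norm_def by (smt (verit))
    qed
  qed
  then have "(\<integral>x. A x \<partial>?M) = 0" unfolding S0 using LIMSEQ_unique tendsto_const by blast
  then show ?thesis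
    using Bochner_Integration.integral_add[OF i1 i2] by (simp add: A_def[abs_def])
qed

text \<open>Each derivative moved off the test function costs one order of decay, and the boundary term at the
  origin vanishes as long as the order stays below the dimension.\<close>

lemma homog_weak_deriv:
  fixes f :: "'a::euclidean_space \<Rightarrow> real"
  assumes "homog k f" "vs \<in> lists Basis" "k + length vs < DIM('a)"
  shows "\<exists>g. homog (k + length vs) g \<and>
     (\<forall>\<eta> K. smooth_on UNIV \<eta> \<longrightarrow> compact K \<longrightarrow> K \<subseteq> ball 0 1 \<longrightarrow> (\<forall>x. x \<notin> K \<longrightarrow> \<eta> x = 0) \<longrightarrow>
        (\<integral>x. iter_deriv vs \<eta> x * f x \<partial>lebesgue_on (ball 0 1)) =
        (-1) ^ length vs * (\<integral>x. \<eta> x * g x \<partial>lebesgue_on (ball 0 1)))"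
  using assms
proof (induction vs arbitrary: k f)
  case Nil
  then show ?case by (intro exI[of _ f]) auto
next
  case (Cons v vs)
  obtain f' where f': "homog (Suc k) f'" "\<And>x. x \<noteq> 0 \<Longrightarrow> dir_deriv v f x = f' x"
    using homog_dir_deriv[OF Cons.prems(1), of v] by blast
  obtain g where g: "homog (Suc k + length vs) g"
    and weak: "\<And>\<eta> K. smooth_on UNIV \<eta> \<Longrightarrow> compact K \<Longrightarrow> K \<subseteq> ball 0 1 \<Longrightarrow> (\<And>x. x \<notin> K \<Longrightarrow> \<eta> x = 0) \<Longrightarrow>
        (\<integral>x. iter_deriv vs \<eta> x * f' x \<partial>lebesgue_on (ball 0 1)) =
        (-1) ^ length vs * (\<integral>x. \<eta> x * g x \<partial>lebesgue_on (ball 0 1))"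
    using Cons.IH[OF f'(1)] Cons.prems by auto
  show ?case
  proof (intro exI[of _ g] conjI allI impI)
    show "homog (k + length (v # vs)) g" using g by simp
    fix \<eta> :: "'a \<Rightarrow> real" and K assume \<eta>: "smooth_on UNIV \<eta>" "compact K" "K \<subseteq> ball (0::'a) 1" "\<forall>x. x \<notin> K \<longrightarrow> \<eta> x = 0"
    have zero: "iter_deriv ws \<eta> x = 0" if "x \<notin> K" for ws x
      using that
    proof (induction ws arbitrary: x)
      case (Cons w ws)
      then show ?case
        using dir_deriv_transform(2)[of "- K" x "iter_deriv ws \<eta>" "\<lambda>_. 0" w] compact_imp_closed[OF \<eta>(2)]
        by (simp add: open_Compl)
    qed (use \<eta>(4) in auto)
    have "(\<integral>x. iter_deriv (v # vs) \<eta> x * f x \<partial>lebesgue_on (ball 0 1)) =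
       - (\<integral>x. iter_deriv vs \<eta> x * f' x \<partial>lebesgue_on (ball 0 1))"
      using Cons.prems \<eta> zero smooth_on_iter_deriv[OF \<eta>(1)]
      by (simp, intro homog_integration_by_parts[OF Cons.prems(1) f']) auto
    also have "\<dots> = (-1) ^ length (v # vs) * (\<integral>x. \<eta> x * g x \<partial>lebesgue_on (ball 0 1))"
      using weak[OF \<eta>(1-3)] \<eta>(4) by simp
    finally show "(\<integral>x. iter_deriv (v # vs) \<eta> x * f x \<partial>lebesgue_on (ball 0 1)) =
      (-1) ^ length (v # vs) * (\<integral>x. \<eta> x * g x \<partial>lebesgue_on (ball 0 1))" .
  qed
qed

lemma test_function_bounded:
  assumes "test_function U \<eta>" "vs \<in> lists Basis"
  shows "iter_deriv vs \<eta> \<in> borel_measurable borel" "\<exists>B. \<forall>x. \<bar>iter_deriv vs \<eta> x\<bar> \<le> B"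
proof -
  let ?K = "closure {x. \<eta> x \<noteq> 0}"
  have K: "compact ?K" and s: "smooth_on UNIV \<eta>" using assms by (auto simp: test_function_def)
  have c: "continuous_on UNIV (iter_deriv vs \<eta>)" using smooth_on_continuous[OF smooth_on_iter_deriv[OF s assms(2)]] .
  then show "iter_deriv vs \<eta> \<in> borel_measurable borel" by (rule borel_measurable_continuous_onI)
  have zero: "iter_deriv vs \<eta> x = 0" if "x \<notin> ?K" for x
    using that
  proof (induction vs arbitrary: x)
    case Nil
    then show ?case using closure_subset[of "{x. \<eta> x \<noteq> 0}"] by auto
  next
    case (Cons w ws)
    then show ?case
      using dir_deriv_transform(2)[of "- ?K" x "iter_deriv ws \<eta>" "\<lambda>_. 0" w] by (simp add: open_Compl)
  qed
  have "bounded (iter_deriv vs \<eta> ` ?K)"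
    using compact_continuous_image[OF continuous_on_subset[OF c] K] compact_imp_bounded by blast
  then obtain B where "B > 0" "\<And>x. x \<in> ?K \<Longrightarrow> \<bar>iter_deriv vs \<eta> x\<bar> \<le> B" unfolding bounded_pos by auto
  then show "\<exists>B. \<forall>x. \<bar>iter_deriv vs \<eta> x\<bar> \<le> B" using zero by (intro exI[of _ B]) (metis abs_zero less_eq_real_def)
qed

lemma homog_components:
  fixes g :: "'b::euclidean_space \<Rightarrow> 'a::euclidean_space \<Rightarrow> real"
  assumes "\<And>i. i \<in> Basis \<Longrightarrow> homog k (g i)"
  defines "G \<equiv> \<lambda>x. \<Sum>i\<in>Basis. g i x *\<^sub>R i"
  shows "2 * k < DIM('a) \<Longrightarrow> L2_on (ball 0 1) G"
    and "k < DIM('a) \<Longrightarrow> \<xi> \<in> borel_measurable borel \<Longrightarrow> (\<And>x. \<bar>\<xi> x\<bar> \<le> B) \<Longrightarrow> i \<in> Basis \<Longrightarrow>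
      (\<integral>x. \<xi> x *\<^sub>R G x \<partial>lebesgue_on (ball 0 1)) \<bullet> i = (\<integral>x. \<xi> x * g i x \<partial>lebesgue_on (ball 0 1))"
proof -
  have comp: "G x \<bullet> i = g i x" if "i \<in> Basis" for x i using that by (simp add: G_def)
  show "L2_on (ball 0 1) G" if "2 * k < DIM('a)"
    unfolding L2_on_def
  proof
    have "G \<in> borel_measurable borel"
      unfolding G_def using homog_measurable[OF assms(1)] by (intro borel_measurable_sum borel_measurable_scaleR) auto
    then show "G \<in> borel_measurable (lebesgue_on (ball 0 1))"
      by (intro measurable_restrict_space1 measurable_completion) simp
    have "integrable (lebesgue_on (ball 0 1)) (\<lambda>x. \<Sum>i\<in>Basis. 1 * (g i x * g i x))"
      using homog_integrable[OF homog_mult[OF assms(1) assms(1)], of _ _ "\<lambda>_. 1" 1] that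
      by (intro Bochner_Integration.integrable_sum) auto
    moreover have "(norm (G x))\<^sup>2 = (\<Sum>i\<in>Basis. 1 * (g i x * g i x))" for x
      unfolding power2_norm_eq_inner by (subst euclidean_inner) (simp add: comp)
    ultimately show "integrable (lebesgue_on (ball 0 1)) (\<lambda>x. (norm (G x))\<^sup>2)" by simp
  qed
  show "(\<integral>x. \<xi> x *\<^sub>R G x \<partial>lebesgue_on (ball 0 1)) \<bullet> i = (\<integral>x. \<xi> x * g i x \<partial>lebesgue_on (ball 0 1))"
    if "k < DIM('a)" and \<xi>: "\<xi> \<in> borel_measurable borel" "\<And>x. \<bar>\<xi> x\<bar> \<le> B" and "i \<in> Basis"
  proof -
    have "integrable (lebesgue_on (ball 0 1)) (\<lambda>x. \<Sum>i\<in>Basis. (\<xi> x * g i x) *\<^sub>R i)"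
      using homog_integrable[OF assms(1) that(1) \<xi>]
      by (intro Bochner_Integration.integrable_sum integrable_scaleR_left) auto
    then have "integrable (lebesgue_on (ball 0 1)) (\<lambda>x. \<xi> x *\<^sub>R G x)"
      by (simp add: G_def scaleR_sum_right)
    then have "(\<integral>x. \<xi> x *\<^sub>R G x \<partial>lebesgue_on (ball 0 1)) \<bullet> i = (\<integral>x. (\<xi> x *\<^sub>R G x) \<bullet> i \<partial>lebesgue_on (ball 0 1))"
      using \<open>i \<in> Basis\<close> by (intro integral_inner_left[symmetric]) auto
    then show ?thesis using comp[OF \<open>i \<in> Basis\<close>] by simp
  qed
qed

lemma homog_sobolev:
  fixes f :: "'a::euclidean_space \<Rightarrow> 'b::euclidean_space"
  assumes f: "\<And>i. i \<in> Basis \<Longrightarrow> homog 0 (\<lambda>x. f x \<bullet> i)" and m: "2 * m < DIM('a)"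
  shows "sobolev m (ball 0 1) f"
  unfolding sobolev_def
proof (intro conjI ballI impI)
  have repr: "(\<lambda>x. \<Sum>i\<in>Basis. (f x \<bullet> i) *\<^sub>R i) = f" by (simp add: euclidean_representation)
  show "L2_on (ball 0 1) f" using homog_components(1)[of 0 "\<lambda>i x. f x \<bullet> i", OF f] unfolding repr by simp
  fix vs :: "'a list" assume vs: "vs \<in> lists Basis" "length vs \<le> m"
  define P where "P i g \<longleftrightarrow> homog (length vs) g \<and>
     (\<forall>\<eta> K. smooth_on UNIV \<eta> \<longrightarrow> compact K \<longrightarrow> K \<subseteq> ball 0 1 \<longrightarrow> (\<forall>x. x \<notin> K \<longrightarrow> \<eta> x = 0) \<longrightarrow>
        (\<integral>x. iter_deriv vs \<eta> x * (f x \<bullet> i) \<partial>lebesgue_on (ball 0 1)) =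
        (-1) ^ length vs * (\<integral>x. \<eta> x * g x \<partial>lebesgue_on (ball 0 1)))" for i g
  have "\<exists>g. P i g" if "i \<in> Basis" for i
    using homog_weak_deriv[OF f[OF that] vs(1)] vs(2) m by (simp add: P_def)
  then obtain g where P: "\<And>i. i \<in> Basis \<Longrightarrow> P i (g i)" by metis
  have g: "\<And>i. i \<in> Basis \<Longrightarrow> homog (length vs) (g i)"
    and weak: "\<And>i \<eta> K. i \<in> Basis \<Longrightarrow> smooth_on UNIV \<eta> \<Longrightarrow> compact K \<Longrightarrow> K \<subseteq> ball 0 1 \<Longrightarrow> (\<And>x. x \<notin> K \<Longrightarrow> \<eta> x = 0) \<Longrightarrow>
        (\<integral>x. iter_deriv vs \<eta> x * (f x \<bullet> i) \<partial>lebesgue_on (ball 0 1)) =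
        (-1) ^ length vs * (\<integral>x. \<eta> x * g i x \<partial>lebesgue_on (ball 0 1))"
    using P unfolding P_def by blast+
  define G where "G x = (\<Sum>i\<in>Basis. g i x *\<^sub>R i)" for x
  show "\<exists>g. L2_on (ball 0 1) g \<and> is_weak_deriv (ball 0 1) vs f g"
  proof (intro exI[of _ G] conjI)
    show "L2_on (ball 0 1) G" unfolding G_def using vs m by (intro homog_components(1)[OF g]) auto
    show "is_weak_deriv (ball 0 1) vs f G"
      unfolding is_weak_deriv_def
    proof (intro allI impI)
      fix \<eta> :: "'a \<Rightarrow> real" assume \<eta>: "test_function (ball 0 1) \<eta>"
      obtain B where B: "\<And>x. \<bar>\<eta> x\<bar> \<le> B" using test_function_bounded(2)[OF \<eta>, of "[]"] by auto
      obtain C where C: "\<And>x. \<bar>iter_deriv vs \<eta> x\<bar> \<le> C" using test_function_bounded(2)[OF \<eta> vs(1)] by auto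
      show "(\<integral>x. iter_deriv vs \<eta> x *\<^sub>R f x \<partial>lebesgue_on (ball 0 1)) =
        (-1) ^ length vs *\<^sub>R (\<integral>x. \<eta> x *\<^sub>R G x \<partial>lebesgue_on (ball 0 1))"
      proof (rule euclidean_eqI)
        fix i :: 'b assume i: "i \<in> Basis"
        have "(\<integral>x. iter_deriv vs \<eta> x *\<^sub>R f x \<partial>lebesgue_on (ball 0 1)) \<bullet> i =
           (\<integral>x. iter_deriv vs \<eta> x * (f x \<bullet> i) \<partial>lebesgue_on (ball 0 1))"
          using homog_components(2)[of 0 "\<lambda>i x. f x \<bullet> i", OF f _ test_function_bounded(1)[OF \<eta> vs(1)] C i]
          by (simp add: euclidean_representation)
        also have "\<dots> = (-1) ^ length vs * (\<integral>x. \<eta> x * g i x \<partial>lebesgue_on (ball 0 1))"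
          using \<eta> closure_subset[of "{x. \<eta> x \<noteq> 0}"]
          by (intro weak[OF i, of _ "closure {x. \<eta> x \<noteq> 0}"]) (auto simp: test_function_def)
        also have "(\<integral>x. \<eta> x * g i x \<partial>lebesgue_on (ball 0 1)) = (\<integral>x. \<eta> x *\<^sub>R G x \<partial>lebesgue_on (ball 0 1)) \<bullet> i"
          unfolding G_def
          using vs m test_function_bounded(1)[OF \<eta>, of "[]"] B i
          by (intro homog_components(2)[OF g, symmetric]) auto
        finally show "(\<integral>x. iter_deriv vs \<eta> x *\<^sub>R f x \<partial>lebesgue_on (ball 0 1)) \<bullet> i =
          ((-1) ^ length vs *\<^sub>R (\<integral>x. \<eta> x *\<^sub>R G x \<partial>lebesgue_on (ball 0 1))) \<bullet> i" by simp
      qed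
    qed
  qed
qed

section \<open>Geometry of the ellipsoid\<close>

text \<open>Up to the factor \<open>2\<close>, this is the gradient of the quadratic form that defines the ellipsoid,
  so it is a normal vector there.\<close>

definition conormal :: "real \<Rightarrow> 'a::euclidean_space \<times> real \<Rightarrow> 'a \<times> real" where
  "conormal b p = (fst p, snd p / b\<^sup>2)"

lemma bounded_linear_conormal: "bounded_linear (conormal b)"
  unfolding conormal_def[abs_def] divide_inverse
  by (rule bounded_linear_Pair[OF bounded_linear_fst
        bounded_linear_compose[OF bounded_linear_mult_left bounded_linear_snd]])

lemma conormal_add: "conormal b (p + q) = conormal b p + conormal b q"
  by (simp add: conormal_def add_divide_distrib)

lemma conormal_scale: "conormal b (r *\<^sub>R p) = r *\<^sub>R conormal b p"
  by (simp add: conormal_def)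

lemma conormal_sym: "p \<bullet> conormal b q = conormal b p \<bullet> q"
  by (cases p; cases q) (simp add: conormal_def)

lemma conormal_nonneg: "0 \<le> p \<bullet> conormal b p"
  by (cases p) (auto simp: conormal_def power2_eq_square[symmetric] intro!: add_nonneg_nonneg divide_nonneg_nonneg)

lemma ellipsoid_iff: "p \<in> ellipsoid b \<longleftrightarrow> p \<bullet> conormal b p = 1"
  by (cases p) (simp add: ellipsoid_def conormal_def dot_square_norm power2_eq_square)

definition orth_proj :: "'a::euclidean_space \<Rightarrow> 'a \<Rightarrow> 'a" where
  "orth_proj m w = w - ((w \<bullet> m) / (m \<bullet> m)) *\<^sub>R m"

lemma orth_proj_sum: "orth_proj m (\<Sum>i\<in>I. f i) = (\<Sum>i\<in>I. orth_proj m (f i))"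
  unfolding orth_proj_def
  by (simp add: inner_sum_left sum_divide_distrib scaleR_sum_left sum_subtractf)

lemma tangent_space_ellipsoid:
  assumes p: "p \<in> ellipsoid b"
  shows "tangent_space (ellipsoid b) p = {v. conormal b p \<bullet> v = 0}"
proof (intro equalityI subsetI)
  fix v assume "v \<in> tangent_space (ellipsoid b) p"
  then obtain \<gamma> :: "real \<Rightarrow> (real ^ 'a) \<times> real" where \<gamma>: "\<And>t. \<gamma> t \<in> ellipsoid b" "\<gamma> 0 = p"
     "(\<gamma> has_derivative (\<lambda>h. h *\<^sub>R v)) (at 0)"
    unfolding tangent_space_def has_vector_derivative_def by blast
  have 1: "((\<lambda>t. \<gamma> t \<bullet> conormal b (\<gamma> t)) has_derivative
      (\<lambda>h. \<gamma> 0 \<bullet> conormal b (h *\<^sub>R v) + (h *\<^sub>R v) \<bullet> conormal b (\<gamma> 0))) (at 0)"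
    by (intro has_derivative_inner \<gamma>(3) bounded_linear.has_derivative[OF bounded_linear_conormal])
  have 2: "((\<lambda>t. \<gamma> t \<bullet> conormal b (\<gamma> t)) has_derivative (\<lambda>h. 0)) (at 0)"
    using \<gamma>(1) by (simp add: ellipsoid_iff)
  have "\<gamma> 0 \<bullet> conormal b (1 *\<^sub>R v) + (1 *\<^sub>R v) \<bullet> conormal b (\<gamma> 0) = 0"
    using fun_cong[OF has_derivative_unique[OF 1 2], of 1] .
  then show "v \<in> {v. conormal b p \<bullet> v = 0}" using \<gamma>(2) conormal_sym[of p b v] by (simp add: inner_commute)
next
  fix v assume "v \<in> {v. conormal b p \<bullet> v = 0}"
  then have v: "conormal b p \<bullet> v = 0" by simp
  define q where "q = v \<bullet> conormal b v"
  define r where "r s = 1 + s\<^sup>2 * q" for s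
  \<comment> \<open>The line through \<open>p\<close> is projected radially to the ellipsoid; by tangency the correction is
     of second order.\<close>
  define \<gamma> where "\<gamma> s = inverse (sqrt (r s)) *\<^sub>R (p + s *\<^sub>R v)" for s
  have r: "r s > 0" for s using conormal_nonneg[of v b] by (simp add: r_def q_def add_pos_nonneg)
  have "\<gamma> s \<in> ellipsoid b" for s
  proof -
    have "(p + s *\<^sub>R v) \<bullet> conormal b (p + s *\<^sub>R v) = r s"
      using p v conormal_sym[of p b v]
      by (simp add: ellipsoid_iff conormal_add conormal_scale inner_add_left inner_add_right r_def q_def
          power2_eq_square inner_commute)
    moreover have "inverse (sqrt (r s)) * (inverse (sqrt (r s)) * r s) = 1"
      using r[of s] real_sqrt_mult_self[of "r s"] by (simp add: field_simps)
    ultimately show ?thesis by (simp add: ellipsoid_iff \<gamma>_def conormal_scale)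
  qed
  moreover have "\<gamma> 0 = p" by (simp add: \<gamma>_def r_def)
  moreover have "(\<gamma> has_vector_derivative v) (at 0)"
  proof -
    have "((\<lambda>s. inverse (sqrt (r s))) has_real_derivative 0) (at 0)"
      unfolding r_def by (auto intro!: derivative_eq_intros)
    then have "(\<gamma> has_vector_derivative (inverse (sqrt (r 0)) *\<^sub>R v + 0 *\<^sub>R (p + 0 *\<^sub>R v))) (at 0)"
      unfolding \<gamma>_def[abs_def]
      by (intro has_vector_derivative_scaleR) (auto intro!: derivative_eq_intros)
    then show ?thesis by (simp add: r_def)
  qed
  ultimately show "v \<in> tangent_space (ellipsoid b) p" unfolding tangent_space_def by blast
qed

lemma conormal_nonzero: "p \<in> ellipsoid b \<Longrightarrow> conormal b p \<noteq> 0"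
  by (auto simp: ellipsoid_iff)

text \<open>On the hyperplane orthogonal to \<open>m\<close>, the closest point is obtained by subtracting the component
  along \<open>m\<close>; minimality is the Cauchy-Schwarz inequality.\<close>

lemma tangent_proj_ellipsoid:
  assumes p: "p \<in> ellipsoid b"
  shows "tangent_proj (ellipsoid b) p w = orth_proj (conormal b p) w"
proof -
  let ?m = "conormal b p"
  have m: "?m \<noteq> 0" using conormal_nonzero[OF p] .
  have "orth_proj ?m w = closest_point {v. ?m \<bullet> v = 0} w"
  proof (rule closest_point_unique)
    show "convex {v. ?m \<bullet> v = 0}" "closed {v. ?m \<bullet> v = 0}"
      by (rule convex_hyperplane, rule closed_hyperplane)
    show "orth_proj ?m w \<in> {v. ?m \<bullet> v = 0}"
      using m by (simp add: orth_proj_def inner_diff_right inner_commute)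
    show "\<forall>z\<in>{v. ?m \<bullet> v = 0}. dist w (orth_proj ?m w) \<le> dist w z"
    proof
      fix z assume z: "z \<in> {v. ?m \<bullet> v = 0}"
      have "dist w (orth_proj ?m w) * norm ?m = \<bar>w \<bullet> ?m\<bar>"
        using m by (simp add: orth_proj_def dist_norm power2_norm_eq_inner[symmetric] power2_eq_square)
      also have "\<dots> = \<bar>(w - z) \<bullet> ?m\<bar>" using z by (simp add: inner_diff_left inner_commute[of z])
      also have "\<dots> \<le> dist w z * norm ?m" using Cauchy_Schwarz_ineq2 by (simp add: dist_norm)
      finally show "dist w (orth_proj ?m w) \<le> dist w z" using m by simp
    qed
  qed
  then show ?thesis by (simp add: tangent_proj_def tangent_space_ellipsoid[OF p])
qed


section \<open>First variation of the trienergy\<close>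

text \<open>A smooth family of maps \<open>x \<mapsto> F (t, x)\<close> into the ellipsoid, for small \<open>|t|\<close>. All quantities are viewed
  as functions of \<open>(t, x)\<close>, so that \<open>t\<close>- and \<open>x\<close>-derivatives commute.\<close>

locale ellipsoid_variation =
  fixes b :: real and \<epsilon> :: real and U :: "'a::euclidean_space set"
    and F :: "real \<times> 'a \<Rightarrow> (real ^ 'n) \<times> real"
  assumes \<epsilon>: "\<epsilon> > 0" and U: "open U"
    and F: "smooth_on ({-\<epsilon><..<\<epsilon>} \<times> U) F"
    and F_in: "z \<in> {-\<epsilon><..<\<epsilon>} \<times> U \<Longrightarrow> F z \<in> ellipsoid b"
begin

abbreviation \<Omega> where "\<Omega> \<equiv> {-\<epsilon><..<\<epsilon>} \<times> U"

definition M where "M z = conormal b (F z)"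

definition lap where "lap z = (\<Sum>e\<in>Basis. dir_deriv (0, e) (dir_deriv (0, e) F) z)"

text \<open>\<open>\<mu>\<close> is the normal coefficient of the ambient Laplacian, so \<open>W\<close> is the tension field of \<open>F (t, \<cdot>)\<close>, and
  \<open>Q e\<close> is its induced covariant derivative in direction \<open>e\<close>.\<close>

definition \<mu> where "\<mu> z = (lap z \<bullet> M z) * inverse (M z \<bullet> M z)"

definition W where "W z = lap z - \<mu> z *\<^sub>R M z"

definition Q where "Q e z = dir_deriv (0, e) W z - ((dir_deriv (0, e) W z \<bullet> M z) * inverse (M z \<bullet> M z)) *\<^sub>R M z"

lemma \<Omega>: "open \<Omega>" using U by (intro open_Times) auto

lemma basis: "e \<in> Basis \<Longrightarrow> (0 :: real, e) \<in> Basis" "(1 :: real, 0 :: 'a) \<in> Basis"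
  by (simp_all add: Basis_prod_def)

lemma M_nonzero: "z \<in> \<Omega> \<Longrightarrow> M z \<bullet> M z \<noteq> 0"
  using conormal_nonzero[OF F_in] by (simp add: M_def)

lemma smooth_M: "smooth_on \<Omega> M"
  unfolding M_def[abs_def] using smooth_on_linear[OF \<Omega> bounded_linear_conormal F] .

lemma smooth_inv: "smooth_on \<Omega> (\<lambda>z. inverse (M z \<bullet> M z))"
  using \<Omega> smooth_M M_nonzero by (intro smooth_on_inverse smooth_on_inner) auto

lemma smooth_lap: "smooth_on \<Omega> lap"
  unfolding lap_def[abs_def] using \<Omega> F basis by (intro smooth_on_sum smooth_on_dir_deriv) auto

lemma smooth_\<mu>: "smooth_on \<Omega> \<mu>"
  unfolding \<mu>_def[abs_def] using \<Omega> smooth_lap smooth_M smooth_inv by (intro smooth_on_mult smooth_on_inner) auto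

lemma smooth_W: "smooth_on \<Omega> W"
  unfolding W_def[abs_def] using \<Omega> smooth_lap smooth_M smooth_\<mu> by (intro smooth_on_sub smooth_on_scaleR) auto

lemma smooth_Q: "e \<in> Basis \<Longrightarrow> smooth_on \<Omega> (Q e)"
  unfolding Q_def[abs_def] using \<Omega> smooth_W smooth_M smooth_inv basis
  by (intro smooth_on_sub smooth_on_scaleR smooth_on_mult smooth_on_inner smooth_on_dir_deriv) auto

lemma dir_deriv_slice:
  assumes "smooth_on \<Omega> G" "t \<in> {-\<epsilon><..<\<epsilon>}" "x \<in> U"
  shows "dir_deriv e (\<lambda>x. G (t, x)) x = dir_deriv (0, e) G (t, x)"
  using smooth_on_slice(2)[OF assms(1) _ U assms(2,3)] by simp

lemma lap_slice:
  assumes "t \<in> {-\<epsilon><..<\<epsilon>}" "x \<in> U" "e \<in> Basis"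
  shows "dir_deriv e (dir_deriv e (\<lambda>x. F (t, x))) x = dir_deriv (0, e) (dir_deriv (0, e) F) (t, x)"
  using dir_deriv_transform(2)[OF U assms(2), of "dir_deriv e (\<lambda>x. F (t, x))" "\<lambda>x. dir_deriv (0, e) F (t, x)" e]
    dir_deriv_slice[OF F assms(1)] dir_deriv_slice[OF smooth_on_dir_deriv[OF F basis(1)[OF assms(3)]] assms(1,2)] by simp

lemma tension_slice:
  assumes "t \<in> {-\<epsilon><..<\<epsilon>}" "x \<in> U"
  shows "tension (ellipsoid b) (\<lambda>x. F (t, x)) x = W (t, x)"
proof -
  have "tension (ellipsoid b) (\<lambda>x. F (t, x)) x =
      (\<Sum>e\<in>Basis. orth_proj (M (t, x)) (dir_deriv (0, e) (dir_deriv (0, e) F) (t, x)))"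
    using F_in[of "(t, x)"] assms
    by (simp add: tension_def induced_conn_def tangent_proj_ellipsoid M_def lap_slice)
  then show ?thesis
    unfolding orth_proj_sum[symmetric] by (simp add: orth_proj_def W_def \<mu>_def lap_def divide_inverse)
qed

lemma trienergy_slice:
  assumes "t \<in> {-\<epsilon><..<\<epsilon>}" "K \<subseteq> U"
  shows "trienergy (ellipsoid b) K (\<lambda>x. F (t, x)) = (\<integral>x. 1 / 2 * (\<Sum>e\<in>Basis. Q e (t, x) \<bullet> Q e (t, x)) \<partial>lebesgue_on K)"
proof -
  have "induced_conn (ellipsoid b) (\<lambda>x. F (t, x)) e (tension (ellipsoid b) (\<lambda>x. F (t, x))) x = Q e (t, x)"
    if "x \<in> K" for e x
  proof -
    have "x \<in> U" using that assms by blast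
    have "dir_deriv e (tension (ellipsoid b) (\<lambda>x. F (t, x))) x = dir_deriv (0, e) W (t, x)"
      using dir_deriv_transform(2)[OF U \<open>x \<in> U\<close> tension_slice[OF assms(1)]]
        dir_deriv_slice[OF smooth_W assms(1) \<open>x \<in> U\<close>] by simp
    then show ?thesis
      using F_in[of "(t, x)"] assms \<open>x \<in> U\<close>
      by (simp add: induced_conn_def tangent_proj_ellipsoid orth_proj_def Q_def M_def divide_inverse)
  qed
  then show ?thesis
    unfolding trienergy_def
    by (subst integral_mult_right_zero[symmetric], intro Bochner_Integration.integral_cong)
      (auto simp: power2_norm_eq_inner)
qed

lemma trienergy_deriv:
  assumes K: "compact K" "K \<subseteq> U"
  shows "((\<lambda>t. trienergy (ellipsoid b) K (\<lambda>x. F (t, x))) has_real_derivative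
     (\<integral>x. (\<Sum>e\<in>Basis. Q e (0, x) \<bullet> dir_deriv (1, 0) (Q e) (0, x)) \<partial>lebesgue_on K)) (at 0)"
proof -
  define D where "D z = 1 / 2 * (\<Sum>e\<in>Basis. Q e z \<bullet> Q e z)" for z
  have D: "smooth_on \<Omega> D" unfolding D_def[abs_def]
    using \<Omega> smooth_Q by (intro smooth_on_mult smooth_on_sum smooth_on_inner) auto
  have "dir_deriv (1, 0) D (0, x) = (\<Sum>e\<in>Basis. Q e (0, x) \<bullet> dir_deriv (1, 0) (Q e) (0, x))" if "x \<in> K" for x
  proof -
    have "(0, x) \<in> \<Omega>" using that K \<epsilon> by auto
    then have d: "Q e differentiable (at (0, x))" if "e \<in> Basis" for e
      using smooth_on_diff[OF smooth_Q[OF that]] by blast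
    note B = dir_deriv_bilinear[OF bounded_bilinear_inner d d]
    have "dir_deriv (1, 0) D (0, x) = 1 / 2 * dir_deriv (1, 0) (\<lambda>z. \<Sum>e\<in>Basis. Q e z \<bullet> Q e z) (0, x)"
      unfolding D_def[abs_def] using B(1)
      by (intro dir_deriv_linear(2)[OF bounded_linear_mult_right] differentiable_sum) auto
    also have "dir_deriv (1, 0) (\<lambda>z. \<Sum>e\<in>Basis. Q e z \<bullet> Q e z) (0, x) =
        (\<Sum>e\<in>Basis. 2 * (Q e (0, x) \<bullet> dir_deriv (1, 0) (Q e) (0, x)))"
      using B by (subst dir_deriv_sum) (auto intro!: sum.cong simp: inner_commute)
    finally show ?thesis by (simp add: sum_distrib_left[symmetric])
  qed
  then have "(\<integral>x. dir_deriv (1, 0) D (0, x) \<partial>lebesgue_on K) =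
      (\<integral>x. (\<Sum>e\<in>Basis. Q e (0, x) \<bullet> dir_deriv (1, 0) (Q e) (0, x)) \<partial>lebesgue_on K)"
    by (intro Bochner_Integration.integral_cong) auto
  with leibniz_rule_compact[OF \<epsilon> U K D]
  have *: "((\<lambda>t. \<integral>x. D (t, x) \<partial>lebesgue_on K) has_real_derivative
     (\<integral>x. (\<Sum>e\<in>Basis. Q e (0, x) \<bullet> dir_deriv (1, 0) (Q e) (0, x)) \<partial>lebesgue_on K)) (at 0)" by simp
  show ?thesis
    by (rule has_field_derivative_transform_within_open[OF *, of "{-\<epsilon><..<\<epsilon>}"])
      (use \<epsilon> trienergy_slice[OF _ K(2)] in \<open>auto simp: D_def\<close>)
qed

text \<open>\<open>V\<close> is the variation field and \<open>y\<close> the velocity of the tension field, both at time \<open>0\<close>.\<close>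

definition V where "V x = dir_deriv (1, 0) F (0, x)"

definition y where "y x = dir_deriv (1, 0) W (0, x)"

lemma zero_in: "x \<in> U \<Longrightarrow> (0, x) \<in> \<Omega>" using \<epsilon> by auto

lemma smooth_slice: "smooth_on \<Omega> G \<Longrightarrow> smooth_on U (\<lambda>x. G (0, x))"
  using smooth_on_slice(1)[of "{-\<epsilon><..<\<epsilon>}" U G 0] U \<epsilon> by auto

lemma smooth_V: "smooth_on U V" and smooth_y: "smooth_on U y"
  unfolding V_def[abs_def] y_def[abs_def] using F smooth_W basis by (auto intro!: smooth_slice smooth_on_dir_deriv)

lemma V_tangent: "x \<in> U \<Longrightarrow> V x \<bullet> M (0, x) = 0"
proof -
  assume x: "x \<in> U"
  have d: "F differentiable (at (0, x))" using smooth_on_diff[OF F zero_in[OF x]] .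
  have dM: "M differentiable (at (0, x))" "dir_deriv (1, 0) M (0, x) = conormal b (V x)"
    using dir_deriv_linear[OF bounded_linear_conormal d] by (auto simp: M_def[abs_def] V_def)
  have "dir_deriv (1, 0) (\<lambda>z. F z \<bullet> M z) (0, x) = F (0, x) \<bullet> conormal b (V x) + V x \<bullet> M (0, x)"
    using dir_deriv_bilinear(2)[OF bounded_bilinear_inner d dM(1)] dM(2) by (simp add: V_def)
  moreover have "dir_deriv (1, 0) (\<lambda>z. F z \<bullet> M z) (0, x) = dir_deriv (1, 0) (\<lambda>z :: real \<times> 'a. 1) (0, x)"
    using F_in by (intro dir_deriv_transform(2)[OF \<Omega> zero_in[OF x]]) (auto simp: M_def ellipsoid_iff)
  ultimately show ?thesis using conormal_sym[of "F (0, x)" b "V x"] by (simp add: M_def inner_commute)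
qed

text \<open>The \<open>t\<close>-derivative of \<open>\<mu>\<close> enters \<open>y\<close> only along the normal, where it stays the unspecified scalar
  \<open>r\<close>: the normal component of \<open>y\<close> is obtained from the constraint \<open>W \<bullet> M = 0\<close> instead.\<close>

lemma W_dot:
  assumes x: "x \<in> U"
  shows "\<exists>r. y x = (\<Sum>e\<in>Basis. dir_deriv e (dir_deriv e V) x) - r *\<^sub>R M (0, x) - \<mu> (0, x) *\<^sub>R conormal b (V x) \<and>
     M (0, x) \<bullet> y x = \<mu> (0, x) * (M (0, x) \<bullet> conormal b (V x)) - lap (0, x) \<bullet> conormal b (V x)"
proof -
  let ?z = "(0, x)" and ?t = "(1, 0) :: real \<times> 'a"
  note z = zero_in[OF x]
  have d: "F differentiable (at ?z)" "M differentiable (at ?z)" "\<mu> differentiable (at ?z)" "lap differentiable (at ?z)"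
     "W differentiable (at ?z)"
    using F smooth_M smooth_\<mu> smooth_lap smooth_W smooth_on_diff z by blast+
  have dM: "dir_deriv ?t M ?z = conormal b (V x)"
    using dir_deriv_linear(2)[OF bounded_linear_conormal d(1)] by (auto simp: M_def[abs_def] V_def)
  have "dir_deriv ?t (dir_deriv (0, e) (dir_deriv (0, e) F)) ?z = dir_deriv e (dir_deriv e V) x" if e: "e \<in> Basis" for e
  proof -
    note b = basis(1)[OF e] basis(2)
    have "dir_deriv ?t (dir_deriv (0, e) (dir_deriv (0, e) F)) ?z = dir_deriv (0, e) (dir_deriv ?t (dir_deriv (0, e) F)) ?z"
      by (rule dir_deriv_commute[OF \<Omega> smooth_on_dir_deriv[OF F b(1)] b(2,1) z])
    also have "\<dots> = dir_deriv (0, e) (dir_deriv (0, e) (dir_deriv ?t F)) ?z"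
      by (rule dir_deriv_transform(2)[OF \<Omega> z]) (rule dir_deriv_commute[OF \<Omega> F b(2,1)])
    also have "\<dots> = dir_deriv e (\<lambda>x. dir_deriv (0, e) (dir_deriv ?t F) (0, x)) x"
      using \<epsilon> by (intro dir_deriv_slice[symmetric] smooth_on_dir_deriv F b x) auto
    also have "\<dots> = dir_deriv e (dir_deriv e V) x"
      using \<epsilon> dir_deriv_slice[OF smooth_on_dir_deriv[OF F b(2)], of 0]
      by (intro dir_deriv_transform(2)[OF U x]) (auto simp: V_def[abs_def])
    finally show ?thesis .
  qed
  then have dlap: "dir_deriv ?t lap ?z = (\<Sum>e\<in>Basis. dir_deriv e (dir_deriv e V) x)"
    unfolding lap_def[abs_def] using smooth_on_diff[OF smooth_on_dir_deriv[OF smooth_on_dir_deriv[OF F basis(1)] basis(1)] z]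
    by (subst dir_deriv_sum) auto
  define r where "r = dir_deriv ?t \<mu> ?z"
  have "y x = dir_deriv ?t lap ?z - dir_deriv ?t (\<lambda>z. \<mu> z *\<^sub>R M z) ?z"
    unfolding y_def W_def[abs_def] using dir_deriv_bilinear(1)[OF bounded_bilinear_scaleR d(3,2)] d
    by (intro dir_deriv_diff) auto
  also have "dir_deriv ?t (\<lambda>z. \<mu> z *\<^sub>R M z) ?z = \<mu> ?z *\<^sub>R conormal b (V x) + r *\<^sub>R M ?z"
    using dir_deriv_bilinear(2)[OF bounded_bilinear_scaleR d(3,2)] by (simp add: dM r_def)
  finally have 1: "y x = (\<Sum>e\<in>Basis. dir_deriv e (dir_deriv e V) x) - r *\<^sub>R M ?z - \<mu> ?z *\<^sub>R conormal b (V x)"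
    by (simp add: dlap)
  \<comment> \<open>The normal part of \<open>y\<close> comes from differentiating \<open>W \<bullet> M = 0\<close>.\<close>
  have "dir_deriv ?t (\<lambda>z. W z \<bullet> M z) ?z = W ?z \<bullet> conormal b (V x) + y x \<bullet> M ?z"
    using dir_deriv_bilinear(2)[OF bounded_bilinear_inner d(5,2)] by (simp add: dM y_def)
  moreover have "dir_deriv ?t (\<lambda>z. W z \<bullet> M z) ?z = dir_deriv ?t (\<lambda>z. 0) ?z"
  proof (rule dir_deriv_transform(2)[OF \<Omega> z])
    fix z assume "z \<in> \<Omega>"
    then show "W z \<bullet> M z = 0" using M_nonzero[of z] by (simp add: W_def \<mu>_def inner_diff_left)
  qed
  ultimately have "M ?z \<bullet> y x = - (W ?z \<bullet> conormal b (V x))" by (simp add: inner_commute)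
  also have "\<dots> = \<mu> ?z * (M ?z \<bullet> conormal b (V x)) - lap ?z \<bullet> conormal b (V x)"
    by (simp add: W_def inner_diff_left)
  finally show ?thesis using 1 by blast
qed

text \<open>If the ambient derivatives of the tension field \<open>w\<close> at time \<open>0\<close> are already tangential, then the
  derivative of the projection drops out and the first variation is that of the flat Dirichlet
  energy of \<open>W\<close>, hence \<open>- \<integral> \<Delta>w \<bullet> y\<close>.\<close>

lemma trienergy_first_variation:
  assumes K: "compact K" "K \<subseteq> U"
    and supp: "\<And>t x. t \<in> {-\<epsilon><..<\<epsilon>} \<Longrightarrow> x \<in> U - K \<Longrightarrow> F (t, x) = F (0, x)"
    and parallel: "\<And>e x. e \<in> Basis \<Longrightarrow> x \<in> U \<Longrightarrow> dir_deriv (0, e) W (0, x) \<bullet> M (0, x) = 0"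
    and w: "smooth_on U w" "\<And>x. x \<in> U \<Longrightarrow> W (0, x) = w x"
  shows "((\<lambda>t. trienergy (ellipsoid b) K (\<lambda>x. F (t, x))) has_real_derivative
     - (\<integral>x. (\<Sum>e\<in>Basis. dir_deriv e (dir_deriv e w) x) \<bullet> y x \<partial>lebesgue_on K)) (at 0)"
    and "x \<in> U - K \<Longrightarrow> V x = 0"
proof -
  have zero: "dir_deriv (1, 0) G (0, x) = 0"
    if G: "smooth_on \<Omega> G" "\<And>t x. t \<in> {-\<epsilon><..<\<epsilon>} \<Longrightarrow> x \<in> U - K \<Longrightarrow> G (t, x) = G (0, x)" "x \<in> U - K"
    for G :: "real \<times> 'a \<Rightarrow> (real ^ 'n) \<times> real" and x
  proof -
    have "((\<lambda>t. G (t, x)) has_vector_derivative dir_deriv (1, 0) G (0, x)) (at 0)"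
      using slice_real_derivative smooth_on_diff[OF G(1) zero_in] G(3) by blast
    moreover have "((\<lambda>t. G (t, x)) has_vector_derivative 0) (at 0)"
    proof (rule has_vector_derivative_transform_within_open[of "\<lambda>t. G (0, x)" _ _ "{-\<epsilon><..<\<epsilon>}"])
      show "G (0, x) = G (t, x)" if "t \<in> {-\<epsilon><..<\<epsilon>}" for t
        using G(2)[OF that G(3)] by (rule sym)
    qed (use \<epsilon> in auto)
    ultimately show ?thesis using vector_derivative_unique_at by blast
  qed
  show "V x = 0" if "x \<in> U - K" using zero[OF F supp that] by (simp add: V_def)
  have W_supp: "W (t, x) = W (0, x)" if "t \<in> {-\<epsilon><..<\<epsilon>}" "x \<in> U - K" for t x
  proof -
    have "tension (ellipsoid b) (\<lambda>x. F (t, x)) x = tension (ellipsoid b) (\<lambda>x. F (0, x)) x"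
    proof -
      have o: "open (U - K)" using U K compact_imp_closed by auto
      have "dir_deriv e (dir_deriv e (\<lambda>x. F (t, x))) x = dir_deriv e (dir_deriv e (\<lambda>x. F (0, x))) x" for e
        by (rule dir_deriv_transform(2)[OF o that(2)], rule dir_deriv_transform(2)[OF o])
          (assumption, rule supp[OF that(1)])
      then show ?thesis using supp[OF that] by (simp add: tension_def induced_conn_def)
    qed
    then show ?thesis using tension_slice[of t x] tension_slice[of 0 x] that \<epsilon> by auto
  qed
  have "Q e (0, x) \<bullet> dir_deriv (1, 0) (Q e) (0, x) = dir_deriv e w x \<bullet> dir_deriv e y x"
    if e: "e \<in> Basis" and x: "x \<in> U" for e x
  proof -
    let ?z = "(0, x)" and ?A = "dir_deriv (0, e) W"
    define c where "c z = (?A z \<bullet> M z) * inverse (M z \<bullet> M z)" for z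
    note z = zero_in[OF x]
    have dA: "?A ?z = dir_deriv e w x"
      using dir_deriv_slice[OF smooth_W _ x, of 0 e] \<epsilon> dir_deriv_transform(2)[OF U x w(2)] by simp
    have "smooth_on \<Omega> ?A" using smooth_on_dir_deriv[OF smooth_W basis(1)[OF e]] .
    moreover have "smooth_on \<Omega> c"
      unfolding c_def[abs_def] using \<Omega> \<open>smooth_on \<Omega> ?A\<close> smooth_M smooth_inv
      by (intro smooth_on_mult smooth_on_inner)
    ultimately have d: "?A differentiable (at ?z)" "c differentiable (at ?z)" "M differentiable (at ?z)"
      using smooth_M smooth_on_diff z by blast+
    have "c ?z = 0" using parallel[OF e x] by (simp add: c_def)
    have "dir_deriv (1, 0) (Q e) ?z = dir_deriv (1, 0) ?A ?z - dir_deriv (1, 0) (\<lambda>z. c z *\<^sub>R M z) ?z"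
      unfolding Q_def[abs_def] c_def[symmetric]
      using dir_deriv_bilinear(1)[OF bounded_bilinear_scaleR d(2,3)] d by (intro dir_deriv_diff) auto
    also have "dir_deriv (1, 0) (\<lambda>z. c z *\<^sub>R M z) ?z = dir_deriv (1, 0) c ?z *\<^sub>R M ?z"
      using dir_deriv_bilinear(2)[OF bounded_bilinear_scaleR d(2,3)] \<open>c ?z = 0\<close> by simp
    also have "dir_deriv (1, 0) ?A ?z = dir_deriv (0, e) (dir_deriv (1, 0) W) ?z"
      by (rule dir_deriv_commute[OF \<Omega> smooth_W basis(2) basis(1)[OF e] z])
    also have "\<dots> = dir_deriv e y x"
      using dir_deriv_slice[OF smooth_on_dir_deriv[OF smooth_W basis(2)] _ x, of 0 e] \<epsilon> by (simp add: y_def[abs_def])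
    finally have dQ: "dir_deriv (1, 0) (Q e) ?z = dir_deriv e y x - dir_deriv (1, 0) c ?z *\<^sub>R M ?z" .
    have "Q e ?z = dir_deriv e w x" using parallel[OF e x] dA by (simp add: Q_def)
    moreover have "dir_deriv e w x \<bullet> M ?z = 0" using parallel[OF e x] dA by simp
    ultimately show ?thesis unfolding dQ by (simp add: inner_diff_right)
  qed
  then have "(\<integral>x. (\<Sum>e\<in>Basis. Q e (0, x) \<bullet> dir_deriv (1, 0) (Q e) (0, x)) \<partial>lebesgue_on K) =
      (\<integral>x. (\<Sum>e\<in>Basis. dir_deriv e w x \<bullet> dir_deriv e y x) \<partial>lebesgue_on K)"
    using K by (intro Bochner_Integration.integral_cong) auto
  also have "\<dots> = - (\<integral>x. (\<Sum>e\<in>Basis. dir_deriv e (dir_deriv e w) x) \<bullet> y x \<partial>lebesgue_on K)"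
    using zero[OF smooth_W W_supp] by (intro integration_by_parts_laplace[OF U K w(1) smooth_y]) (auto simp: y_def)
  finally show "((\<lambda>t. trienergy (ellipsoid b) K (\<lambda>x. F (t, x))) has_real_derivative
     - (\<integral>x. (\<Sum>e\<in>Basis. dir_deriv e (dir_deriv e w) x) \<bullet> y x \<partial>lebesgue_on K)) (at 0)"
    using trienergy_deriv[OF K] by simp
qed

end

section \<open>Radial fields\<close>

text \<open>All the explicit fields of the problem, the maps \<open>\<phi>\<^sub>a\<close>, their normals and their tension fields, have
  this form.\<close>

definition radial :: "real \<Rightarrow> nat \<Rightarrow> real \<Rightarrow> nat \<Rightarrow> 'a::euclidean_space \<Rightarrow> 'a \<times> real" where
  "radial \<alpha> m \<beta> k x = ((\<alpha> * inverse (norm x) ^ m) *\<^sub>R x, \<beta> * inverse (norm x) ^ k)"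

lemma inverse_norm_power_deriv:
  fixes x :: "'a::euclidean_space"
  assumes "x \<noteq> 0"
  shows "((\<lambda>x. inverse (norm x) ^ k) has_derivative (\<lambda>h. - real k * inverse (norm x) ^ (k + 2) * (x \<bullet> h))) (at x)"
proof (rule has_derivative_eq_rhs[OF has_derivative_power[OF has_derivative_inverse_norm[OF assms]]])
  show "(\<lambda>h. of_nat k * (- (x \<bullet> h) * inverse (norm x) ^ 3) * inverse (norm x) ^ (k - 1)) =
     (\<lambda>h. - real k * inverse (norm x) ^ (k + 2) * (x \<bullet> h))"
    by (cases k) (auto simp: fun_eq_iff power_add power2_eq_square power3_eq_cube algebra_simps)
qed

lemma inverse_norm_power_square:
  fixes x :: "'a::euclidean_space"
  assumes "x \<noteq> 0"
  shows "inverse (norm x) ^ (k + 2) * (x \<bullet> x) = inverse (norm x) ^ k"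
  using assms by (simp add: power_add dot_square_norm power2_eq_square field_simps)

lemma smooth_on_radial: "smooth_on (- {0 :: 'a::euclidean_space}) (radial \<alpha> m \<beta> k)"
  unfolding radial_def[abs_def]
  by (intro smooth_on_Pair smooth_on_scaleR smooth_on_mult smooth_on_id smooth_on_const
      homog_smooth[OF homog_rad_power]) (auto simp: open_Compl)

lemma radial_dir_deriv:
  fixes x :: "'a::euclidean_space"
  assumes "x \<noteq> 0"
  shows "dir_deriv h (radial \<alpha> m \<beta> k) x =
    ((\<alpha> * inverse (norm x) ^ m) *\<^sub>R h - (\<alpha> * real m * inverse (norm x) ^ (m + 2) * (x \<bullet> h)) *\<^sub>R x,
     - (\<beta> * real k * inverse (norm x) ^ (k + 2) * (x \<bullet> h)))"
proof -
  note P = inverse_norm_power_deriv[OF assms]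
  have "(radial \<alpha> m \<beta> k has_derivative (\<lambda>h.
      ((\<alpha> * inverse (norm x) ^ m) *\<^sub>R h + (\<alpha> * (- real m * inverse (norm x) ^ (m + 2) * (x \<bullet> h))) *\<^sub>R x,
       \<beta> * (- real k * inverse (norm x) ^ (k + 2) * (x \<bullet> h))))) (at x)"
    unfolding radial_def[abs_def]
    by (intro has_derivative_Pair has_derivative_scaleR has_derivative_mult_right P has_derivative_ident)
  from dir_deriv_eq[OF this, of h] show ?thesis by (simp add: mult_ac)
qed

lemma radial_dir_deriv2:
  fixes x :: "'a::euclidean_space"
  assumes x: "x \<noteq> 0" and e: "e \<in> Basis"
  shows "dir_deriv e (dir_deriv e (radial \<alpha> m \<beta> k)) x =
    ((\<alpha> * real m * (real m + 2) * inverse (norm x) ^ (m + 4) * (x \<bullet> e)\<^sup>2 - \<alpha> * real m * inverse (norm x) ^ (m + 2)) *\<^sub>R x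
       - 2 *\<^sub>R ((\<alpha> * real m * inverse (norm x) ^ (m + 2)) *\<^sub>R ((x \<bullet> e) *\<^sub>R e)),
     \<beta> * real k * (real k + 2) * inverse (norm x) ^ (k + 4) * (x \<bullet> e)\<^sup>2 - \<beta> * real k * inverse (norm x) ^ (k + 2))"
proof -
  define f where "f y = ((\<alpha> * inverse (norm y) ^ m) *\<^sub>R e - (\<alpha> * real m * (inverse (norm y) ^ (m + 2) * (y \<bullet> e))) *\<^sub>R y,
     - (\<beta> * real k * (inverse (norm y) ^ (k + 2) * (y \<bullet> e))))" for y :: 'a
  note P = inverse_norm_power_deriv[OF x]
  have "dir_deriv e (dir_deriv e (radial \<alpha> m \<beta> k)) x = dir_deriv e f x"
    by (rule dir_deriv_transform(2)[of "- {0}"]) (use x in \<open>auto simp: radial_dir_deriv f_def mult_ac open_Compl\<close>)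
  also have "\<dots> = ((\<alpha> * (- real m * inverse (norm x) ^ (m + 2) * (x \<bullet> e))) *\<^sub>R e -
      ((\<alpha> * real m * (inverse (norm x) ^ (m + 2) * (x \<bullet> e))) *\<^sub>R e +
       (\<alpha> * real m * (inverse (norm x) ^ (m + 2) * (e \<bullet> e) + - real (m + 2) * inverse (norm x) ^ (m + 2 + 2) * (x \<bullet> e) * (x \<bullet> e))) *\<^sub>R x),
      - (\<beta> * real k * (inverse (norm x) ^ (k + 2) * (e \<bullet> e) + - real (k + 2) * inverse (norm x) ^ (k + 2 + 2) * (x \<bullet> e) * (x \<bullet> e))))"
    unfolding f_def[abs_def]
    by (rule dir_deriv_eq, intro has_derivative_Pair has_derivative_diff has_derivative_minus
        has_derivative_scaleR has_derivative_scaleR_left has_derivative_mult has_derivative_mult_right P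
        has_derivative_inner_left has_derivative_ident)
  also have "e \<bullet> e = 1" using e by (simp add: inner_Basis)
  also have "m + 2 + 2 = m + 4" by simp
  also have "k + 2 + 2 = k + 4" by simp
  finally have eq: "dir_deriv e (dir_deriv e (radial \<alpha> m \<beta> k)) x =
      ((\<alpha> * (- real m * inverse (norm x) ^ (m + 2) * (x \<bullet> e))) *\<^sub>R e -
      ((\<alpha> * real m * (inverse (norm x) ^ (m + 2) * (x \<bullet> e))) *\<^sub>R e +
       (\<alpha> * real m * (inverse (norm x) ^ (m + 2) * 1 + - real (m + 2) * inverse (norm x) ^ (m + 4) * (x \<bullet> e) * (x \<bullet> e))) *\<^sub>R x),
      - (\<beta> * real k * (inverse (norm x) ^ (k + 2) * 1 + - real (k + 2) * inverse (norm x) ^ (k + 4) * (x \<bullet> e) * (x \<bullet> e))))" .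
  have vec: "(\<alpha> * (- real m * A * t)) *\<^sub>R e - ((\<alpha> * real m * (A * t)) *\<^sub>R e +
       (\<alpha> * real m * (A * 1 + - real (m + 2) * B * t * t)) *\<^sub>R x) =
     (\<alpha> * real m * (real m + 2) * B * t\<^sup>2 - \<alpha> * real m * A) *\<^sub>R x - 2 *\<^sub>R ((\<alpha> * real m * A) *\<^sub>R (t *\<^sub>R e))"
    for A B t
    by (rule euclidean_eqI) (simp add: inner_diff_left inner_add_left power2_eq_square algebra_simps)
  have scal: "- (\<beta> * real k * (A * 1 + - real (k + 2) * B * t * t)) =
     \<beta> * real k * (real k + 2) * B * t\<^sup>2 - \<beta> * real k * A" for A B t
    by (simp add: power2_eq_square algebra_simps)
  show ?thesis unfolding eq vec scal ..
qed

text \<open>The Laplacian maps \<open>|x|\<^sup>-\<^sup>k\<close> to \<open>k (k + 2 - n) |x|\<^sup>-\<^sup>k\<^sup>-\<^sup>2\<close> and \<open>|x|\<^sup>-\<^sup>m x\<close> to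
  \<open>m (m - n) |x|\<^sup>-\<^sup>m\<^sup>-\<^sup>2 x\<close>, so radial fields are preserved.\<close>

lemma radial_laplace:
  fixes x :: "'a::euclidean_space"
  assumes "x \<noteq> 0"
  shows "(\<Sum>e\<in>Basis. dir_deriv e (dir_deriv e (radial \<alpha> m \<beta> k)) x) =
    radial (\<alpha> * real m * (real m - real DIM('a))) (m + 2) (\<beta> * real k * (real k + 2 - real DIM('a))) (k + 2) x"
proof -
  let ?\<rho> = "inverse (norm x)" and ?n = "real DIM('a)"
  have sq: "(\<Sum>e\<in>Basis. (x \<bullet> e)\<^sup>2) = x \<bullet> x" by (subst euclidean_inner) (simp add: power2_eq_square)
  have 4: "?\<rho> ^ (j + 4) * (x \<bullet> x) = ?\<rho> ^ (j + 2)" for j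
  proof -
    have "j + 4 = (j + 2) + 2" by simp
    then show ?thesis by (simp only: inverse_norm_power_square[OF assms])
  qed
  have "(\<Sum>e\<in>Basis. \<alpha> * real m * (real m + 2) * ?\<rho> ^ (m + 4) * (x \<bullet> e)\<^sup>2 - \<alpha> * real m * ?\<rho> ^ (m + 2)) =
     \<alpha> * real m * (real m + 2) * (?\<rho> ^ (m + 4) * (x \<bullet> x)) - ?n * (\<alpha> * real m * ?\<rho> ^ (m + 2))"
    by (simp add: sum_subtractf sum_distrib_left[symmetric] sq mult.assoc)
  then have 1: "(\<Sum>e\<in>Basis. \<alpha> * real m * (real m + 2) * ?\<rho> ^ (m + 4) * (x \<bullet> e)\<^sup>2 - \<alpha> * real m * ?\<rho> ^ (m + 2)) =
     \<alpha> * real m * (real m + 2 - ?n) * ?\<rho> ^ (m + 2)" unfolding 4 by (simp add: algebra_simps)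
  have "(\<Sum>e\<in>Basis. \<beta> * real k * (real k + 2) * ?\<rho> ^ (k + 4) * (x \<bullet> e)\<^sup>2 - \<beta> * real k * ?\<rho> ^ (k + 2)) =
     \<beta> * real k * (real k + 2) * (?\<rho> ^ (k + 4) * (x \<bullet> x)) - ?n * (\<beta> * real k * ?\<rho> ^ (k + 2))"
    by (simp add: sum_subtractf sum_distrib_left[symmetric] sq mult.assoc)
  then have 2: "(\<Sum>e\<in>Basis. \<beta> * real k * (real k + 2) * ?\<rho> ^ (k + 4) * (x \<bullet> e)\<^sup>2 - \<beta> * real k * ?\<rho> ^ (k + 2)) =
     \<beta> * real k * (real k + 2 - ?n) * ?\<rho> ^ (k + 2)" unfolding 4 by (simp add: algebra_simps)
  show ?thesis
  proof -
    let ?K = "\<alpha> * real m * ?\<rho> ^ (m + 2)"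
    have "(\<Sum>e\<in>Basis. dir_deriv e (dir_deriv e (radial \<alpha> m \<beta> k)) x) =
       ((\<Sum>e\<in>Basis. \<alpha> * real m * (real m + 2) * ?\<rho> ^ (m + 4) * (x \<bullet> e)\<^sup>2 - ?K) *\<^sub>R x
          - 2 *\<^sub>R (?K *\<^sub>R (\<Sum>e\<in>Basis. (x \<bullet> e) *\<^sub>R e)),
        \<Sum>e\<in>Basis. \<beta> * real k * (real k + 2) * ?\<rho> ^ (k + 4) * (x \<bullet> e)\<^sup>2 - \<beta> * real k * ?\<rho> ^ (k + 2))"
      unfolding scaleR_sum_left scaleR_sum_right sum_subtractf[symmetric] sum_prod[symmetric]
      by (intro sum.cong refl) (simp only: radial_dir_deriv2[OF assms])
    also have "\<dots> = ((\<alpha> * real m * (real m + 2 - ?n) * ?\<rho> ^ (m + 2)) *\<^sub>R x - 2 *\<^sub>R (?K *\<^sub>R x),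
        \<beta> * real k * (real k + 2 - ?n) * ?\<rho> ^ (k + 2))"
      unfolding 1 2 euclidean_representation ..
    also have "(\<alpha> * real m * (real m + 2 - ?n) * ?\<rho> ^ (m + 2)) *\<^sub>R x - 2 *\<^sub>R (?K *\<^sub>R x) =
        (\<alpha> * real m * (real m - ?n) * ?\<rho> ^ (m + 2)) *\<^sub>R x"
      by (rule euclidean_eqI) (simp only: inner_diff_left inner_scaleR_left, simp add: algebra_simps)
    finally show ?thesis unfolding radial_def .
  qed
qed

lemma radial_inner: "radial \<alpha> m \<beta> k x \<bullet> p = \<alpha> * inverse (norm x) ^ m * (x \<bullet> fst p) + \<beta> * inverse (norm x) ^ k * snd p"
  by (cases p) (simp add: radial_def)


section \<open>First variation at the maps \<open>\<phi>\<^sub>a\<close>\<close>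

lemma phi_eq_radial: "phi b a = radial (sin a) 1 (b * cos a) 0"
  by (auto simp: phi_def radial_def fun_eq_iff)

lemma conormal_phi: "b > 0 \<Longrightarrow> conormal b (phi b a x) = radial (sin a) 1 (cos a / b) 0 x"
  by (simp add: phi_eq_radial radial_def conormal_def power2_eq_square)

lemma phi_in_ellipsoid:
  assumes "b > 0" "x \<noteq> 0"
  shows "phi b a x \<in> ellipsoid b"
proof -
  have "phi b a x \<bullet> conormal b (phi b a x) = (sin a)\<^sup>2 * (inverse (norm x) ^ (0 + 2) * (x \<bullet> x)) + (cos a)\<^sup>2"
    unfolding conormal_phi[OF assms(1)] unfolding phi_eq_radial radial_inner
    using assms by (simp add: radial_def power2_eq_square)
  then show ?thesis
    unfolding inverse_norm_power_square[OF assms(2)] by (simp add: ellipsoid_iff)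
qed

lemma smooth_on_phi: "0 \<notin> U \<Longrightarrow> smooth_on U (phi b a)"
  unfolding phi_eq_radial by (rule smooth_on_subset[OF smooth_on_radial]) auto

text \<open>The polynomial whose zeros \<open>S = sin\<^sup>2 a\<close> give the triharmonic \<open>\<phi>\<^sub>a\<close>; here \<open>\<beta> = b\<^sup>2\<close> and
  \<open>1 - S + \<beta> S\<close> is the squared length of the meridian direction \<open>(cos a, - b sin a)\<close>.\<close>

definition el_poly :: "real \<Rightarrow> real \<Rightarrow> real \<Rightarrow> real" where
  "el_poly n \<beta> S =
     (2 * (n - 4) * (1 - S + \<beta> * S) + (n - 1) * (1 - S)) *
     (4 * (n - 6) * (1 - S + \<beta> * S)\<^sup>2 + (n - 1) * ((1 - S) * (1 - S + \<beta> * S) - \<beta> * S))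
     - (n - 1)\<^sup>2 * \<beta> * S * (1 - S)"

text \<open>Variations of \<open>\<phi>\<^sub>a\<close>, with \<open>n\<close> for the dimension of the domain.\<close>

locale phi_variation = ellipsoid_variation b \<epsilon> U F
  for b \<epsilon> and U :: "(real ^ 'n) set" and F :: "real \<times> (real ^ 'n) \<Rightarrow> (real ^ 'n) \<times> real" +
  fixes a n :: real
  assumes n: "n = real CARD('n)" and b: "b > 0" and a: "0 < a" "a < pi / 2" and U0: "0 \<notin> U"
    and F0: "x \<in> U \<Longrightarrow> F (0, x) = phi b a x"
begin

abbreviation (input) s where "s \<equiv> sin a"
abbreviation (input) c where "c \<equiv> cos a"

text \<open>With the meridian direction \<open>t = (cos a \<cdot> x/|x|, - b sin a)\<close> of squared length \<open>H\<close>, the tension field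
  of \<open>\<phi>\<^sub>a\<close> is \<open>w = g |x|\<^sup>-\<^sup>2 t\<close>, and \<open>\<Psi> = |x|\<^sup>-\<^sup>4 t\<close>. The numbers \<open>\<zeta>\<close> and \<open>\<omega>\<close> are the coefficients in
  \<open>\<Delta>w = - g (\<zeta> \<Psi> + \<omega> |x|\<^sup>-\<^sup>4 M)\<close>.\<close>

definition H where "H = c\<^sup>2 + b\<^sup>2 * s\<^sup>2"
definition g where "g = - (n - 1) * s * c / H"
definition w where "w = radial (g * c) 3 (- g * b * s) 2"
definition \<zeta> where "\<zeta> = 2 * (n - 4) + (n - 1) * c\<^sup>2 / H"
definition \<omega> where "\<omega> = (n - 1) * c * s * b\<^sup>2 / H"
definition \<Psi> where "\<Psi> = radial c 5 (- b * s) 4"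

lemma sc: "s > 0" "c > 0" using a by (auto intro: sin_gt_zero cos_gt_zero)

lemma H_pos: "H > 0" unfolding H_def using sc b by (intro add_pos_pos mult_pos_pos) auto

lemma cs: "c\<^sup>2 = 1 - s\<^sup>2" using sin_cos_squared_add[of a] by linarith

lemma nonzero: "x \<in> U \<Longrightarrow> x \<noteq> 0" using U0 by blast

lemma M0: "x \<in> U \<Longrightarrow> M (0, x) = radial s 1 (c / b) 0 x"
  using b by (simp add: M_def F0 conormal_phi)

lemma rho2: "x \<in> U \<Longrightarrow> inverse (norm x) * inverse (norm x) * (x \<bullet> x) = 1"
  using inverse_norm_power_square[of x 0] nonzero by (simp add: power2_eq_square)

lemma M0_norm: "x \<in> U \<Longrightarrow> M (0, x) \<bullet> M (0, x) = H / b\<^sup>2"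
  using rho2[of x] b
  by (simp add: M0 radial_inner) (simp add: radial_def H_def field_simps power2_eq_square)

lemma lap0:
  assumes x: "x \<in> U"
  shows "lap (0, x) = radial (s * (1 - n)) 3 0 2 x"
proof -
  have "lap (0, x) = (\<Sum>e\<in>Basis. dir_deriv e (dir_deriv e (phi b a)) x)"
    unfolding lap_def
  proof (intro sum.cong refl)
    fix e :: "real ^ 'n" assume e: "e \<in> Basis"
    have "dir_deriv (0, e) (dir_deriv (0, e) F) (0, x) = dir_deriv e (dir_deriv e (\<lambda>x. F (0, x))) x"
      using \<epsilon> by (intro lap_slice[symmetric] x e) auto
    also have "\<dots> = dir_deriv e (dir_deriv e (phi b a)) x"
      by (rule dir_deriv_transform(2)[OF U x], rule dir_deriv_transform(2)[OF U]) (auto simp: F0)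
    finally show "dir_deriv (0, e) (dir_deriv (0, e) F) (0, x) = dir_deriv e (dir_deriv e (phi b a)) x" .
  qed
  then show ?thesis
    by (simp add: phi_eq_radial radial_laplace[OF nonzero[OF x]] n) (simp add: radial_def power3_eq_cube)
qed

lemma \<mu>0:
  assumes x: "x \<in> U"
  shows "\<mu> (0, x) = - ((n - 1) * s\<^sup>2 * b\<^sup>2 / H) * inverse (norm x) ^ 2"
proof -
  have "lap (0, x) \<bullet> M (0, x) = - (n - 1) * s\<^sup>2 * inverse (norm x) ^ 2 * (inverse (norm x) * inverse (norm x) * (x \<bullet> x))"
    by (simp add: lap0[OF x] M0[OF x] radial_inner)
      (simp add: radial_def power2_eq_square power3_eq_cube algebra_simps)
  then have lapM: "lap (0, x) \<bullet> M (0, x) = - (n - 1) * s\<^sup>2 * inverse (norm x) ^ 2"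
    by (simp only: rho2[OF x] mult_1_right)
  show ?thesis using H_pos b unfolding \<mu>_def lapM M0_norm[OF x]
    by (simp add: divide_inverse algebra_simps)
qed

lemma W0:
  assumes x: "x \<in> U"
  shows "W (0, x) = w x"
proof -
  have 1: "s * (1 - n) + (n - 1) * s\<^sup>2 * b\<^sup>2 / H * s = g * c"
    using H_pos by (simp add: g_def field_simps) (simp add: H_def power2_eq_square algebra_simps)
  have 2: "(n - 1) * s\<^sup>2 * b\<^sup>2 / H * (c / b) = - g * b * s"
    using H_pos b by (simp add: g_def field_simps power2_eq_square)
  have "radial A 3 0 2 x - (- k * inverse (norm x) ^ 2) *\<^sub>R radial B 1 C 0 x = radial (A + k * B) 3 (k * C) 2 x"
    for A B C k :: real
    by (simp add: radial_def power2_eq_square power3_eq_cube algebra_simps)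
  from this[of "s * (1 - n)" "(n - 1) * s\<^sup>2 * b\<^sup>2 / H" s "c / b"]
  have "W (0, x) = radial (s * (1 - n) + (n - 1) * s\<^sup>2 * b\<^sup>2 / H * s) 3 ((n - 1) * s\<^sup>2 * b\<^sup>2 / H * (c / b)) 2 x"
    unfolding W_def lap0[OF x] \<mu>0[OF x] M0[OF x] .
  then show ?thesis unfolding 1 2 w_def .
qed

lemma smooth_w: "smooth_on U w"
  unfolding w_def using U0 by (intro smooth_on_subset[OF smooth_on_radial]) auto

text \<open>The radial derivative of \<open>w\<close> is a multiple of \<open>t\<close>, and its derivatives along the spheres are
  multiples of directions tangent to the parallels of the ellipsoid.\<close>

lemma w_parallel:
  assumes e: "e \<in> Basis" and x: "x \<in> U"
  shows "dir_deriv (0, e) W (0, x) \<bullet> M (0, x) = 0"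
proof -
  have "dir_deriv (0, e) W (0, x) = dir_deriv e w x"
    using dir_deriv_slice[OF smooth_W _ x, of 0 e] \<epsilon> dir_deriv_transform(2)[OF U x W0] by simp
  also have "\<dots> \<bullet> M (0, x) =
     (3 * g * c * s) * (inverse (norm x) ^ 4 * (x \<bullet> e)) * (1 - inverse (norm x) * inverse (norm x) * (x \<bullet> x))"
    using b unfolding w_def M0[OF x]
    by (simp add: radial_dir_deriv[OF nonzero[OF x]])
      (simp add: radial_def numeral_eq_Suc inner_commute inner_diff_left algebra_simps)
  finally show ?thesis by (simp add: rho2[OF x])
qed

text \<open>Tangency determines the second component of \<open>V\<close> by the radial part of the first one. So every pairing
  of \<open>V\<close> with a radial field is a multiple of \<open>x \<bullet> fst (V x)\<close>, and the first variation is governed by a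
  single coefficient.\<close>

lemma V_snd:
  assumes x: "x \<in> U"
  shows "snd (V x) = - (b * s / c) * (inverse (norm x) * (x \<bullet> fst (V x)))"
proof -
  have "s * (inverse (norm x) * (x \<bullet> fst (V x))) + c / b * snd (V x) = 0"
    using V_tangent[OF x] by (simp add: M0[OF x] inner_commute[of "V x"] radial_inner)
  then have "c / b * snd (V x) = - (s * (inverse (norm x) * (x \<bullet> fst (V x))))" by linarith
  then have "b / c * (c / b * snd (V x)) = b / c * - (s * (inverse (norm x) * (x \<bullet> fst (V x))))" by (rule arg_cong)
  then show ?thesis using b sc by simp
qed

text \<open>\<open>\<Delta>w\<close> is decomposed into a multiple of the tangential field \<open>\<Psi>\<close> and of the normal \<open>M\<close>,
  because the two components of \<open>y\<close> have different sources.\<close>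

lemma laplace_w_inner_y:
  assumes x: "x \<in> U"
  shows "- ((\<Sum>e\<in>Basis. dir_deriv e (dir_deriv e w) x) \<bullet> y x) =
     g * \<zeta> * (\<Psi> x \<bullet> (\<Sum>e\<in>Basis. dir_deriv e (dir_deriv e V) x)) +
     g * (\<zeta> * (n - 1) * s\<^sup>2 * b\<^sup>2 / (H * c) + \<omega> * (n - 1) * s / H) * (inverse (norm x) ^ 7 * (x \<bullet> fst (V x)))"
proof -
  let ?\<rho> = "inverse (norm x)"
  define v where "v = ?\<rho> * (x \<bullet> fst (V x))"
  define D where "D = (\<Sum>e\<in>Basis. dir_deriv e (dir_deriv e V) x)"
  obtain r where y: "y x = D - r *\<^sub>R M (0, x) - \<mu> (0, x) *\<^sub>R conormal b (V x)"
    and My: "M (0, x) \<bullet> y x = \<mu> (0, x) * (M (0, x) \<bullet> conormal b (V x)) - lap (0, x) \<bullet> conormal b (V x)"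
    using W_dot[OF x] unfolding D_def by blast
  have V2: "snd (V x) = - (b * s / c) * v" using V_snd[OF x] by (simp add: v_def)
  have "\<zeta> * c + \<omega> * s = 3 * (n - 3) * c"
  proof -
    have "(n - 1) * c\<^sup>2 / H * c + (n - 1) * c * s * b\<^sup>2 / H * s = (n - 1) * c * (c\<^sup>2 + b\<^sup>2 * s\<^sup>2) / H"
      using H_pos by (simp add: field_simps power2_eq_square)
    also have "\<dots> = (n - 1) * c" unfolding H_def[symmetric] using H_pos by simp
    finally have "\<zeta> * c + \<omega> * s = 2 * (n - 4) * c + (n - 1) * c"
      by (simp add: \<zeta>_def \<omega>_def distrib_right)
    then show ?thesis by (simp add: algebra_simps)
  qed
  moreover have "- \<zeta> * b * s + \<omega> * (c / b) = - 2 * (n - 4) * b * s"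
    using H_pos b by (simp add: \<zeta>_def \<omega>_def field_simps power2_eq_square)
  ultimately have coeff: "\<zeta> * c + \<omega> * s = 3 * (n - 3) * c" "- \<zeta> * b * s + \<omega> * (c / b) = - 2 * (n - 4) * b * s"
    by blast+
  have "(\<Sum>e\<in>Basis. dir_deriv e (dir_deriv e w) x) =
      radial (- g * (3 * (n - 3) * c)) 5 (- g * (- 2 * (n - 4) * b * s)) 4 x"
    unfolding w_def by (simp add: radial_laplace[OF nonzero[OF x]] n algebra_simps)
  also have "\<dots> = (- g) *\<^sub>R (\<zeta> *\<^sub>R \<Psi> x + (\<omega> * ?\<rho> ^ 4) *\<^sub>R M (0, x))"
    unfolding coeff[symmetric] M0[OF x] \<Psi>_def by (simp add: radial_def numeral_eq_Suc algebra_simps)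
  finally have lapw: "(\<Sum>e\<in>Basis. dir_deriv e (dir_deriv e w) x) = (- g) *\<^sub>R (\<zeta> *\<^sub>R \<Psi> x + (\<omega> * ?\<rho> ^ 4) *\<^sub>R M (0, x))" .
  have "\<Psi> x \<bullet> M (0, x) = c * s * ?\<rho> ^ 4 * (?\<rho> * ?\<rho> * (x \<bullet> x)) - c * s * ?\<rho> ^ 4"
    unfolding M0[OF x] \<Psi>_def radial_inner using b by (simp add: radial_def numeral_eq_Suc algebra_simps)
  then have PM: "\<Psi> x \<bullet> M (0, x) = 0" by (simp add: rho2[OF x])
  have fst_v: "?\<rho> * (x \<bullet> fst (V x)) = v" by (simp add: v_def)
  have "\<Psi> x \<bullet> conormal b (V x) = ?\<rho> ^ 4 * (c * (?\<rho> * (x \<bullet> fst (V x))) - s * (snd (V x) / b))"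
    unfolding \<Psi>_def radial_inner using b by (simp add: conormal_def numeral_eq_Suc algebra_simps)
  also have "c * (?\<rho> * (x \<bullet> fst (V x))) - s * (snd (V x) / b) = v / c"
  proof -
    have "v * (c * c) + v * (s * s) = v" using cs by (simp add: distrib_left[symmetric] power2_eq_square)
    then show ?thesis unfolding fst_v V2 using b sc by (simp add: field_simps)
  qed
  finally have PV: "\<Psi> x \<bullet> conormal b (V x) = ?\<rho> ^ 4 * (v / c)" .
  have "M (0, x) \<bullet> conormal b (V x) = s * (?\<rho> * (x \<bullet> fst (V x))) + c / b * (snd (V x) / b\<^sup>2)"
    unfolding M0[OF x] radial_inner by (simp add: conormal_def)
  also have "\<dots> = s * v * (1 - 1 / b\<^sup>2)"
    unfolding fst_v V2 using b sc by (simp add: field_simps)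
  finally have MV: "M (0, x) \<bullet> conormal b (V x) = s * v * (1 - 1 / b\<^sup>2)" .
  have "lap (0, x) \<bullet> conormal b (V x) = - (n - 1) * s * ?\<rho>\<^sup>2 * (?\<rho> * (x \<bullet> fst (V x)))"
    unfolding lap0[OF x] radial_inner by (simp add: conormal_def numeral_eq_Suc algebra_simps)
  then have LV: "lap (0, x) \<bullet> conormal b (V x) = - (n - 1) * s * ?\<rho>\<^sup>2 * v" unfolding fst_v .
  have "\<Psi> x \<bullet> y x = \<Psi> x \<bullet> D + (n - 1) * s\<^sup>2 * b\<^sup>2 / (H * c) * (?\<rho> ^ 6 * v)"
    unfolding y inner_diff_right inner_scaleR_right PM PV \<mu>0[OF x]
    using H_pos sc by (simp add: numeral_eq_Suc field_simps)
  moreover have "?\<rho> ^ 4 * (M (0, x) \<bullet> y x) = (n - 1) * s / H * (?\<rho> ^ 6 * v)"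
  proof -
    have "M (0, x) \<bullet> y x = (n - 1) * s * ?\<rho>\<^sup>2 * v * (1 - s\<^sup>2 * b\<^sup>2 / H * (1 - 1 / b\<^sup>2))"
      unfolding My MV LV \<mu>0[OF x] by (simp add: algebra_simps power2_eq_square)
    also have "1 - s\<^sup>2 * b\<^sup>2 / H * (1 - 1 / b\<^sup>2) = (H - (s\<^sup>2 * b\<^sup>2 - s\<^sup>2)) / H"
      using H_pos b by (simp add: field_simps)
    also have "H - (s\<^sup>2 * b\<^sup>2 - s\<^sup>2) = 1" by (simp add: H_def cs)
    finally show ?thesis by (simp add: numeral_eq_Suc)
  qed
  moreover have "- ((\<Sum>e\<in>Basis. dir_deriv e (dir_deriv e w) x) \<bullet> y x) =
      g * \<zeta> * (\<Psi> x \<bullet> y x) + g * \<omega> * (?\<rho> ^ 4 * (M (0, x) \<bullet> y x))"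
    unfolding lapw by (simp add: inner_add_left algebra_simps)
  moreover have "?\<rho> ^ 7 * (x \<bullet> fst (V x)) = ?\<rho> ^ 6 * v" by (simp add: v_def numeral_eq_Suc)
  ultimately show ?thesis unfolding D_def by (simp add: algebra_simps)
qed

lemma laplace_\<Psi>_inner_V:
  assumes x: "x \<in> U"
  shows "(\<Sum>e\<in>Basis. dir_deriv e (dir_deriv e \<Psi>) x) \<bullet> V x =
    - ((4 * (n - 6) * H + (n - 1) * c\<^sup>2) / c) * (inverse (norm x) ^ 7 * (x \<bullet> fst (V x)))"
proof -
  let ?\<rho> = "inverse (norm x)"
  define v where "v = ?\<rho> * (x \<bullet> fst (V x))"
  have V2: "snd (V x) = - (b * s / c) * v" using V_snd[OF x] by (simp add: v_def)
  have "(\<Sum>e\<in>Basis. dir_deriv e (dir_deriv e \<Psi>) x) = radial (c * 5 * (5 - n)) 7 (- b * s * 4 * (6 - n)) 6 x"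
    unfolding \<Psi>_def by (simp add: radial_laplace[OF nonzero[OF x]] n)
  then have "(\<Sum>e\<in>Basis. dir_deriv e (dir_deriv e \<Psi>) x) \<bullet> V x =
      ?\<rho> ^ 6 * (c * 5 * (5 - n) * v - b * s * 4 * (6 - n) * snd (V x))"
    by (simp add: radial_inner v_def numeral_eq_Suc algebra_simps)
  also have "c * 5 * (5 - n) * v - b * s * 4 * (6 - n) * snd (V x) = - ((4 * (n - 6) * H + (n - 1) * c\<^sup>2) / c) * v"
    unfolding V2 using sc by (simp add: field_simps) (simp add: H_def algebra_simps power2_eq_square)
  also have "?\<rho> ^ 6 * (- ((4 * (n - 6) * H + (n - 1) * c\<^sup>2) / c) * v) =
     - ((4 * (n - 6) * H + (n - 1) * c\<^sup>2) / c) * (?\<rho> ^ 7 * (x \<bullet> fst (V x)))"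
    by (simp add: v_def numeral_eq_Suc)
  finally show ?thesis .
qed

definition coefficient where
  "coefficient = g * \<zeta> * - ((4 * (n - 6) * H + (n - 1) * c\<^sup>2) / c) +
     g * (\<zeta> * (n - 1) * s\<^sup>2 * b\<^sup>2 / (H * c) + \<omega> * (n - 1) * s / H)"

lemma coefficient_eq: "coefficient * (c * H\<^sup>2) = - g * el_poly n (b\<^sup>2) (s\<^sup>2)"
proof -
  have H: "1 - s\<^sup>2 + b\<^sup>2 * s\<^sup>2 = H" by (simp add: H_def cs)
  have "el_poly n (b\<^sup>2) (s\<^sup>2) = (2 * (n - 4) * H + (n - 1) * c\<^sup>2) * (4 * (n - 6) * H\<^sup>2 + (n - 1) * (c\<^sup>2 * H - b\<^sup>2 * s\<^sup>2))
      - (n - 1)\<^sup>2 * b\<^sup>2 * s\<^sup>2 * c\<^sup>2"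
    unfolding el_poly_def H unfolding cs[symmetric] ..
  also have "2 * (n - 4) * H + (n - 1) * c\<^sup>2 = \<zeta> * H" using H_pos by (simp add: \<zeta>_def distrib_right)
  also have "(n - 1)\<^sup>2 * b\<^sup>2 * s\<^sup>2 * c\<^sup>2 = \<omega> * H * (n - 1) * c * s"
    using H_pos by (simp add: \<omega>_def power2_eq_square)
  finally have poly: "el_poly n (b\<^sup>2) (s\<^sup>2) = \<zeta> * H * (4 * (n - 6) * H\<^sup>2 + (n - 1) * (c\<^sup>2 * H - b\<^sup>2 * s\<^sup>2)) - \<omega> * H * (n - 1) * c * s" .
  show ?thesis
    unfolding poly coefficient_def using H_pos sc by (simp add: field_simps power2_eq_square)
qed

text \<open>Green's formula moves the remaining Laplacian from \<open>V\<close> to \<open>\<Psi>\<close>.\<close>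

lemma phi_first_variation:
  assumes K: "compact K" "K \<subseteq> U"
    and supp: "\<And>t x. t \<in> {-\<epsilon><..<\<epsilon>} \<Longrightarrow> x \<in> U - K \<Longrightarrow> F (t, x) = F (0, x)"
  shows "((\<lambda>t. trienergy (ellipsoid b) K (\<lambda>x. F (t, x))) has_real_derivative
     coefficient * (\<integral>x. inverse (norm x) ^ 7 * (x \<bullet> fst (V x)) \<partial>lebesgue_on K)) (at 0)"
proof -
  note fv = trienergy_first_variation[OF K supp w_parallel smooth_w W0]
  define k1 where "k1 = g * (\<zeta> * (n - 1) * s\<^sup>2 * b\<^sup>2 / (H * c) + \<omega> * (n - 1) * s / H)"
  define k2 where "k2 = - ((4 * (n - 6) * H + (n - 1) * c\<^sup>2) / c)"
  let ?q = "\<lambda>x. inverse (norm x) ^ 7 * (x \<bullet> fst (V x))"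
  let ?\<Delta>V = "\<lambda>x. \<Sum>e\<in>Basis. dir_deriv e (dir_deriv e V) x"
  have s\<Psi>: "smooth_on U \<Psi>" unfolding \<Psi>_def using U0 by (intro smooth_on_subset[OF smooth_on_radial]) auto
  have "smooth_on U ?q"
    using U U0 smooth_V
    by (intro smooth_on_mult smooth_on_inner smooth_on_id smooth_on_linear[OF U bounded_linear_fst]
        smooth_on_subset[OF homog_smooth[OF homog_rad_power]]) auto
  then have iq: "integrable (lebesgue_on K) ?q"
    using K by (intro integrable_lebesgue_on_compact continuous_on_subset[OF smooth_on_continuous])
  have "smooth_on U (\<lambda>x. \<Psi> x \<bullet> ?\<Delta>V x)"
    using U smooth_V s\<Psi> by (intro smooth_on_inner smooth_on_sum smooth_on_dir_deriv)
  then have i\<Psi>: "integrable (lebesgue_on K) (\<lambda>x. \<Psi> x \<bullet> ?\<Delta>V x)"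
    using K by (intro integrable_lebesgue_on_compact continuous_on_subset[OF smooth_on_continuous])
  have "- (\<integral>x. (\<Sum>e\<in>Basis. dir_deriv e (dir_deriv e w) x) \<bullet> y x \<partial>lebesgue_on K) =
      (\<integral>x. - ((\<Sum>e\<in>Basis. dir_deriv e (dir_deriv e w) x) \<bullet> y x) \<partial>lebesgue_on K)" by simp
  also have "\<dots> = (\<integral>x. g * \<zeta> * (\<Psi> x \<bullet> ?\<Delta>V x) + k1 * ?q x \<partial>lebesgue_on K)"
    using K laplace_w_inner_y unfolding k1_def by (intro Bochner_Integration.integral_cong) auto
  also have "\<dots> = g * \<zeta> * (\<integral>x. \<Psi> x \<bullet> ?\<Delta>V x \<partial>lebesgue_on K) + k1 * (\<integral>x. ?q x \<partial>lebesgue_on K)"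
    using iq i\<Psi> by simp
  also have "(\<integral>x. \<Psi> x \<bullet> ?\<Delta>V x \<partial>lebesgue_on K) =
      (\<integral>x. (\<Sum>e\<in>Basis. dir_deriv e (dir_deriv e \<Psi>) x) \<bullet> V x \<partial>lebesgue_on K)"
    by (rule green_formula[OF U K s\<Psi> smooth_V fv(2)])
  also have "\<dots> = (\<integral>x. k2 * ?q x \<partial>lebesgue_on K)"
    using K laplace_\<Psi>_inner_V unfolding k2_def by (intro Bochner_Integration.integral_cong) auto
  also have "\<dots> = k2 * (\<integral>x. ?q x \<partial>lebesgue_on K)" using iq by simp
  finally have "- (\<integral>x. (\<Sum>e\<in>Basis. dir_deriv e (dir_deriv e w) x) \<bullet> y x \<partial>lebesgue_on K) =
      coefficient * (\<integral>x. ?q x \<partial>lebesgue_on K)"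
    unfolding coefficient_def k1_def[symmetric] k2_def[symmetric] by (simp add: algebra_simps)
  then show ?thesis using fv(1) by simp
qed

end

section \<open>Zeros of the Euler-Lagrange polynomial\<close>

text \<open>With \<open>C = 1 - S\<close> and \<open>k = \<beta> S\<close>, the hypothesis on \<open>\<beta>\<close> makes the only possibly negative part of the
  second factor nonnegative. The product is then compared with \<open>(n - 1)\<^sup>2 k C (S + C)\<close> one monomial in
  \<open>k\<close> and \<open>C\<close> at a time, where \<open>S + C = 1\<close>.\<close>

lemma el_poly_pos:
  assumes n: "n \<ge> 7" and \<beta>: "\<beta> > 0" "(n - 1) \<le> 4 * (n - 6) * \<beta>" and S: "0 < S" "S < 1"
  shows "el_poly n \<beta> S > 0"
proof -
  define C where "C = 1 - S"
  define k where "k = \<beta> * S"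
  define A where "A = (3 * n - 9) * C + 2 * (n - 4) * k"
  define B where "B = (5 * n - 25) * C\<^sup>2 + 8 * (n - 6) * k * C"
  have pos: "C > 0" "k > 0" "A > 0" using S \<beta> n by (auto simp: C_def k_def A_def intro!: add_pos_pos)
  have SC: "S = 1 - C" by (simp add: C_def)
  have "el_poly n \<beta> S = A * (B + k * (4 * (n - 6) * k - (n - 1) * S)) - (n - 1)\<^sup>2 * k * C * (S + C)"
    unfolding el_poly_def A_def B_def k_def C_def by (simp add: algebra_simps power2_eq_square)
  moreover have "A * (k * (4 * (n - 6) * k - (n - 1) * S)) \<ge> 0"
  proof -
    have "(n - 1) * S \<le> 4 * (n - 6) * \<beta> * S" using \<beta>(2) S by (intro mult_right_mono) auto
    then have "4 * (n - 6) * k - (n - 1) * S \<ge> 0" by (simp add: k_def mult.assoc)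
    then show ?thesis using pos by (intro mult_nonneg_nonneg) auto
  qed
  moreover have "A * B > (n - 1)\<^sup>2 * k * C * (S + C)"
  proof -
    have "(n - 1)\<^sup>2 * (k * S) \<le> 16 * (n - 4) * (n - 6) * (k * k)"
    proof -
      have "(n - 1) * S \<le> 4 * (n - 6) * k" using mult_right_mono[OF \<beta>(2), of S] S by (simp add: k_def mult.assoc)
      moreover have "(n - 1) * k \<le> 4 * (n - 4) * k" using n pos by (intro mult_right_mono) auto
      ultimately have "(n - 1) * k * ((n - 1) * S) \<le> 4 * (n - 4) * k * (4 * (n - 6) * k)"
        using n pos S by - (rule mult_mono, auto)
      then show ?thesis by (simp add: power2_eq_square algebra_simps)
    qed
    moreover have "(n - 1)\<^sup>2 * (k * C) \<le> ((3 * n - 9) * (8 * (n - 6)) + 2 * (n - 4) * (5 * n - 25)) * (k * C)"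
    proof (rule mult_right_mono)
      have "(3 * n - 9) * (8 * (n - 6)) + 2 * (n - 4) * (5 * n - 25) - (n - 1)\<^sup>2 =
          33 * (n - 7)\<^sup>2 + 158 * (n - 7) + 120" by (simp add: power2_eq_square algebra_simps)
      moreover have "\<dots> \<ge> 0" using n by (intro add_nonneg_nonneg mult_nonneg_nonneg) auto
      ultimately show "(n - 1)\<^sup>2 \<le> (3 * n - 9) * (8 * (n - 6)) + 2 * (n - 4) * (5 * n - 25)" by linarith
    qed (use pos in auto)
    moreover have "0 < (3 * n - 9) * (5 * n - 25) * (C * C)" using n pos by (intro mult_pos_pos) auto
    ultimately have "(n - 1)\<^sup>2 * (k * S) + (n - 1)\<^sup>2 * (k * C) < (3 * n - 9) * (5 * n - 25) * (C * C) +
       ((3 * n - 9) * (8 * (n - 6)) + 2 * (n - 4) * (5 * n - 25)) * (k * C) + 16 * (n - 4) * (n - 6) * (k * k)"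
      by linarith
    from mult_strict_right_mono[OF this pos(1)] show ?thesis
      unfolding A_def B_def by (simp add: power2_eq_square algebra_simps)
  qed
  ultimately show ?thesis by (simp add: distrib_left)
qed

text \<open>At \<open>S = 0\<close> the polynomial is positive; at \<open>S = 1\<close> its sign is that of
  \<open>4 (n - 6) \<beta> - (n - 1)\<close>.\<close>

lemma el_poly_root_iff:
  assumes n: "n \<ge> 7" and \<beta>: "\<beta> > 0"
  shows "(\<exists>S. 0 < S \<and> S < 1 \<and> el_poly n \<beta> S = 0) \<longleftrightarrow> \<beta> < (n - 1) / (4 * (n - 6))"
proof
  assume "\<exists>S. 0 < S \<and> S < 1 \<and> el_poly n \<beta> S = 0"
  then have "\<not> (n - 1) \<le> 4 * (n - 6) * \<beta>" using el_poly_pos[OF n \<beta>] by fastforce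
  then show "\<beta> < (n - 1) / (4 * (n - 6))" using n by (simp add: pos_less_divide_eq mult.commute)
next
  assume "\<beta> < (n - 1) / (4 * (n - 6))"
  then have lt: "4 * (n - 6) * \<beta> < n - 1" using n by (simp add: pos_less_divide_eq mult.commute)
  have 0: "el_poly n \<beta> 0 > 0" using n by (auto simp: el_poly_def intro!: mult_pos_pos add_pos_pos)
  have "el_poly n \<beta> 1 = (2 * (n - 4) * \<beta>) * (\<beta> * (4 * (n - 6) * \<beta> - (n - 1)))"
    by (simp add: el_poly_def power2_eq_square algebra_simps)
  then have 1: "el_poly n \<beta> 1 < 0" using n \<beta> lt by (auto intro!: mult_pos_neg)
  have "continuous_on {0..1} (el_poly n \<beta>)" unfolding el_poly_def by (intro continuous_intros)
  then obtain S where "0 \<le> S" "S \<le> 1" "el_poly n \<beta> S = 0"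
    using IVT2'[of "el_poly n \<beta>" 1 0 0] 0 1 by auto
  then have "0 < S \<and> S < 1 \<and> el_poly n \<beta> S = 0" using 0 1 by (metis less_eq_real_def less_irrefl)
  then show "\<exists>S. 0 < S \<and> S < 1 \<and> el_poly n \<beta> S = 0" by blast
qed


section \<open>Harmonicity and triharmonicity of \<open>\<phi>\<^sub>a\<close>\<close>

lemma open_punctured_ball: "open (ball (0::'a::euclidean_space) 1 - {0})"
  by (intro open_Diff) auto

lemma smooth_map_phi: "b > 0 \<Longrightarrow> 0 \<notin> U \<Longrightarrow> smooth_map U (ellipsoid b) (phi b a)"
  using smooth_on_phi[of U b a] phi_in_ellipsoid[of b _ a] unfolding smooth_map_def by (metis image_subsetI)

text \<open>The tension field is read off from the constant variation of \<open>\<phi>\<^sub>a\<close>.\<close>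

lemma tension_phi_nonzero:
  fixes x :: "real ^ 'n"
  assumes "b > 0" "0 < a" "a < pi / 2" "CARD('n) > 1" "x \<noteq> 0"
  shows "tension (ellipsoid b) (phi b a) x \<noteq> 0"
proof -
  interpret phi_variation b 1 "- {0 :: real ^ 'n}" "\<lambda>z. phi b a (snd z)" a "real CARD('n)"
  proof
    have o: "open ({-1<..<1::real} \<times> - {0 :: real ^ 'n})" by (intro open_Times open_Compl) auto
    show "smooth_on ({-1<..<1::real} \<times> - {0}) (\<lambda>z. phi b a (snd z) :: (real ^ 'n) \<times> real)"
      by (rule smooth_on_compose[OF o smooth_on_linear_id[OF o bounded_linear_snd], of "- {0}" "phi b a"])
        (auto intro: smooth_on_phi)
  qed (use assms in \<open>auto simp: open_Compl intro!: phi_in_ellipsoid\<close>)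
  have "tension (ellipsoid b) (phi b a) x = w x"
    using tension_slice[of 0 x] W0[of x] assms by simp
  moreover have "fst (w x) \<noteq> 0"
    using sc H_pos assms by (simp add: w_def radial_def g_def)
  ultimately show ?thesis by force
qed

lemma triharmonic_phi:
  assumes b: "b > 0" and a: "0 < a" "a < pi / 2"
    and root: "el_poly (real CARD('n)) (b\<^sup>2) ((sin a)\<^sup>2) = 0"
  shows "triharmonic_on (ball 0 1 - {0}) (ellipsoid b) (phi b a :: real ^ 'n \<Rightarrow> _)"
  unfolding triharmonic_on_def
proof (intro conjI allI impI)
  let ?U = "ball 0 1 - {0 :: real ^ 'n}"
  show "smooth_map ?U (ellipsoid b) (phi b a)" using b by (intro smooth_map_phi) auto
  fix K and \<Phi> :: "real \<Rightarrow> real ^ 'n \<Rightarrow> (real ^ 'n) \<times> real"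
  assume *: "compact K \<and> K \<subseteq> ?U \<and> variation ?U (ellipsoid b) K (phi b a) \<Phi>"
  then obtain \<epsilon> where var: "\<epsilon> > 0" "smooth_map ({-\<epsilon><..<\<epsilon>} \<times> ?U) (ellipsoid b) (\<lambda>(t, x). \<Phi> t x)"
      "\<And>x. x \<in> ?U \<Longrightarrow> \<Phi> 0 x = phi b a x"
      "\<And>t x. t \<in> {-\<epsilon><..<\<epsilon>} \<Longrightarrow> x \<in> ?U - K \<Longrightarrow> \<Phi> t x = phi b a x"
    unfolding variation_def by blast
  interpret phi_variation b \<epsilon> ?U "\<lambda>(t, x). \<Phi> t x" a "real CARD('n)"
  proof
    show "(case z of (t, x) \<Rightarrow> \<Phi> t x) \<in> ellipsoid b" if "z \<in> {-\<epsilon><..<\<epsilon>} \<times> ?U" for z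
      using var(2) that unfolding smooth_map_def by blast
  qed (use var(1-3) a b open_punctured_ball in \<open>auto simp: smooth_map_def\<close>)
  have supp: "(case (t, x) of (t, x) \<Rightarrow> \<Phi> t x) = (case (0, x) of (t, x) \<Rightarrow> \<Phi> t x)" if "t \<in> {-\<epsilon><..<\<epsilon>}" "x \<in> ?U - K" for t x
    using var(3)[of x] var(4)[OF that] that by simp
  have "coefficient = 0" using coefficient_eq sc H_pos by (simp add: root)
  with phi_first_variation[OF _ _ supp] *
  show "((\<lambda>t. trienergy (ellipsoid b) K (\<Phi> t)) has_real_derivative 0) (at 0)" by simp
qed

text \<open>Conversely it suffices to test with one variation that moves \<open>\<phi>\<^sub>a\<close> along the meridians,
  because it makes the integral in the first variation positive.\<close>

lemma triharmonic_phi_imp_root: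
  assumes b: "b > 0" and a: "0 < a" "a < pi / 2" and dim: "CARD('n) > 1"
    and tri: "triharmonic_on (ball 0 1 - {0}) (ellipsoid b) (phi b a :: real ^ 'n \<Rightarrow> _)"
  shows "el_poly (real CARD('n)) (b\<^sup>2) ((sin a)\<^sup>2) = 0"
proof -
  let ?U = "ball 0 1 - {0 :: real ^ 'n}"
  obtain e :: "real ^ 'n" where e: "e \<in> Basis" using nonempty_Basis by blast
  define p where "p = (1 / 2) *\<^sub>R e"
  have np: "norm p = 1 / 2" using e by (simp add: p_def)
  define K where "K = cball p (1 / 4)"
  define \<eta> where "\<eta> x = smooth_step (1 / 16 - (x - p) \<bullet> (x - p))" for x
  define \<Phi> where "\<Phi> t x = phi b (a + t * \<eta> x) x" for t and x :: "real ^ 'n"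
  have K: "compact K" "K \<subseteq> ?U"
  proof -
    have "x \<in> ?U" if "x \<in> K" for x
    proof -
      have "norm (x - p) \<le> 1 / 4" using that by (simp add: K_def dist_norm norm_minus_commute)
      moreover have "norm x \<le> norm (x - p) + norm p" "norm p \<le> norm x + norm (x - p)"
        using norm_triangle_ineq[of "x - p" p] norm_triangle_ineq4[of x "x - p"] by auto
      ultimately show ?thesis using np by auto
    qed
    then show "K \<subseteq> ?U" by blast
  qed (simp add: K_def)
  have sq: "(x - p) \<bullet> (x - p) = (norm (x - p))\<^sup>2" for x by (simp add: power2_norm_eq_inner)
  have \<eta>_out: "\<eta> x = 0" if "x \<notin> K" for x
  proof -
    have "1 / 4 < norm (x - p)" using that by (simp add: K_def dist_norm norm_minus_commute)
    then have "(1 / 4)\<^sup>2 \<le> (norm (x - p))\<^sup>2" by (intro power_mono) auto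
    then show ?thesis unfolding \<eta>_def sq by (intro smooth_step_nonpos) (simp add: power2_eq_square)
  qed
  have \<eta>_in: "\<eta> x > 0" if "x \<in> ball p (1 / 4)" for x
  proof -
    have "norm (x - p) < 1 / 4" using that by (simp add: dist_norm norm_minus_commute)
    then have "(norm (x - p))\<^sup>2 < (1 / 4)\<^sup>2" by (intro power_strict_mono) auto
    then show ?thesis unfolding \<eta>_def sq by (intro smooth_step_pos) (simp add: power2_eq_square)
  qed
  have smooth: "smooth_on ({-1<..<1} \<times> ?U) (\<lambda>(t, x). \<Phi> t x)"
  proof -
    let ?\<Omega> = "{-1<..<1::real} \<times> ?U"
    have o: "open ?\<Omega>" using open_punctured_ball by (intro open_Times) auto
    note L = smooth_on_linear_id[OF o bounded_linear_fst] smooth_on_linear_id[OF o bounded_linear_snd]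
    have \<eta>: "smooth_on ?\<Omega> (\<lambda>z. \<eta> (snd z))"
      unfolding \<eta>_def by (intro smooth_on_smooth_step smooth_on_sub smooth_on_inner L o smooth_on_const)
    have \<theta>: "smooth_on ?\<Omega> (\<lambda>z. a + fst z * \<eta> (snd z))"
      by (intro smooth_on_add smooth_on_mult L \<eta> o smooth_on_const)
    have \<rho>: "smooth_on ?\<Omega> (\<lambda>z. inverse (norm (snd z)))"
      by (rule smooth_on_compose[OF o L(2) homog_smooth[OF homog_rad]]) auto
    have "smooth_on ?\<Omega> (\<lambda>z. (sin (a + fst z * \<eta> (snd z)) *\<^sub>R (inverse (norm (snd z)) *\<^sub>R snd z),
        b * cos (a + fst z * \<eta> (snd z))))"
      by (intro smooth_on_Pair smooth_on_scaleR smooth_on_mult smooth_on_sin smooth_on_cos \<theta> \<rho> L o smooth_on_const)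
    then show ?thesis by (simp add: \<Phi>_def phi_def case_prod_unfold)
  qed
  interpret phi_variation b 1 ?U "\<lambda>(t, x). \<Phi> t x" a "real CARD('n)"
  proof
    show "(case z of (t, x) \<Rightarrow> \<Phi> t x) \<in> ellipsoid b" if "z \<in> {-1<..<1} \<times> ?U" for z
      using that b by (auto simp: \<Phi>_def intro!: phi_in_ellipsoid)
  qed (use smooth a b open_punctured_ball in \<open>auto simp: \<Phi>_def\<close>)
  let ?q = "\<lambda>x. inverse (norm x) ^ 7 * (x \<bullet> fst (V x))"
  have q: "?q x = cos a * \<eta> x * inverse (norm x) ^ 6" if x: "x \<in> ?U" for x
  proof -
    have "((\<lambda>t. \<Phi> t x) has_vector_derivative V x) (at 0)"
      using slice_real_derivative[OF smooth_on_diff[OF F zero_in[OF x]]] by (simp add: V_def)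
    then have "((\<lambda>t. fst (\<Phi> t x)) has_vector_derivative fst (V x)) (at 0)"
      by (rule bounded_linear.has_vector_derivative[OF bounded_linear_fst])
    moreover have "((\<lambda>t. fst (\<Phi> t x)) has_vector_derivative (cos a * \<eta> x) *\<^sub>R (x /\<^sub>R norm x)) (at 0)"
    proof -
      have "((\<lambda>t. sin (a + t * \<eta> x)) has_real_derivative cos (a + 0 * \<eta> x) * \<eta> x) (at 0)"
        by (auto intro!: derivative_eq_intros)
      then have "((\<lambda>t. sin (a + t * \<eta> x) *\<^sub>R (x /\<^sub>R norm x)) has_vector_derivative
         (sin (a + 0 * \<eta> x) *\<^sub>R 0 + (cos (a + 0 * \<eta> x) * \<eta> x) *\<^sub>R (x /\<^sub>R norm x))) (at 0)"
        by (intro has_vector_derivative_scaleR has_vector_derivative_const)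
      then show ?thesis by (simp add: \<Phi>_def phi_def)
    qed
    ultimately have "fst (V x) = (cos a * \<eta> x) *\<^sub>R (x /\<^sub>R norm x)" by (rule vector_derivative_unique_at)
    then have "?q x = cos a * \<eta> x * inverse (norm x) ^ 6 * (inverse (norm x) * inverse (norm x) * (x \<bullet> x))"
      by (simp add: numeral_eq_Suc)
    then show ?thesis unfolding rho2[OF x] by simp
  qed
  have \<eta>0: "\<eta> x \<ge> 0" for x by (simp add: \<eta>_def smooth_step_bounds)
  have int: "(\<integral>x. ?q x \<partial>lebesgue_on K) \<noteq> 0"
  proof
    assume 0: "(\<integral>x. ?q x \<partial>lebesgue_on K) = 0"
    have "smooth_on ?U ?q"
      using U U0 smooth_V
      by (intro smooth_on_mult smooth_on_inner smooth_on_id smooth_on_linear[OF U bounded_linear_fst]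
          smooth_on_subset[OF homog_smooth[OF homog_rad_power]]) auto
    then have "integrable (lebesgue_on K) ?q"
      using K by (intro integrable_lebesgue_on_compact continuous_on_subset[OF smooth_on_continuous])
    moreover have "AE x in lebesgue_on K. 0 \<le> ?q x"
    proof (rule AE_I2)
      fix x assume "x \<in> space (lebesgue_on K)"
      then have "x \<in> ?U" using K(2) by auto
      then show "0 \<le> ?q x" unfolding q[OF \<open>x \<in> ?U\<close>] using \<eta>0[of x] sc by simp
    qed
    ultimately have "AE x in lebesgue_on K. ?q x = 0" using 0 integral_nonneg_eq_0_iff_AE by blast
    then have "AE x in lebesgue. x \<in> K \<longrightarrow> ?q x = 0"
      using K(1) by (subst (asm) AE_restrict_space_iff) (auto simp: compact_imp_closed)
    then have "AE x in lebesgue. x \<notin> ball p (1 / 4)"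
    proof eventually_elim
      fix x assume x: "x \<in> K \<longrightarrow> ?q x = 0"
      show "x \<notin> ball p (1 / 4)"
      proof
        assume b4: "x \<in> ball p (1 / 4)"
        then have "x \<in> K" by (auto simp: K_def)
        then have "x \<in> ?U" using K by blast
        then show False using x \<open>x \<in> K\<close> \<eta>_in[OF b4] sc unfolding q[OF \<open>x \<in> ?U\<close>] by auto
      qed
    qed
    then have "ball p (1 / 4) \<in> null_sets lebesgue"
      by (subst AE_iff_null_sets) auto
    then show False using open_not_negligible[of "ball p (1 / 4)"] by (simp add: negligible_iff_null_sets)
  qed
  have d1: "((\<lambda>t. trienergy (ellipsoid b) K (\<Phi> t)) has_real_derivative
      coefficient * (\<integral>x. ?q x \<partial>lebesgue_on K)) (at 0)"
  proof -
    have "(case (t, x) of (t, x) \<Rightarrow> \<Phi> t x) = (case (0, x) of (t, x) \<Rightarrow> \<Phi> t x)"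
      if "t \<in> {-1<..<1}" "x \<in> ?U - K" for t x
      using \<eta>_out that by (simp add: \<Phi>_def)
    from phi_first_variation[OF K this] show ?thesis by simp
  qed
  have d2: "((\<lambda>t. trienergy (ellipsoid b) K (\<Phi> t)) has_real_derivative 0) (at 0)"
  proof -
    have "variation ?U (ellipsoid b) K (phi b a) \<Phi>"
      unfolding variation_def smooth_map_def
    proof (intro exI[of _ 1] conjI ballI)
      show "(\<lambda>(t, x). \<Phi> t x) ` ({-1<..<1} \<times> ?U) \<subseteq> ellipsoid b" using F_in by blast
      show "smooth_on ({-1<..<1} \<times> ?U) (\<lambda>(t, x). \<Phi> t x)" by (rule smooth)
    qed (use \<eta>_out in \<open>auto simp: \<Phi>_def\<close>)
    then show ?thesis using tri K unfolding triharmonic_on_def by blast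
  qed
  have "coefficient = 0" using DERIV_unique[OF d1 d2] int by simp
  then have "g * el_poly (real CARD('n)) (b\<^sup>2) ((sin a)\<^sup>2) = 0" using coefficient_eq by simp
  moreover have "g \<noteq> 0" using sc H_pos dim by (simp add: g_def)
  ultimately show ?thesis by simp
qed

lemma sobolev_into_phi:
  assumes "b > 0" "CARD('n::finite) \<ge> 7"
  shows "sobolev_into 3 (ball 0 1) (ellipsoid b) (phi b a :: real ^ 'n \<Rightarrow> _)"
  unfolding sobolev_into_def
proof
  show "sobolev 3 (ball 0 1) (phi b a :: real ^ 'n \<Rightarrow> _)"
  proof (rule homog_sobolev)
    fix i :: "(real ^ 'n) \<times> real" assume "i \<in> Basis"
    have "phi b a x \<bullet> i = sin a * (x \<bullet> fst i * inverse (norm x)) + b * cos a * snd i" for x :: "real ^ 'n"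
      by (cases i) (simp add: phi_def)
    then show "homog 0 (\<lambda>x. phi b a x \<bullet> i)"
      using homog_add[OF homog_scale[OF homog_dir[of "fst i"], of "sin a"] homog_const[of "b * cos a * snd i"]] by simp
  qed (use assms in auto)
  show "AE x in lebesgue_on (ball 0 1). (phi b a :: real ^ 'n \<Rightarrow> _) x \<in> ellipsoid b"
    using AE_lebesgue_on_ball_nonzero by eventually_elim (rule phi_in_ellipsoid[OF assms(1)])
qed

lemma proper_weakly_triharmonic_phi_iff:
  assumes "b > 0" "CARD('n::finite) \<ge> 7" "0 < a" "a < pi / 2"
  shows "proper_weakly_triharmonic (ellipsoid b) (phi b a :: real ^ 'n \<Rightarrow> _) \<longleftrightarrow>
    el_poly (real CARD('n)) (b\<^sup>2) ((sin a)\<^sup>2) = 0"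
proof -
  obtain e :: "real ^ 'n" where e: "e \<in> Basis" using nonempty_Basis by blast
  then have "(1 / 2) *\<^sub>R e \<in> ball 0 1 - {0}" by (auto simp: nonzero_Basis)
  moreover have "tension (ellipsoid b) (phi b a) ((1 / 2) *\<^sub>R e) \<noteq> 0"
    using assms e by (intro tension_phi_nonzero) (auto simp: nonzero_Basis)
  ultimately have "\<not> weakly_harmonic (ellipsoid b) (phi b a :: real ^ 'n \<Rightarrow> _)"
    unfolding weakly_harmonic_def harmonic_on_def by blast
  then show ?thesis
    unfolding proper_weakly_triharmonic_def weakly_triharmonic_def
    using sobolev_into_phi[OF assms(1,2)] triharmonic_phi[where 'n = 'n, OF assms(1,3,4)]
      triharmonic_phi_imp_root[where 'n = 'n, OF assms(1,3,4)] assms(2) by auto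
qed

theorem theorem1p9:
  fixes b :: real
  assumes "CARD('n::finite) \<ge> 7" and "b > 0"
  shows "(\<exists>a\<in>{0<..<pi / 2}.
            proper_weakly_triharmonic (ellipsoid b) (phi b a :: real ^ 'n \<Rightarrow> (real ^ 'n) \<times> real))
         \<longleftrightarrow> 0 < b\<^sup>2 \<and> b\<^sup>2 < (real CARD('n) - 1) / (4 * (real CARD('n) - 6))"
proof -
  let ?n = "real CARD('n)"
  have "(\<exists>a\<in>{0<..<pi / 2}.
            proper_weakly_triharmonic (ellipsoid b) (phi b a :: real ^ 'n \<Rightarrow> (real ^ 'n) \<times> real))
     \<longleftrightarrow> (\<exists>a\<in>{0<..<pi / 2}. el_poly ?n (b\<^sup>2) ((sin a)\<^sup>2) = 0)"
    using proper_weakly_triharmonic_phi_iff[OF assms(2,1)] by auto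
  also have "\<dots> \<longleftrightarrow> (\<exists>S. 0 < S \<and> S < 1 \<and> el_poly ?n (b\<^sup>2) S = 0)"
  proof
    assume "\<exists>a\<in>{0<..<pi / 2}. el_poly ?n (b\<^sup>2) ((sin a)\<^sup>2) = 0"
    then obtain a where a: "0 < a" "a < pi / 2" "el_poly ?n (b\<^sup>2) ((sin a)\<^sup>2) = 0" by auto
    have "sin a > 0" "cos a > 0" using a by (auto intro: sin_gt_zero cos_gt_zero)
    then have "0 < (sin a)\<^sup>2" "0 < (cos a)\<^sup>2" by auto
    then have "0 < (sin a)\<^sup>2 \<and> (sin a)\<^sup>2 < 1" using sin_cos_squared_add[of a] by linarith
    then show "\<exists>S. 0 < S \<and> S < 1 \<and> el_poly ?n (b\<^sup>2) S = 0" using a(3) by blast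
  next
    assume "\<exists>S. 0 < S \<and> S < 1 \<and> el_poly ?n (b\<^sup>2) S = 0"
    then obtain S where S: "0 < S" "S < 1" "el_poly ?n (b\<^sup>2) S = 0" by blast
    define a where "a = arcsin (sqrt S)"
    have "sin a = sqrt S" using S by (simp add: a_def order.trans[of "-1" 0])
    moreover have "0 < a" using S arcsin_less_arcsin[of 0 "sqrt S"] by (simp add: a_def)
    moreover have "a < pi / 2" using S arcsin_less_arcsin[of "sqrt S" 1] by (simp add: a_def order.trans[of "-1" 0])
    ultimately show "\<exists>a\<in>{0<..<pi / 2}. el_poly ?n (b\<^sup>2) ((sin a)\<^sup>2) = 0"
      using S by (intro bexI[of _ a]) auto
  qed
  also have "\<dots> \<longleftrightarrow> b\<^sup>2 < (?n - 1) / (4 * (?n - 6))"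
    using assms by (intro el_poly_root_iff) auto
  finally show ?thesis using assms(2) by simp
qed

end
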